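(* Let $T>0$, let $E$ be a real Banach space, $\Omega\subset E$ a non-empty open subset, $\xi_0\in\Omega$, $U$ a Hausdorff topological space, $m,q\ge 1$ integers, and let $f:[0,T]\times\Omega\times U\to E$, $f^0:[0,T]\times\Omega\times U\to\mathbb R$, $g^\alpha:\Omega\to\mathbb R$ ($0\le\alpha\le m$), $h^\beta:\Omega\to\mathbb R$ ($1\le\beta\le q$) be functions. Let $(x_0,u_0)$ be a solution of the Bolza problem $(\mathcal B)$ (defined in the context). Assume: (1) for each $\phi\in\{f^0,f\}$ (with values in $F=\mathbb R$, resp. $F=E$): $\phi$ is continuous on $[0,T]\times\Omega\times U$; $D_{G,2}\phi(t,\xi,\zeta)$ exists for all $(t,\xi,\zeta)\in[0,T]\times\Omega\times U$; $D_{F,2}\phi(t,x_0(t),\zeta)$ exists for all $(t,\zeta)\in[0,T]\times U$ and $[(t,\zeta)\mapsto D_{F,2}\phi(t,x_0(t),\zeta)]\in C^0([0,T]\times U,\mathcal L(E,F))$; and for all non-empty compact $K\subset\Omega$, $M\subset U$, $\sup_{[0,T]\times K\times M}\|D_{G,2}\phi\|<+\infty$; (2) $g^\alpha$ is Hadamard differentiable at $x_0(T)$ for $0\le\alpha\le m$; for $1\le\beta\le q$, $h^\beta$ is continuous on a neighborhood of $x_0(T)$ and Hadamard differentiable at $x_0(T)$. Consider the conditions: (QC) If $(c_\alpha)_{1\le\alpha\le m}\in\mathbb R_+^m$ and $(d_\beta)_{1\le\beta\le q}\in\mathbb R^q$ satisfy $c_\alpha g^\alpha(x_0(T))=0$ for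 all $\alpha\in\{1,\dots,m\}$ and $\sum_{\alpha=1}^mc_\alpha D_Gg^\alpha(x_0(T))+\sum_{\beta=1}^qd_\beta D_Gh^\beta(x_0(T))=0$, then all $c_\alpha$ and all $d_\beta$ are $0$. (Surj) $U$ is a subset of a real normed vector space $Y$, and there exists $\hat t\in[0,T]$ such that $U$ is a neighborhood of $u_0(\hat t)$ in $Y$, and $D_{G,3}f(\hat t,x_0(\hat t),u_0(\hat t))$ exists and is surjective. (LI) $U$ is a subset of a real normed vector space $Y$, $U$ is a neighborhood of $u_0(T)$ in $Y$, $D_{G,3}f(T,x_0(T),u_0(T))$ exists, and the family consisting of $D_Hg^\alpha(x_0(T))\circ D_{G,3}f(T,x_0(T),u_0(T))$ ($1\le\alpha\le m$) and $D_Hh^\beta(x_0(T))\circ D_{G,3}f(T,x_0(T),u_0(T))$ ($1\le\beta\le q$) is linearly independent. Then, with Pontryagin triples as defined in the context: (i) Under (QC), every Pontryagin triple satisfies $(\lambda_0,p(t))\ne0$ for all $t\in[0,T]$. (ii) Under (QC) and (Surj), there is a Pontryagin triple with $\lambda_0=1$. (iii) Under (LI), there is a Pontryagin triple with $\lambda_0=1$. (iv) Under (LI), if in addition $D_{G,3}f^0(T,x_0(T),u_0(T))$ exists, then the Pontryagin triple with $\lambda_0=1$ is unique.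
   Context: Function spaces. For a Hausdorff topological space $W$, $PC^0([0,T],W)$ is the set of $x:[0,T]\to W$ which are continuous, or for which there is a subdivision $0=\tau_0<\tau_1<\dots<\tau_{k+1}=T$ such that $x$ is continuous at every $t\notin\{\tau_i\}$, the right limit $x(\tau_i+)$ exists in $W$ for $0\le i\le k$ and the left limit $x(\tau_i-)$ exists in $W$ for $1\le i\le k+1$. $NPC^0_R([0,T],W)$ is the set of $x\in PC^0([0,T],W)$ which are right-continuous on $[0,T[$ and left-continuous at $T$. For $W$ a subset of a real normed space, $PC^1([0,T],W)$ is the set of continuous $x:[0,T]\to W$ which are continuously differentiable, or for which there is a subdivision $0=\tau_0<\tau_1<\dots<\tau_{k+1}=T$ such that $x$ is continuously differentiable at every $t\notin\{\tau_i\}$, the right derivative $x'_R(\tau_i)=x'(\tau_i+)$ exists for $0\le i\le k$ and the left derivative $x'_L(\tau_i)=x'(\tau_i-)$ exists for $1\le i\le k+1$. The extended derivative is $\underline d x(t):=x'(t)$ if $t\notin\{\tau_i\}$, $\underline d x(\tau_i):=x'_R(\tau_i)$ for $0\le i\le k$, $\underline d x(T):=x'_L(T)$. Differentials. $D_G\mathfrak f(x)$, $D_H\mathfrak f(x)$, $D_F\mathfrak f(x)$ are the Gâteaux, Hadamard, Fréchet differentials (continuous linear maps). $D_G\mathfrak f(x)\cdot v=\lim_{\theta\to0+}(\mathfrak f(x+\theta v)-\mathfrak f(x))/\theta$ for all $v$; $\mathfrak f$ is Hadamard differentiable at $x$ when moreover $\lim_{\theta\to0+,\,w\to v}(\mathfrak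 f(x+\theta w)-\mathfrak f(x))/\theta=D_H\mathfrak f(x)\cdot v$ for all $v$. A subscript $i$, as in $D_{G,i},D_{H,i},D_{F,i}$, denotes the partial differential with respect to the $i$-th variable. Problem $(\mathcal B)$: maximize $\int_0^Tf^0(t,x(t),u(t))\,dt+g^0(x(T))$ over the admissible processes, i.e. the pairs $(x,u)\in PC^1([0,T],\Omega)\times NPC^0_R([0,T],U)$ with $\underline d x(t)=f(t,x(t),u(t))$ for all $t\in[0,T]$, $x(0)=\xi_0$, $g^\alpha(x(T))\ge0$ for $1\le\alpha\le m$, and $h^\beta(x(T))=0$ for $1\le\beta\le q$. A solution is an admissible process attaining the maximum. Pontryagin triple: with $H_B(t,\xi,\zeta,p,\lambda):=\lambda f^0(t,\xi,\zeta)+p\cdot f(t,\xi,\zeta)$, a Pontryagin triple (for $(x_0,u_0)$) is $((\lambda_\alpha)_{0\le\alpha\le m},(\mu_\beta)_{1\le\beta\le q},p)\in\mathbb R^{1+m}\times\mathbb R^q\times PC^1([0,T],E^* )$ such that: $((\lambda_\alpha),(\mu_\beta))\neq0$; $\lambda_\alpha\ge0$ for $0\le\alpha\le m$; $\lambda_\alpha g^\alpha(x_0(T))=0$ for $1\le\alpha\le m$; $\sum_{\alpha=0}^m\lambda_\alpha D_Hg^\alpha(x_0(T))+\sum_{\beta=1}^q\mu_\beta D_Hh^\beta(x_0(T))=p(T)$; $\underline d p(t)=-D_{F,2}H_B(t,x_0(t),u_0(t),p(t),\lambda_0)$ for all $t\in[0,T]$; $H_B(t,x_0(t),u_0(t),p(t),\lambda_0)\ge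 H_B(t,x_0(t),\zeta,p(t),\lambda_0)$ for all $t\in[0,T]$, $\zeta\in U$; and $[t\mapsto H_B(t,x_0(t),u_0(t),p(t),\lambda_0)]\in C^0([0,T],\mathbb R)$. *)

theory Defs
  imports "HOL-Analysis.Analysis"
begin

section \<open>Piecewise regular functions on a compact interval\<close>

text \<open>
  A function on \<open>[0,T]\<close> is a total function on \<open>real\<close> of which only the values on
  \<open>{0..T}\<close> matter: no notion below depends on the values elsewhere. A Hausdorff space
  \<open>W\<close> without further structure is an abstract topology, with carrier \<open>topspace W\<close>.
\<close>

definition subdivision :: "real \<Rightarrow> nat \<Rightarrow> (nat \<Rightarrow> real) \<Rightarrow> bool" where
  "subdivision T k \<tau> \<longleftrightarrow> \<tau> 0 = 0 \<and> \<tau> (Suc k) = T \<and> (\<forall>i\<le>k. \<tau> i < \<tau> (Suc i))"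

definition PC0 :: "real \<Rightarrow> 'w topology \<Rightarrow> (real \<Rightarrow> 'w) set" where
  "PC0 T W = {x. x \<in> {0..T} \<rightarrow> topspace W \<and>
     (continuous_map (top_of_set {0..T}) W x \<or>
      (\<exists>k \<tau>. subdivision T k \<tau> \<and>
        (\<forall>t \<in> {0..T} - \<tau> ` {0..Suc k}. topcontinuous_at (top_of_set {0..T}) W x t) \<and>
        (\<forall>i \<in> {0..k}. \<exists>l. limitin W x l (at_right (\<tau> i))) \<and>
        (\<forall>i \<in> {1..Suc k}. \<exists>l. limitin W x l (at_left (\<tau> i)))))}"

definition NPC0R :: "real \<Rightarrow> 'w topology \<Rightarrow> (real \<Rightarrow> 'w) set" where
  "NPC0R T W = {x \<in> PC0 T W.
     (\<forall>t \<in> {0..<T}. limitin W x (x t) (at_right t)) \<and> limitin W x (x T) (at_left T)}"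

text \<open>
  In the next definition the one-sided derivatives at the points of the subdivision are required
  to exist and to be equal to the one-sided limits of the derivative, as expressed by
  \<open>x'\<^sub>R(\<tau>\<^sub>i) = x'(\<tau>\<^sub>i+)\<close> and \<open>x'\<^sub>L(\<tau>\<^sub>i) = x'(\<tau>\<^sub>i-)\<close>.
\<close>

definition PC1 :: "real \<Rightarrow> 'w::real_normed_vector set \<Rightarrow> (real \<Rightarrow> 'w) set" where
  "PC1 T W = {x. x \<in> {0..T} \<rightarrow> W \<and> continuous_on {0..T} x \<and>
     ((\<exists>D. continuous_on {0..T} D \<and>
        (\<forall>t \<in> {0..T}. (x has_vector_derivative D t) (at t within {0..T}))) \<or>
      (\<exists>k \<tau>. subdivision T k \<tau> \<and>
        x C1_differentiable_on ({0..T} - \<tau> ` {0..Suc k}) \<and>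
        (\<forall>i \<in> {0..k}. \<exists>d. (x has_vector_derivative d) (at_right (\<tau> i)) \<and>
           ((\<lambda>t. vector_derivative x (at t)) \<longlongrightarrow> d) (at_right (\<tau> i))) \<and>
        (\<forall>i \<in> {1..Suc k}. \<exists>d. (x has_vector_derivative d) (at_left (\<tau> i)) \<and>
           ((\<lambda>t. vector_derivative x (at t)) \<longlongrightarrow> d) (at_left (\<tau> i)))))}"

text \<open>
  The extended derivative of \<open>x \<in> PC1 T W\<close>. Where \<open>x\<close> is differentiable, the derivative is the
  right derivative, so that one formula covers all \<open>t < T\<close>, whatever the subdivision.
\<close>

definition ext_deriv :: "real \<Rightarrow> (real \<Rightarrow> 'w::real_normed_vector) \<Rightarrow> real \<Rightarrow> 'w" where
  "ext_deriv T x t =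
     (if t < T then vector_derivative x (at_right t) else vector_derivative x (at_left t))"


section \<open>Differentials\<close>

definition has_gateaux_differential ::
    "('a::real_normed_vector \<Rightarrow> 'b::real_normed_vector) \<Rightarrow> ('a \<Rightarrow>\<^sub>L 'b) \<Rightarrow> 'a \<Rightarrow> bool" where
  "has_gateaux_differential \<phi> L x \<longleftrightarrow>
     (\<forall>v. ((\<lambda>\<theta>::real. (\<phi> (x + \<theta> *\<^sub>R v) - \<phi> x) /\<^sub>R \<theta>) \<longlongrightarrow> blinfun_apply L v) (at_right 0))"

definition gateaux_differentiable ::
    "('a::real_normed_vector \<Rightarrow> 'b::real_normed_vector) \<Rightarrow> 'a \<Rightarrow> bool" where
  "gateaux_differentiable \<phi> x \<longleftrightarrow> (\<exists>L. has_gateaux_differential \<phi> L x)"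

definition D_G :: "('a::real_normed_vector \<Rightarrow> 'b::real_normed_vector) \<Rightarrow> 'a \<Rightarrow> 'a \<Rightarrow>\<^sub>L 'b" where
  "D_G \<phi> x = (THE L. has_gateaux_differential \<phi> L x)"

definition has_hadamard_differential ::
    "('a::real_normed_vector \<Rightarrow> 'b::real_normed_vector) \<Rightarrow> ('a \<Rightarrow>\<^sub>L 'b) \<Rightarrow> 'a \<Rightarrow> bool" where
  "has_hadamard_differential \<phi> L x \<longleftrightarrow> has_gateaux_differential \<phi> L x \<and>
     (\<forall>v. ((\<lambda>(\<theta>::real, w). (\<phi> (x + \<theta> *\<^sub>R w) - \<phi> x) /\<^sub>R \<theta>) \<longlongrightarrow> blinfun_apply L v)
        (at_right 0 \<times>\<^sub>F nhds v))"

definition hadamard_differentiable ::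
    "('a::real_normed_vector \<Rightarrow> 'b::real_normed_vector) \<Rightarrow> 'a \<Rightarrow> bool" where
  "hadamard_differentiable \<phi> x \<longleftrightarrow> (\<exists>L. has_hadamard_differential \<phi> L x)"

definition D_H :: "('a::real_normed_vector \<Rightarrow> 'b::real_normed_vector) \<Rightarrow> 'a \<Rightarrow> 'a \<Rightarrow>\<^sub>L 'b" where
  "D_H \<phi> x = (THE L. has_hadamard_differential \<phi> L x)"

definition D_F :: "('a::real_normed_vector \<Rightarrow> 'b::real_normed_vector) \<Rightarrow> 'a \<Rightarrow> 'a \<Rightarrow>\<^sub>L 'b" where
  "D_F \<phi> x = Blinfun (frechet_derivative \<phi> (at x))"


section \<open>The Bolza problem\<close>

definition admissible ::
    "real \<Rightarrow> 'e::banach set \<Rightarrow> 'e \<Rightarrow> 'u topology \<Rightarrow> nat \<Rightarrow> nat \<Rightarrow>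
     (real \<Rightarrow> 'e \<Rightarrow> 'u \<Rightarrow> 'e) \<Rightarrow> (nat \<Rightarrow> 'e \<Rightarrow> real) \<Rightarrow> (nat \<Rightarrow> 'e \<Rightarrow> real) \<Rightarrow>
     (real \<Rightarrow> 'e) \<Rightarrow> (real \<Rightarrow> 'u) \<Rightarrow> bool" where
  "admissible T \<Omega> \<xi>\<^sub>0 U m q f g h x u \<longleftrightarrow>
     x \<in> PC1 T \<Omega> \<and> u \<in> NPC0R T U \<and>
     (\<forall>t \<in> {0..T}. ext_deriv T x t = f t (x t) (u t)) \<and>
     x 0 = \<xi>\<^sub>0 \<and>
     (\<forall>\<alpha> \<in> {1..m}. g \<alpha> (x T) \<ge> 0) \<and>
     (\<forall>\<beta> \<in> {1..q}. h \<beta> (x T) = 0)"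

definition bolza_cost ::
    "real \<Rightarrow> (real \<Rightarrow> 'e \<Rightarrow> 'u \<Rightarrow> real) \<Rightarrow> (nat \<Rightarrow> 'e \<Rightarrow> real) \<Rightarrow>
     (real \<Rightarrow> 'e) \<Rightarrow> (real \<Rightarrow> 'u) \<Rightarrow> real" where
  "bolza_cost T f\<^sub>0 g x u = integral {0..T} (\<lambda>t. f\<^sub>0 t (x t) (u t)) + g 0 (x T)"

definition bolza_solution ::
    "real \<Rightarrow> 'e::banach set \<Rightarrow> 'e \<Rightarrow> 'u topology \<Rightarrow> nat \<Rightarrow> nat \<Rightarrow>
     (real \<Rightarrow> 'e \<Rightarrow> 'u \<Rightarrow> real) \<Rightarrow> (real \<Rightarrow> 'e \<Rightarrow> 'u \<Rightarrow> 'e) \<Rightarrow>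
     (nat \<Rightarrow> 'e \<Rightarrow> real) \<Rightarrow> (nat \<Rightarrow> 'e \<Rightarrow> real) \<Rightarrow>
     (real \<Rightarrow> 'e) \<Rightarrow> (real \<Rightarrow> 'u) \<Rightarrow> bool" where
  "bolza_solution T \<Omega> \<xi>\<^sub>0 U m q f\<^sub>0 f g h x\<^sub>0 u\<^sub>0 \<longleftrightarrow>
     admissible T \<Omega> \<xi>\<^sub>0 U m q f g h x\<^sub>0 u\<^sub>0 \<and>
     (\<forall>x u. admissible T \<Omega> \<xi>\<^sub>0 U m q f g h x u \<longrightarrow>
        bolza_cost T f\<^sub>0 g x u \<le> bolza_cost T f\<^sub>0 g x\<^sub>0 u\<^sub>0)"


section \<open>Pontryagin triples\<close>

definition hamiltonian ::
    "(real \<Rightarrow> 'e::banach \<Rightarrow> 'u \<Rightarrow> real) \<Rightarrow> (real \<Rightarrow> 'e \<Rightarrow> 'u \<Rightarrow> 'e) \<Rightarrow>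
     real \<Rightarrow> 'e \<Rightarrow> 'u \<Rightarrow> ('e \<Rightarrow>\<^sub>L real) \<Rightarrow> real \<Rightarrow> real" where
  "hamiltonian f\<^sub>0 f t \<xi> \<zeta> p l = l * f\<^sub>0 t \<xi> \<zeta> + blinfun_apply p (f t \<xi> \<zeta>)"

definition pontryagin_triple ::
    "real \<Rightarrow> 'u topology \<Rightarrow> nat \<Rightarrow> nat \<Rightarrow>
     (real \<Rightarrow> 'e::banach \<Rightarrow> 'u \<Rightarrow> real) \<Rightarrow> (real \<Rightarrow> 'e \<Rightarrow> 'u \<Rightarrow> 'e) \<Rightarrow>
     (nat \<Rightarrow> 'e \<Rightarrow> real) \<Rightarrow> (nat \<Rightarrow> 'e \<Rightarrow> real) \<Rightarrow>
     (real \<Rightarrow> 'e) \<Rightarrow> (real \<Rightarrow> 'u) \<Rightarrow>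
     (nat \<Rightarrow> real) \<Rightarrow> (nat \<Rightarrow> real) \<Rightarrow> (real \<Rightarrow> 'e \<Rightarrow>\<^sub>L real) \<Rightarrow> bool" where
  "pontryagin_triple T U m q f\<^sub>0 f g h x\<^sub>0 u\<^sub>0 l \<mu> p \<longleftrightarrow>
     p \<in> PC1 T UNIV \<and>
     \<not> ((\<forall>\<alpha> \<in> {0..m}. l \<alpha> = 0) \<and> (\<forall>\<beta> \<in> {1..q}. \<mu> \<beta> = 0)) \<and>
     (\<forall>\<alpha> \<in> {0..m}. l \<alpha> \<ge> 0) \<and>
     (\<forall>\<alpha> \<in> {1..m}. l \<alpha> * g \<alpha> (x\<^sub>0 T) = 0) \<and>
     (\<Sum>\<alpha>=0..m. l \<alpha> *\<^sub>R D_H (g \<alpha>) (x\<^sub>0 T)) + (\<Sum>\<beta>=1..q. \<mu> \<beta> *\<^sub>R D_H (h \<beta>) (x\<^sub>0 T)) = p T \<and>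
     (\<forall>t \<in> {0..T}. ext_deriv T p t =
        - D_F (\<lambda>\<xi>. hamiltonian f\<^sub>0 f t \<xi> (u\<^sub>0 t) (p t) (l 0)) (x\<^sub>0 t)) \<and>
     (\<forall>t \<in> {0..T}. \<forall>\<zeta> \<in> topspace U.
        hamiltonian f\<^sub>0 f t (x\<^sub>0 t) (u\<^sub>0 t) (p t) (l 0) \<ge> hamiltonian f\<^sub>0 f t (x\<^sub>0 t) \<zeta> (p t) (l 0)) \<and>
     continuous_on {0..T} (\<lambda>t. hamiltonian f\<^sub>0 f t (x\<^sub>0 t) (u\<^sub>0 t) (p t) (l 0))"


section \<open>Hypotheses\<close>

definition integrand_regular ::
    "real \<Rightarrow> 'e::banach set \<Rightarrow> 'u topology \<Rightarrow> (real \<Rightarrow> 'e) \<Rightarrow>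
     (real \<Rightarrow> 'e \<Rightarrow> 'u \<Rightarrow> 'f::real_normed_vector) \<Rightarrow> bool" where
  "integrand_regular T \<Omega> U x\<^sub>0 \<phi> \<longleftrightarrow>
     continuous_map (prod_topology (top_of_set {0..T}) (prod_topology (top_of_set \<Omega>) U)) euclidean
       (\<lambda>(t, \<xi>, \<zeta>). \<phi> t \<xi> \<zeta>) \<and>
     (\<forall>t \<in> {0..T}. \<forall>\<xi> \<in> \<Omega>. \<forall>\<zeta> \<in> topspace U. gateaux_differentiable (\<lambda>y. \<phi> t y \<zeta>) \<xi>) \<and>
     (\<forall>t \<in> {0..T}. \<forall>\<zeta> \<in> topspace U. (\<lambda>y. \<phi> t y \<zeta>) differentiable (at (x\<^sub>0 t))) \<and>
     continuous_map (prod_topology (top_of_set {0..T}) U) euclidean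
       (\<lambda>(t, \<zeta>). D_F (\<lambda>y. \<phi> t y \<zeta>) (x\<^sub>0 t)) \<and>
     (\<forall>K M. K \<noteq> {} \<and> compact K \<and> K \<subseteq> \<Omega> \<and> M \<noteq> {} \<and> compactin U M \<longrightarrow>
        bdd_above ((\<lambda>(t, \<xi>, \<zeta>). norm (D_G (\<lambda>y. \<phi> t y \<zeta>) \<xi>)) ` ({0..T} \<times> K \<times> M)))"

definition terminal_regular ::
    "'e::banach set \<Rightarrow> nat \<Rightarrow> nat \<Rightarrow> (nat \<Rightarrow> 'e \<Rightarrow> real) \<Rightarrow> (nat \<Rightarrow> 'e \<Rightarrow> real) \<Rightarrow> 'e \<Rightarrow> bool" where
  "terminal_regular \<Omega> m q g h \<xi> \<longleftrightarrow>
     (\<forall>\<alpha> \<in> {0..m}. hadamard_differentiable (g \<alpha>) \<xi>) \<and>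
     (\<forall>\<beta> \<in> {1..q}. (\<exists>N. open N \<and> \<xi> \<in> N \<and> N \<subseteq> \<Omega> \<and> continuous_on N (h \<beta>)) \<and>
        hadamard_differentiable (h \<beta>) \<xi>)"

definition QC ::
    "nat \<Rightarrow> nat \<Rightarrow> (nat \<Rightarrow> 'e::banach \<Rightarrow> real) \<Rightarrow> (nat \<Rightarrow> 'e \<Rightarrow> real) \<Rightarrow> 'e \<Rightarrow> bool" where
  "QC m q g h \<xi> \<longleftrightarrow>
     (\<forall>c d :: nat \<Rightarrow> real.
        (\<forall>\<alpha> \<in> {1..m}. c \<alpha> \<ge> 0) \<and> (\<forall>\<alpha> \<in> {1..m}. c \<alpha> * g \<alpha> \<xi> = 0) \<and>
        (\<Sum>\<alpha>=1..m. c \<alpha> *\<^sub>R D_G (g \<alpha>) \<xi>) + (\<Sum>\<beta>=1..q. d \<beta> *\<^sub>R D_G (h \<beta>) \<xi>) = 0 \<longrightarrow>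
        (\<forall>\<alpha> \<in> {1..m}. c \<alpha> = 0) \<and> (\<forall>\<beta> \<in> {1..q}. d \<beta> = 0))"

text \<open>
  A general Hausdorff space \<open>U\<close> does not live in a normed space. That \<open>U\<close> is a subset of
  the normed space \<open>'y\<close>, with the induced topology, is expressed by an inclusion map \<open>\<iota>\<close>
  with \<open>embedding_map U euclidean \<iota>\<close>, which identifies \<open>U\<close> with \<open>\<iota> ` topspace U\<close>; an actual
  subset \<open>V\<close> is the case \<open>U = top_of_set V\<close>, \<open>\<iota> = id\<close>. A function \<open>\<psi>\<close> of the control is then
  read as a function on \<open>\<iota> ` topspace U\<close>.
\<close>

definition on_image :: "'u topology \<Rightarrow> ('u \<Rightarrow> 'y) \<Rightarrow> ('u \<Rightarrow> 'b) \<Rightarrow> 'y \<Rightarrow> 'b" where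
  "on_image U \<iota> \<psi> y = \<psi> (inv_into (topspace U) \<iota> y)"

definition subset_nbhd :: "'u topology \<Rightarrow> ('u \<Rightarrow> 'y::real_normed_vector) \<Rightarrow> 'u \<Rightarrow> bool" where
  "subset_nbhd U \<iota> \<zeta> \<longleftrightarrow> embedding_map U euclidean \<iota> \<and> \<iota> \<zeta> \<in> interior (\<iota> ` topspace U)"

definition Surj ::
    "real \<Rightarrow> 'u topology \<Rightarrow> ('u \<Rightarrow> 'y::real_normed_vector) \<Rightarrow>
     (real \<Rightarrow> 'e::banach \<Rightarrow> 'u \<Rightarrow> 'e) \<Rightarrow> (real \<Rightarrow> 'e) \<Rightarrow> (real \<Rightarrow> 'u) \<Rightarrow> bool" where
  "Surj T U \<iota> f x\<^sub>0 u\<^sub>0 \<longleftrightarrow>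
     (\<exists>t \<in> {0..T}. subset_nbhd U \<iota> (u\<^sub>0 t) \<and>
        gateaux_differentiable (on_image U \<iota> (f t (x\<^sub>0 t))) (\<iota> (u\<^sub>0 t)) \<and>
        surj (blinfun_apply (D_G (on_image U \<iota> (f t (x\<^sub>0 t))) (\<iota> (u\<^sub>0 t)))))"

definition LI ::
    "real \<Rightarrow> 'u topology \<Rightarrow> ('u \<Rightarrow> 'y::real_normed_vector) \<Rightarrow> nat \<Rightarrow> nat \<Rightarrow>
     (real \<Rightarrow> 'e::banach \<Rightarrow> 'u \<Rightarrow> 'e) \<Rightarrow> (nat \<Rightarrow> 'e \<Rightarrow> real) \<Rightarrow> (nat \<Rightarrow> 'e \<Rightarrow> real) \<Rightarrow>
     (real \<Rightarrow> 'e) \<Rightarrow> (real \<Rightarrow> 'u) \<Rightarrow> bool" where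
  "LI T U \<iota> m q f g h x\<^sub>0 u\<^sub>0 \<longleftrightarrow>
     subset_nbhd U \<iota> (u\<^sub>0 T) \<and>
     gateaux_differentiable (on_image U \<iota> (f T (x\<^sub>0 T))) (\<iota> (u\<^sub>0 T)) \<and>
     (let A = D_G (on_image U \<iota> (f T (x\<^sub>0 T))) (\<iota> (u\<^sub>0 T)) in
      \<forall>c d :: nat \<Rightarrow> real.
        (\<Sum>\<alpha>=1..m. c \<alpha> *\<^sub>R (D_H (g \<alpha>) (x\<^sub>0 T) o\<^sub>L A)) +
        (\<Sum>\<beta>=1..q. d \<beta> *\<^sub>R (D_H (h \<beta>) (x\<^sub>0 T) o\<^sub>L A)) = 0 \<longrightarrow>
        (\<forall>\<alpha> \<in> {1..m}. c \<alpha> = 0) \<and> (\<forall>\<beta> \<in> {1..q}. d \<beta> = 0))"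

end

theory Submission
  imports Defs
begin

text \<open>
  The cost is turned into a state variable, so that the optimal process becomes a trajectory in
  \<open>real \<times> 'e\<close> whose endpoint is extremal for finitely many terminal functions. Replacing the control
  by constants on finitely many short intervals moves the endpoint, to first order, in the positive
  cone spanned by the transported jumps of the dynamics. The state
  derivative is continuous only along the reference trajectory, so Taylor expansion is not uniform in
  time; the first-order term is identified by dominated convergence, with a domination given by a
  uniform Lipschitz bound in a tube around the trajectory.
  The terminal functions are only Hadamard differentiable, so the equality constraints are solved by
  the Poincare--Miranda theorem: if no multipliers existed, the cone would contain
  directions that strictly improve the cost and the active inequalities while prescribing the first
  order of each equality constraint arbitrarily. The multipliers determine the costate through
  the adjoint equation, and the needle inequalities are the maximum condition. Nontriviality,
  normality and uniqueness then follow from linear uniqueness for the adjoint equation and from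
  stationarity of the Hamiltonian at an interior control.
\<close>

section \<open>Piecewise continuous functions\<close>

text \<open>Hypothesis (1) bounds the state differential over compact sets only, and closed balls of
  E need not be compact. The Lipschitz tube therefore comes from a contradiction: points violating
  every bound would converge to the trajectory, and a convergent sequence together with its limit is
  compact. The terminal functions need not be differentiable away from the endpoint, so the endpoint
  map is differentiated only along sequences s_j B_j with s_j -> 0+ and B_j -> b. This is the kind
  of limit that a Hadamard differential accepts. Because B_j may vary, a compactness argument makes
  the expansion uniform over a cube of directions. Poincare-Miranda then asks only that the equality
  values depend continuously on the needle lengths, which is where continuity of h^\<beta> near the
  endpoint enters. The cone of first-order variations need not be closed. Separation is carried out
  in the finite-dimensional space of terminal values with a minimising sequence for the distance,
  and it yields approximate directions; their tolerance is small enough not to change the signs on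
  the faces of the cube.\<close>

lemma at_within_Icc_eq: "t \<in> {0<..<T} \<Longrightarrow> at t within {0..T} = at (t::real)"
  by (metis at_within_interior interior_atLeastAtMost_real)

lemma atin_Icc: "t \<in> {0..T} \<Longrightarrow> atin (top_of_set {0..T}) t = at t within {0..T::real}"
  by (simp add: atin_subtopology_within_if filter_eq_iff eventually_atin_within eventually_at_topological) blast

lemma at_right_le_within: "(t::real) < T \<Longrightarrow> 0 \<le> t \<Longrightarrow> at_right t \<le> at t within {0..T}"
  unfolding le_filter_def eventually_at_filter eventually_nhds
  apply (intro allI impI)
  subgoal for P
    apply (elim exE conjE)
    subgoal for S
      by (rule exI[of _ "S \<inter> {..<T}"]) auto
    done
  done

lemma at_left_le_within: "0 < (t::real) \<Longrightarrow> t \<le> T \<Longrightarrow> at_left t \<le> at t within {0..T}"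
  unfolding le_filter_def eventually_at_filter eventually_nhds
  apply (intro allI impI)
  subgoal for P
    apply (elim exE conjE)
    subgoal for S
      by (rule exI[of _ "S \<inter> {0<..}"]) auto
    done
  done

lemma limitin_mono_filter: "limitin X f l F \<Longrightarrow> G \<le> F \<Longrightarrow> limitin X f l G"
  unfolding limitin_def le_filter_def by blast

text \<open>With continuity into an abstract space written as a limit along the ordinary filter,
  continuity and one-sided limits are handled by the same predicate \<open>limitin\<close>.\<close>

lemma topcontinuous_at_Icc:
  assumes "u \<in> {0..T} \<rightarrow> topspace W" "t \<in> {0..T::real}"
  shows "topcontinuous_at (top_of_set {0..T}) W u t \<longleftrightarrow> limitin W u (u t) (at t within {0..T})"
  using assms by (auto simp: topcontinuous_at_atin atin_Icc)

section \<open>Subdivisions and finite sets of nodes\<close>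

lemma subdivision_mono:
  assumes "subdivision T k \<tau>" "i \<le> j" "j \<le> Suc k"
  shows "\<tau> i \<le> \<tau> j"
  using assms(2,3)
proof (induction j rule: dec_induct)
  case (step n)
  then show ?case using assms(1) unfolding subdivision_def
    by (metis Suc_le_mono less_eq_real_def order_trans Suc_leD)
qed simp

lemma subdivision_mem:
  assumes "subdivision T k \<tau>" "i \<le> Suc k"
  shows "\<tau> i \<in> {0..T}"
  using subdivision_mono[OF assms(1), of 0 i] subdivision_mono[OF assms(1), of i "Suc k"] assms
  by (auto simp: subdivision_def)

lemma subdivision_strict:
  assumes "subdivision T k \<tau>" "i < j" "j \<le> Suc k"
  shows "\<tau> i < \<tau> j"
proof -
  have "\<tau> i < \<tau> (Suc i)" using assms by (auto simp: subdivision_def)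
  also have "\<dots> \<le> \<tau> j" by (rule subdivision_mono[OF assms(1)]) (use assms in auto)
  finally show ?thesis .
qed

lemma subdivision_gap:
  assumes "subdivision T k \<tau>" "i \<le> k" "\<tau> i < t" "t < \<tau> (Suc i)"
  shows "t \<notin> \<tau> ` {0..Suc k}"
proof
  assume "t \<in> \<tau> ` {0..Suc k}"
  then obtain j where j: "j \<le> Suc k" "t = \<tau> j" by auto
  show False
  proof (cases "j \<le> i")
    case True
    then show ?thesis using subdivision_mono[OF assms(1) True] assms j by auto
  next
    case False
    then show ?thesis using subdivision_mono[OF assms(1), of "Suc i" j] assms j by auto
  qed
qed

text \<open>Sorting the set with both ends adjoined gives the enumeration. This lets any finite
  exceptional set stand in for a subdivision.\<close>

lemma subdivision_of_finite:
  assumes "finite F" "T > 0"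
  obtains k \<tau> where "subdivision T k \<tau>" "\<tau> ` {0..Suc k} = {0, T} \<union> (F \<inter> {0..T})"
proof -
  define G where "G = {0, T} \<union> (F \<inter> {0..T})"
  have fG: "finite G" and G: "0 \<in> G" "T \<in> G" "G \<subseteq> {0..T}" using assms by (auto simp: G_def)
  define xs where "xs = sorted_list_of_set G"
  have xs: "set xs = G" "sorted_wrt (<) xs" "length xs = card G"
    using fG by (auto simp: xs_def)
  have c2: "card G \<ge> 2"
  proof -
    have "card {0, T} \<le> card G" by (rule card_mono) (use fG G in auto)
    then show ?thesis using assms by simp
  qed
  define k where "k = card G - 2"
  have len: "length xs = Suc (Suc k)" using xs c2 by (simp add: k_def)
  have lt: "xs ! i < xs ! j" if "i < j" "j < length xs" for i j
    using xs(2) that by (simp add: sorted_wrt_nth_less)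
  have im: "(\<lambda>i. xs ! i) ` {0..Suc k} = G"
  proof -
    have "(\<lambda>i. xs ! i) ` {0..Suc k} = (\<lambda>i. xs ! i) ` {0..<length xs}" by (simp add: len atLeastLessThanSuc_atLeastAtMost)
    also have "\<dots> = set xs" by (auto simp: set_conv_nth)
    finally show ?thesis using xs by simp
  qed
  have "xs ! 0 = 0"
  proof -
    obtain i where i: "i < length xs" "xs ! i = 0" using G xs by (metis in_set_conv_nth)
    have "xs ! 0 \<in> G" using xs len by (metis nth_mem zero_less_Suc)
    then have "xs ! 0 \<ge> 0" using G by auto
    then show ?thesis using lt[of 0 i] i by (cases "i = 0") auto
  qed
  moreover have "xs ! Suc k = T"
  proof -
    obtain i where i: "i < length xs" "xs ! i = T" using G xs by (metis in_set_conv_nth)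
    have "xs ! Suc k \<in> G" using xs len by (metis nth_mem lessI)
    then have "xs ! Suc k \<le> T" using G by auto
    then show ?thesis using lt[of i "Suc k"] i len by (cases "i = Suc k") auto
  qed
  ultimately have "subdivision T k (\<lambda>i. xs ! i)"
    unfolding subdivision_def using lt len by auto
  with im show ?thesis using that G_def by blast
qed

text \<open>The subdivision is traded for a finite exceptional set and one-sided limits at every
  point. Exceptional sets are combined by union, whereas two subdivisions would have to be merged
  and renumbered; the closure properties below rest on this form.\<close>

lemma NPC0R_iff:
  assumes T: "T > 0"
  shows "u \<in> NPC0R T W \<longleftrightarrow> u \<in> {0..T} \<rightarrow> topspace W \<and>
    (\<exists>F. finite F \<and> (\<forall>t\<in>{0..T} - F. limitin W u (u t) (at t within {0..T}))) \<and>
    (\<forall>t\<in>{0..<T}. limitin W u (u t) (at_right t)) \<and> limitin W u (u T) (at_left T) \<and>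
    (\<forall>t\<in>{0<..T}. \<exists>l. limitin W u l (at_left t))" (is "?L \<longleftrightarrow> ?R")
proof
  assume L: ?L
  then have sp: "u \<in> {0..T} \<rightarrow> topspace W" by (auto simp: NPC0R_def PC0_def)
  have rl: "\<forall>t\<in>{0..<T}. limitin W u (u t) (at_right t)" "limitin W u (u T) (at_left T)"
    using L by (auto simp: NPC0R_def)
  have "(\<exists>F. finite F \<and> (\<forall>t\<in>{0..T} - F. limitin W u (u t) (at t within {0..T}))) \<and>
    (\<forall>t\<in>{0<..T}. \<exists>l. limitin W u l (at_left t))"
  proof (cases "continuous_map (top_of_set {0..T}) W u")
    case True
    have c: "limitin W u (u t) (at t within {0..T})" if "t \<in> {0..T}" for t
      using True that topcontinuous_at_Icc[OF sp that] by (simp add: continuous_map_eq_topcontinuous_at)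
    show ?thesis
    proof (intro conjI ballI exI[of _ "{}"])
      show "\<exists>l. limitin W u l (at_left t)" if "t \<in> {0<..T}" for t
        using limitin_mono_filter[OF c at_left_le_within] that by (intro exI[of _ "u t"]) auto
    qed (use c in auto)
  next
    case False
    then obtain k \<tau> where s: "subdivision T k \<tau>"
      and c: "\<forall>t \<in> {0..T} - \<tau> ` {0..Suc k}. topcontinuous_at (top_of_set {0..T}) W u t"
      and l: "\<forall>i \<in> {1..Suc k}. \<exists>l. limitin W u l (at_left (\<tau> i))"
      using L by (auto simp: NPC0R_def PC0_def)
    have c': "limitin W u (u t) (at t within {0..T})" if "t \<in> {0..T} - \<tau> ` {0..Suc k}" for t
      using c that topcontinuous_at_Icc[OF sp] by blast
    have "\<exists>l. limitin W u l (at_left t)" if t: "t \<in> {0<..T}" for t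
    proof (cases "t \<in> \<tau> ` {0..Suc k}")
      case True
      then obtain i where i: "i \<in> {0..Suc k}" "t = \<tau> i" by auto
      then have "i \<noteq> 0" using t s by (intro notI) (simp add: subdivision_def)
      then show ?thesis using l i by force
    next
      case False
      then show ?thesis using limitin_mono_filter[OF c' at_left_le_within] t by (intro exI[of _ "u t"]) auto
    qed
    moreover have "finite (\<tau> ` {0..Suc k})" by simp
    ultimately show ?thesis using c' by blast
  qed
  with sp rl show ?R by blast
next
  assume R: ?R
  then have sp: "u \<in> {0..T} \<rightarrow> topspace W" by blast
  obtain F where F: "finite F" "\<forall>t\<in>{0..T} - F. limitin W u (u t) (at t within {0..T})" using R by blast
  obtain k \<tau> where s: "subdivision T k \<tau>" and im: "\<tau> ` {0..Suc k} = {0, T} \<union> (F \<inter> {0..T})"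
    using subdivision_of_finite[OF F(1) T] .
  have "topcontinuous_at (top_of_set {0..T}) W u t" if "t \<in> {0..T} - \<tau> ` {0..Suc k}" for t
    using that F(2) topcontinuous_at_Icc[OF sp, of t] im by auto
  moreover have "\<exists>l. limitin W u l (at_right (\<tau> i))" if "i \<in> {0..k}" for i
  proof -
    have "\<tau> i < T" using subdivision_strict[OF s, of i "Suc k"] that s by (auto simp: subdivision_def)
    then show ?thesis using R subdivision_mem[OF s, of i] that by auto
  qed
  moreover have "\<exists>l. limitin W u l (at_left (\<tau> i))" if "i \<in> {1..Suc k}" for i
  proof -
    have "\<tau> i > 0" using subdivision_strict[OF s, of 0 i] that s by (auto simp: subdivision_def)
    then show ?thesis using R subdivision_mem[OF s, of i] that by auto
  qed
  ultimately have "u \<in> PC0 T W" unfolding PC0_def using sp s by blast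
  with R show ?L unfolding NPC0R_def by blast
qed

section \<open>Closure properties of normalised piecewise continuous functions\<close>

lemma NPC0R_const: "T > 0 \<Longrightarrow> c \<in> topspace W \<Longrightarrow> (\<lambda>_. c) \<in> NPC0R T W"
  unfolding NPC0R_def PC0_def by auto

lemma NPC0R_continuous:
  assumes "T > 0" "continuous_on {0..T} (x :: real \<Rightarrow> 'a::topological_space)" "x ` {0..T} \<subseteq> S"
  shows "x \<in> NPC0R T (top_of_set S)"
proof -
  have cm: "continuous_map (top_of_set {0..T}) (top_of_set S) x" using assms by auto
  then have c: "limitin (top_of_set S) x (x t) (at t within {0..T})" if "t \<in> {0..T}" for t
    using that by (metis limitin_continuous_map topspace_euclidean_subtopology atin_Icc)
  have "x \<in> {0..T} \<rightarrow> topspace (top_of_set S)" using assms by auto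
  moreover have "limitin (top_of_set S) x (x t) (at_right t)" if "t \<in> {0..<T}" for t
    using limitin_mono_filter[OF c at_right_le_within] that by auto
  moreover have "limitin (top_of_set S) x (x T) (at_left T)"
    using limitin_mono_filter[OF c at_left_le_within] assms(1) by auto
  ultimately show ?thesis using cm unfolding NPC0R_def PC0_def by blast
qed

lemma NPC0R_pair:
  assumes T: "T > 0" and "u \<in> NPC0R T W" "v \<in> NPC0R T W'"
  shows "(\<lambda>t. (u t, v t)) \<in> NPC0R T (prod_topology W W')"
proof -
  obtain F where F: "finite F" "\<forall>t\<in>{0..T} - F. limitin W u (u t) (at t within {0..T})"
    using assms by (auto simp: NPC0R_iff)
  obtain G where G: "finite G" "\<forall>t\<in>{0..T} - G. limitin W' v (v t) (at t within {0..T})"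
    using assms by (auto simp: NPC0R_iff)
  have p: "limitin (prod_topology W W') (\<lambda>t. (u t, v t)) (a, b) A \<longleftrightarrow> limitin W u a A \<and> limitin W' v b A" for a b A
    by (simp add: limitin_pairwise o_def)
  have "\<exists>l. limitin (prod_topology W W') (\<lambda>t. (u t, v t)) l (at_left t)" if "t \<in> {0<..T}" for t
    using assms(2,3) p that unfolding NPC0R_iff[OF T] by meson
  moreover have "(\<lambda>t. (u t, v t)) \<in> {0..T} \<rightarrow> topspace (prod_topology W W')"
    using assms by (auto simp: NPC0R_iff)
  moreover have "\<forall>t\<in>{0..T} - (F \<union> G). limitin (prod_topology W W') (\<lambda>t. (u t, v t)) (u t, v t) (at t within {0..T})"
    using F G p by auto
  ultimately show ?thesis
    using assms F(1) G(1) by (auto simp: NPC0R_iff p intro!: exI[of _ "F \<union> G"])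
qed

lemma NPC0R_compose:
  assumes T: "T > 0" and u: "u \<in> NPC0R T W" and c: "continuous_map W V \<phi>"
  shows "(\<lambda>t. \<phi> (u t)) \<in> NPC0R T V"
proof -
  have p: "limitin W u a A \<Longrightarrow> limitin V (\<lambda>t. \<phi> (u t)) (\<phi> a) A" for a A
    using continuous_map_limit[OF c, of u a A] by (simp add: o_def)
  note u' = u[unfolded NPC0R_iff[OF T]]
  have "(\<lambda>t. \<phi> (u t)) \<in> {0..T} \<rightarrow> topspace V" using u' c by (auto simp: continuous_map_def Pi_iff)
  moreover have "\<exists>F. finite F \<and> (\<forall>t\<in>{0..T} - F. limitin V (\<lambda>t. \<phi> (u t)) (\<phi> (u t)) (at t within {0..T}))"
    using u' p by meson
  moreover have "\<forall>t\<in>{0<..T}. \<exists>l. limitin V (\<lambda>t. \<phi> (u t)) l (at_left t)" using u' p by meson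
  ultimately show ?thesis using u' p unfolding NPC0R_iff[OF T] by simp
qed

text \<open>Time is itself a regular function, so a time-dependent map is a continuous map applied
  to the pair of t and \<open>u t\<close>.\<close>

lemma NPC0R_tcompose:
  assumes T: "T > 0" and u: "u \<in> NPC0R T W" 
    and c: "continuous_map (prod_topology (top_of_set {0..T}) W) V (\<lambda>(t, w). \<phi> t w)"
  shows "(\<lambda>t. \<phi> t (u t)) \<in> NPC0R T V"
proof -
  have "(\<lambda>t. t) \<in> NPC0R T (top_of_set {0..T})"
    by (rule NPC0R_continuous[OF T]) auto
  from NPC0R_compose[OF T NPC0R_pair[OF T this u] c] show ?thesis by simp
qed

text \<open>The replacement interval is closed on the left, open on the right and ends before
  \<open>T\<close>. This is what preserves right-continuity on [0,T[ and left-continuity at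
  \<open>T\<close>.\<close>

lemma NPC0R_splice:
  assumes T: "T > 0" and u: "u \<in> NPC0R T W" and v: "v \<in> NPC0R T W" and cd: "0 \<le> c" "d < T"
  shows "(\<lambda>t. if t \<in> {c..<d} then v t else u t) \<in> NPC0R T W" (is "?w \<in> _")
proof -
  note u' = u[unfolded NPC0R_iff[OF T]] and v' = v[unfolded NPC0R_iff[OF T]]
  obtain F where F: "finite F" "\<forall>t\<in>{0..T} - F. limitin W u (u t) (at t within {0..T})"
    using u' by auto
  obtain G where G: "finite G" "\<forall>t\<in>{0..T} - G. limitin W v (v t) (at t within {0..T})"
    using v' by auto
  have tr: "limitin W ?w l A" if "limitin W g l A" "eventually (\<lambda>s. g s = ?w s) A" for g l A
    using limitin_transform_eventually[OF that(2,1)] .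
  have e1: "eventually (\<lambda>s. v s = ?w s) A" if "eventually (\<lambda>s. s \<in> {c..<d}) A" for A
    using that by eventually_elim auto
  have e2: "eventually (\<lambda>s. u s = ?w s) A" if "eventually (\<lambda>s. s \<notin> {c..<d}) A" for A
    using that by eventually_elim auto
  have right: "limitin W ?w (?w t) (at_right t)" if t: "t \<in> {0..<T}" for t
  proof (cases "t \<in> {c..<d}")
    case True
    have "eventually (\<lambda>s. s \<in> {c..<d}) (at_right t)"
      unfolding eventually_at_right_field using True by (intro exI[of _ d]) auto
    then show ?thesis using tr[OF _ e1] v' t True by auto
  next
    case False
    have "eventually (\<lambda>s. s \<notin> {c..<d}) (at_right t)"
      unfolding eventually_at_right_field using False
      by (intro exI[of _ "if t < c then c else t+1"]) auto
    then show ?thesis using tr[OF _ e2] u' t False by auto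
  qed
  have left: "\<exists>l. limitin W ?w l (at_left t)" if t: "t \<in> {0<..T}" for t
  \<comment> \<open>Left limits change over at the opposite ends: at \<open>c\<close> the left limit
    is still that of \<open>u\<close>, at \<open>d\<close> it is still that of
    \<open>v\<close>.\<close>
  proof (cases "t \<in> {c<..d}")
    case True
    have "eventually (\<lambda>s. s \<in> {c..<d}) (at_left t)"
      unfolding eventually_at_left_field using True by (intro exI[of _ c]) auto
    then show ?thesis using tr[OF _ e1] v' t by blast
  next
    case False
    have "eventually (\<lambda>s. s \<notin> {c..<d}) (at_left t)"
      unfolding eventually_at_left_field using False
      by (intro exI[of _ "if d < t then d else t - 1"]) auto
    then show ?thesis using tr[OF _ e2] u' t by blast
  qed
  have leftT: "limitin W ?w (?w T) (at_left T)"
  proof -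
    have "eventually (\<lambda>s. s \<notin> {c..<d}) (at_left T)"
      unfolding eventually_at_left_field using cd by (intro exI[of _ d]) auto
    then show ?thesis using tr[OF _ e2] u' cd by auto
  qed
  have mid: "limitin W ?w (?w t) (at t within {0..T})" if t: "t \<in> {0..T} - (F \<union> G \<union> {c, d})" for t
  proof (cases "t \<in> {c..<d}")
    case True
    have "eventually (\<lambda>s. s \<in> {c<..<d}) (at t within {0..T})"
      unfolding eventually_at_topological using True t by (intro exI[of _ "{c<..<d}"]) auto
    then have "eventually (\<lambda>s. s \<in> {c..<d}) (at t within {0..T})" by eventually_elim auto
    then show ?thesis using tr[OF _ e1] G t True by auto
  next
    case False
    have "eventually (\<lambda>s. s \<in> {..<c} \<union> {d<..}) (at t within {0..T})"
      unfolding eventually_at_topological using False t by (intro exI[of _ "{..<c} \<union> {d<..}"]) auto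
    then have "eventually (\<lambda>s. s \<notin> {c..<d}) (at t within {0..T})" by eventually_elim auto
    then show ?thesis using tr[OF _ e2] F t False by auto
  qed
  have "?w \<in> {0..T} \<rightarrow> topspace W" using u' v' by (auto simp: Pi_iff)
  moreover have "finite (F \<union> G \<union> {c, d})" using F G by auto
  then have "\<exists>F. finite F \<and> (\<forall>t\<in>{0..T} - F. limitin W ?w (?w t) (at t within {0..T}))"
    using mid by (intro exI[of _ "F \<union> G \<union> {c, d}"] conjI ballI)
  ultimately show ?thesis using right left leftT unfolding NPC0R_iff[OF T] by (intro conjI ballI)
qed


text \<open>Overwriting the value at the right end by the left limit makes the piece continuous on a
  closed interval, so that compactness becomes available.\<close>

lemma continuous_map_left_limit:
  fixes a b :: real
  assumes "a < b" and sp: "\<And>t. t \<in> {a..<b} \<Longrightarrow> u t \<in> topspace W"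
    and mid: "\<And>t. t \<in> {a<..<b} \<Longrightarrow> limitin W u (u t) (at t)"
    and right: "limitin W u (u a) (at_right a)"
    and left: "limitin W u l (at_left b)"
  shows "continuous_map (top_of_set {a..b}) W (\<lambda>t. if t < b then u t else l)" (is "continuous_map _ _ ?w")
  unfolding continuous_map_eq_topcontinuous_at
proof
  fix t assume "t \<in> topspace (top_of_set {a..b})"
  then have t: "t \<in> {a..b}" by simp
  have tr: "limitin W ?w l' A" if "limitin W u l' A" "eventually (\<lambda>s. s < b) A" for l' A
    by (rule limitin_transform_eventually[OF _ that(1)]) (use that(2) in \<open>auto elim: eventually_mono\<close>)
  have "limitin W ?w (?w t) (at t within {a..b})"
  proof -
    consider "t = a" | "t \<in> {a<..<b}" | "t = b" using t by force
    then show ?thesis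
    proof cases
      case 1
      have "eventually (\<lambda>s. s < b) (at_right a)" using assms(1) eventually_at_right_field by blast
      then show ?thesis using tr[OF right] 1 assms(1) by (simp add: at_within_Icc_at_right)
    next
      case 2
      have "eventually (\<lambda>s. s < b) (at t)"
        unfolding eventually_at_topological using 2 by (intro exI[of _ "{..<b}"]) auto
      moreover have "at t within {a..b} = at t" using 2 by (metis at_within_interior interior_atLeastAtMost_real)
      ultimately show ?thesis using tr[OF mid] 2 by auto
    next
      case 3
      have "eventually (\<lambda>s. s < b) (at_left b)" by (simp add: eventually_at_filter)
      then show ?thesis using tr[OF left] 3 assms(1) by (simp add: at_within_Icc_at_left)
    qed
  qed
  moreover have "atin (top_of_set {a..b}) t = at t within {a..b}"
    using t by (simp add: atin_subtopology_within_if filter_eq_iff eventually_atin_within eventually_at_topological) blast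
  ultimately show "topcontinuous_at (top_of_set {a..b}) W ?w t"
    using t sp limitin_topspace[OF left] unfolding topcontinuous_at_atin by auto
qed

text \<open>On its closed interval, \<open>w i\<close> can differ from \<open>u\<close> only at the
  right node, where it takes the left limit. Compactness of the range and integrability are then
  read off finitely many continuous functions on compact intervals.\<close>

lemma NPC0R_pieces:
  assumes T: "T > 0" and u: "u \<in> NPC0R T W"
  obtains k \<tau> w where "subdivision T k \<tau>"
    "\<And>i. i \<le> k \<Longrightarrow> continuous_map (top_of_set {\<tau> i..\<tau> (Suc i)}) W (w i)"
    "\<And>i t. i \<le> k \<Longrightarrow> t \<in> {\<tau> i..<\<tau> (Suc i)} \<Longrightarrow> w i t = u t"
proof -
  note u' = u[unfolded NPC0R_iff[OF T]]
  obtain F where F: "finite F" "\<forall>t\<in>{0..T} - F. limitin W u (u t) (at t within {0..T})"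
    using u' by auto
  obtain k \<tau> where s: "subdivision T k \<tau>" and im: "\<tau> ` {0..Suc k} = {0, T} \<union> (F \<inter> {0..T})"
    using subdivision_of_finite[OF F(1) T] .
  obtain l where l: "\<And>t. t \<in> {0<..T} \<Longrightarrow> limitin W u (l t) (at_left t)" using u' by metis
  define w where "w i t = (if t < \<tau> (Suc i) then u t else l (\<tau> (Suc i)))" for i t
  show ?thesis
  proof (rule that[OF s])
    fix i assume i: "i \<le> k"
    have lt: "\<tau> i < \<tau> (Suc i)" using s i by (auto simp: subdivision_def)
    have m: "\<tau> i \<in> {0..T}" "\<tau> (Suc i) \<in> {0..T}" using subdivision_mem[OF s] i by auto
    show "continuous_map (top_of_set {\<tau> i..\<tau> (Suc i)}) W (w i)"
      unfolding w_def
    proof (rule continuous_map_left_limit[OF lt])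
      show "u t \<in> topspace W" if "t \<in> {\<tau> i..<\<tau> (Suc i)}" for t using u' m that by auto
      show "limitin W u (u t) (at t)" if t: "t \<in> {\<tau> i<..<\<tau> (Suc i)}" for t
      proof -
        have "t \<notin> \<tau> ` {0..Suc k}" using subdivision_gap[OF s i] t by auto
        then have "limitin W u (u t) (at t within {0..T})" using F(2) im t m by auto
        then show ?thesis using at_within_Icc_eq[of t T] t m by auto
      qed
      show "limitin W u (u (\<tau> i)) (at_right (\<tau> i))" using u' m lt by auto
      show "limitin W u (l (\<tau> (Suc i))) (at_left (\<tau> (Suc i)))" using l m lt by auto
    qed
    show "w i t = u t" if "t \<in> {\<tau> i..<\<tau> (Suc i)}" for t using that by (auto simp: w_def)
  qed
qed

lemma subdivision_cover:
  assumes "subdivision T k \<tau>" "t \<in> {0..<T}"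
  obtains i where "i \<le> k" "t \<in> {\<tau> i..<\<tau> (Suc i)}"
proof -
  \<comment> \<open>The first node beyond t; the piece containing t has index i - 1.\<close>
  define i where "i = (LEAST j. t < \<tau> j)"
  have ex: "t < \<tau> (Suc k)" using assms by (auto simp: subdivision_def)
  have i: "t < \<tau> i" unfolding i_def by (rule LeastI, rule ex)
  have "i \<le> Suc k" unfolding i_def by (rule Least_le, rule ex)
  moreover have "i \<noteq> 0" using i assms by (intro notI) (auto simp: subdivision_def)
  moreover have "\<not> t < \<tau> (i - 1)" unfolding i_def by (rule not_less_Least) (use calculation in \<open>auto simp: i_def\<close>)
  ultimately show ?thesis using i by (intro that[of "i - 1"]) auto
qed

text \<open>The range itself may lack the left limits at the jumps. The images of the closed pieces
  contain them, and the value at \<open>T\<close>, which no half-open piece covers, is added by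
  hand.\<close>

lemma NPC0R_compact_range:
  assumes T: "T > 0" and u: "u \<in> NPC0R T W"
  obtains M where "compactin W M" "u ` {0..T} \<subseteq> M"
proof -
  obtain k \<tau> w where s: "subdivision T k \<tau>"
    and c: "\<And>i. i \<le> k \<Longrightarrow> continuous_map (top_of_set {\<tau> i..\<tau> (Suc i)}) W (w i)"
    and e: "\<And>i t. i \<le> k \<Longrightarrow> t \<in> {\<tau> i..<\<tau> (Suc i)} \<Longrightarrow> w i t = u t"
    using NPC0R_pieces[OF assms] by blast
  define M where "M = insert (u T) (\<Union>i\<le>k. w i ` {\<tau> i..\<tau> (Suc i)})"
  have uT: "u T \<in> topspace W" using u T by (auto simp: NPC0R_iff[OF T])
  have "compactin W (w i ` {\<tau> i..\<tau> (Suc i)})" if "i \<le> k" for i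
    by (rule image_compactin[OF _ c[OF that]]) (simp add: compactin_subtopology)
  then have "compactin W (\<Union>i\<le>k. w i ` {\<tau> i..\<tau> (Suc i)})" by (intro compactin_Union) auto
  then have "compactin W ({u T} \<union> (\<Union>i\<le>k. w i ` {\<tau> i..\<tau> (Suc i)}))"
    using uT by (intro compactin_Un) auto
  then have "compactin W M" by (simp add: M_def)
  moreover have "u t \<in> M" if t: "t \<in> {0..T}" for t
  proof (cases "t = T")
    case False
    then obtain i where "i \<le> k" "t \<in> {\<tau> i..<\<tau> (Suc i)}" using subdivision_cover[OF s, of t] t by auto
    then show ?thesis using e[of i t] unfolding M_def by force
  qed (simp add: M_def)
  ultimately show ?thesis using that by blast
qed

lemma NPC0R_integrable:
  fixes u :: "real \<Rightarrow> 'a::banach"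
  assumes T: "T > 0" and u: "u \<in> NPC0R T euclidean"
  shows "u integrable_on {0..T}"
proof -
  obtain k \<tau> w where s: "subdivision T k \<tau>"
    and c: "\<And>i. i \<le> k \<Longrightarrow> continuous_map (top_of_set {\<tau> i..\<tau> (Suc i)}) euclidean (w i)"
    and e: "\<And>i t. i \<le> k \<Longrightarrow> t \<in> {\<tau> i..<\<tau> (Suc i)} \<Longrightarrow> w i t = u t"
    using NPC0R_pieces[OF assms] by blast
  have "u integrable_on {0..\<tau> j}" if "j \<le> Suc k" for j
    using that
  proof (induction j)
    case 0
    then show ?case using s has_integral_refl(2)[of u 0] by (auto simp: subdivision_def integrable_on_def)
  next
    case (Suc j)
    have "w j integrable_on {\<tau> j..\<tau> (Suc j)}" using c[of j] Suc by (intro integrable_continuous_real) auto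
    then have "u integrable_on {\<tau> j..\<tau> (Suc j)}"
      by (rule integrable_spike_finite[of "{\<tau> (Suc j)}", rotated 2]) (use e[of j] Suc in auto)
    moreover have "\<tau> j \<le> \<tau> (Suc j)" "0 \<le> \<tau> j"
      using subdivision_mono[OF s] subdivision_mem[OF s] Suc by auto
    ultimately show ?case using Suc Henstock_Kurzweil_Integration.integrable_combine[where f = u and a = 0 and b = "\<tau> (Suc j)" and c = "\<tau> j"] by auto
  qed
  from this[of "Suc k"] show ?thesis using s by (auto simp: subdivision_def)
qed

lemma NPC0R_bounded:
  fixes u :: "real \<Rightarrow> 'a::real_normed_vector"
  assumes T: "T > 0" and u: "u \<in> NPC0R T euclidean"
  obtains B where "B > 0" "\<And>t. t \<in> {0..T} \<Longrightarrow> norm (u t) \<le> B"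
proof -
  obtain M where "compact M" "u ` {0..T} \<subseteq> M" using NPC0R_compact_range[OF assms] by auto
  then have "bounded (u ` {0..T})" using bounded_subset compact_imp_bounded by blast
  then show ?thesis using that unfolding bounded_pos by auto
qed

text \<open>Only a one-sided limit of \<open>g\<close> is given. Redefining \<open>g\<close> at the
  end point as \<open>l\<close> leaves every integral unchanged and makes \<open>g\<close>
  continuous there relative to the interval, so the usual theorem on primitives applies.\<close>

lemma integral_one_sided_derivative:
  fixes g :: "real \<Rightarrow> 'a::banach"
  assumes "g integrable_on {a..b}" "a < b"
  shows "(g \<longlongrightarrow> l) (at_right a) \<Longrightarrow> ((\<lambda>t. integral {a..t} g) has_vector_derivative l) (at_right a)"
    and "(g \<longlongrightarrow> l) (at_left b) \<Longrightarrow> ((\<lambda>t. integral {a..t} g) has_vector_derivative l) (at_left b)"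
proof -
  have spike: "integral {a..t} (g(c := l)) = integral {a..t} g" for t c
    by (rule integral_spike[of "{c}"]) auto
  have int: "(g(c := l)) integrable_on {a..b}" for c
    by (rule integrable_spike_finite[of "{c}", OF _ _ assms(1)]) auto
  show "((\<lambda>t. integral {a..t} g) has_vector_derivative l) (at_right a)" if "(g \<longlongrightarrow> l) (at_right a)"
  proof -
    have "((g(a := l)) \<longlongrightarrow> l) (at_right a)"
      using that by (rule Lim_transform_eventually) (auto simp: eventually_at_filter)
    then have "continuous (at a within {a..b} - {}) (g(a := l))"
      using assms(2) by (simp add: continuous_within at_within_Icc_at_right)
    from integral_has_vector_derivative_continuous_at[OF int _ _ this] assms(2)
    have "((\<lambda>t. integral {a..t} (g(a := l))) has_vector_derivative l) (at a within {a..b})" by auto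
    then show ?thesis using assms(2) by (simp add: spike at_within_Icc_at_right)
  qed
  show "((\<lambda>t. integral {a..t} g) has_vector_derivative l) (at_left b)" if "(g \<longlongrightarrow> l) (at_left b)"
  proof -
    have "((g(b := l)) \<longlongrightarrow> l) (at_left b)"
      using that by (rule Lim_transform_eventually) (auto simp: eventually_at_filter)
    then have "continuous (at b within {a..b} - {}) (g(b := l))"
      using assms(2) by (simp add: continuous_within at_within_Icc_at_left)
    from integral_has_vector_derivative_continuous_at[OF int _ _ this] assms(2)
    have "((\<lambda>t. integral {a..t} (g(b := l))) has_vector_derivative l) (at b within {a..b})" by auto
    then show ?thesis using assms(2) by (simp add: spike at_within_Icc_at_left)
  qed
qed

lemma vector_derivative_at_right_eq:
  "(x has_vector_derivative d) (at_right (t::real)) \<Longrightarrow> vector_derivative x (at_right t) = d"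
  by (rule vector_derivative_within) (auto simp: trivial_limit_at_right_real)

lemma vector_derivative_at_left_eq:
  "(x has_vector_derivative d) (at_left (t::real)) \<Longrightarrow> vector_derivative x (at_left t) = d"
  by (rule vector_derivative_within) (auto simp: trivial_limit_at_left_real)

lemma has_vector_derivative_cong_eventually:
  fixes x y :: "real \<Rightarrow> 'a::real_normed_vector"
  assumes "(y has_vector_derivative d) (at t within S)" "x t = y t" "eventually (\<lambda>s. x s = y s) (at t within S)"
  shows "(x has_vector_derivative d) (at t within S)"
proof -
  let ?q = "\<lambda>x y. (1 / norm (y - t)) *\<^sub>R (x y - (x t + (y - t) *\<^sub>R d))"
  have "(?q y \<longlongrightarrow> 0) (at t within S)"
    using assms(1) by (simp add: has_vector_derivative_def has_derivative_within)
  then have "(?q x \<longlongrightarrow> 0) (at t within S)"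
    by (rule Lim_transform_eventually) (use assms(2,3) in \<open>auto elim: eventually_mono\<close>)
  then show ?thesis
    by (simp add: has_vector_derivative_def has_derivative_within bounded_linear_scaleR_left)
qed

section \<open>Primitives of normalised piecewise continuous functions\<close>

context
  fixes T :: real and g x :: "real \<Rightarrow> 'a::banach"
  assumes T: "T > 0" and g: "g \<in> NPC0R T euclidean"
    and x: "\<And>t. t \<in> {0..T} \<Longrightarrow> x t = x 0 + integral {0..t} g"
begin

private lemma gint: "g integrable_on {a..b}" if "0 \<le> a" "b \<le> T" for a b
  using integrable_subinterval_real[OF NPC0R_integrable[OF T g], of a b] that by auto

private lemma x_right_derivative:
  assumes t: "t \<in> {0..<T}" shows "(x has_vector_derivative g t) (at_right t)"
proof -
  have "((\<lambda>s. integral {t..s} g) has_vector_derivative g t) (at_right t)"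
    by (rule integral_one_sided_derivative(1)[of _ _ T]) (use t g gint in \<open>auto simp: NPC0R_iff[OF T]\<close>)
  then have "((\<lambda>s. x t + integral {t..s} g) has_vector_derivative g t) (at_right t)"
    by (auto intro!: derivative_eq_intros)
  then show ?thesis
  proof (rule has_vector_derivative_cong_eventually)
    have "x s = x t + integral {t..s} g" if "s \<in> {t<..<T}" for s
      using x[of s] x[of t] Henstock_Kurzweil_Integration.integral_combine[OF _ _ gint[of 0 s], of t] that t by (auto simp: algebra_simps)
    then show "\<forall>\<^sub>F s in at_right t. x s = x t + integral {t..s} g"
      unfolding eventually_at_right_field using t by (intro exI[of _ T]) auto
  qed auto
qed

private lemma x_left_derivative:
  assumes t: "t \<in> {0<..T}" and l: "(g \<longlongrightarrow> l) (at_left t)" shows "(x has_vector_derivative l) (at_left t)"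
proof -
  have "((\<lambda>s. integral {0..s} g) has_vector_derivative l) (at_left t)"
    by (rule integral_one_sided_derivative(2)) (use t l gint in auto)
  then have "((\<lambda>s. x 0 + integral {0..s} g) has_vector_derivative l) (at_left t)"
    by (auto intro!: derivative_eq_intros)
  then show ?thesis
  proof (rule has_vector_derivative_cong_eventually)
    show "\<forall>\<^sub>F s in at_left t. x s = x 0 + integral {0..s} g"
      unfolding eventually_at_left_field using t by (intro exI[of _ 0] conjI allI impI x) auto
    show "x t = x 0 + integral {0..t} g" using t by (intro x) auto
  qed
qed

lemma integral_NPC0R_derivative:
  obtains F where "finite F" "0 \<in> F" "T \<in> F" "\<And>t. t \<in> {0..T} - F \<Longrightarrow> (x has_vector_derivative g t) (at t)"
    "\<And>t. t \<in> {0..T} - F \<Longrightarrow> (g \<longlongrightarrow> g t) (at t)"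
proof -
  obtain F where F: "finite F" "\<forall>t\<in>{0..T} - F. (g \<longlongrightarrow> g t) (at t within {0..T})"
    using g by (auto simp: NPC0R_iff[OF T])
  have l: "(g \<longlongrightarrow> g t) (at t)" if "t \<in> {0..T} - (F \<union> {0, T})" for t
    using bspec[OF F(2), of t] that at_within_Icc_eq[of t T] by auto
  have "(x has_vector_derivative g t) (at t)" if t: "t \<in> {0..T} - (F \<union> {0, T})" for t
  proof -
    have "(g \<longlongrightarrow> g t) (at_left t)" using l[OF t] by (simp add: filterlim_at_split)
    then have "(x has_vector_derivative g t) (at_left t)" using x_left_derivative t by auto
    moreover have "(x has_vector_derivative g t) (at_right t)" using x_right_derivative t by auto
    ultimately show ?thesis
      by (simp add: has_vector_derivative_def has_derivative_within filterlim_at_split)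
  qed
  with l F(1) show ?thesis by (intro that[of "F \<union> {0, T}"]) auto
qed

text \<open>There are no exceptional times: right-continuity on [0,T[ and left-continuity at
  \<open>T\<close> match the two cases in the definition of \<open>ext_deriv\<close>.\<close>

lemma integral_NPC0R_ext_deriv: "t \<in> {0..T} \<Longrightarrow> ext_deriv T x t = g t"
  using x_right_derivative[of t] x_left_derivative[of t "g t"] g T
  by (auto simp: ext_deriv_def NPC0R_iff[OF T] intro!: vector_derivative_at_right_eq vector_derivative_at_left_eq)

lemma integral_NPC0R_continuous: "continuous_on {0..T} x"
proof -
  have "continuous_on {0..T} (\<lambda>t. x 0 + integral {0..t} g)"
    by (intro continuous_intros indefinite_integral_continuous_1 gint) auto
  then show ?thesis by (rule continuous_on_eq) (rule x[symmetric])
qed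

text \<open>On the open gaps beside a node the derivative coincides with \<open>g\<close>, so its
  one-sided limits at the node are those of \<open>g\<close>, and these are also the one-sided
  derivatives.\<close>

lemma integral_NPC0R_PC1:
  assumes W: "x ` {0..T} \<subseteq> W"
  shows "x \<in> PC1 T W"
proof -
  obtain F where F: "finite F" "0 \<in> F" "T \<in> F" and d: "\<And>t. t \<in> {0..T} - F \<Longrightarrow> (x has_vector_derivative g t) (at t)"
    and l: "\<And>t. t \<in> {0..T} - F \<Longrightarrow> (g \<longlongrightarrow> g t) (at t)"
    using integral_NPC0R_derivative by blast
  obtain k \<tau> where s: "subdivision T k \<tau>" and im: "\<tau> ` {0..Suc k} = {0, T} \<union> (F \<inter> {0..T})"
    using subdivision_of_finite[OF F(1) T] .
  have im': "{0..T} - \<tau> ` {0..Suc k} = {0..T} - F" using im F by auto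
  have vd: "vector_derivative x (at t) = g t" if "t \<in> {0..T} - F" for t
    using d[OF that] by (rule vector_derivative_at)
  then have vd': "vector_derivative x (at t) = g t" if "t \<in> {0..T} - \<tau> ` {0..Suc k}" for t
    using that unfolding im' by blast
  have "continuous_on ({0..T} - F) g"
    unfolding continuous_on_def using l by (blast intro: Lim_at_imp_Lim_at_within)
  then have c1: "x C1_differentiable_on ({0..T} - \<tau> ` {0..Suc k})"
    unfolding im' C1_differentiable_on_def using d by blast
  have right: "\<exists>d. (x has_vector_derivative d) (at_right (\<tau> i)) \<and>
           ((\<lambda>t. vector_derivative x (at t)) \<longlongrightarrow> d) (at_right (\<tau> i))" if i: "i \<in> {0..k}" for i
  proof -
    have t: "\<tau> i \<in> {0..<T}" using subdivision_strict[OF s, of i "Suc k"] subdivision_mem[OF s, of i] s i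
      by (auto simp: subdivision_def)
    have "eventually (\<lambda>t. g t = vector_derivative x (at t)) (at_right (\<tau> i))"
      unfolding eventually_at_right_field
    proof (intro exI[of _ "\<tau> (Suc i)"] conjI allI impI)
      show "\<tau> i < \<tau> (Suc i)" using s i by (auto simp: subdivision_def)
      fix y assume "\<tau> i < y" "y < \<tau> (Suc i)"
      then show "g y = vector_derivative x (at y)"
        using subdivision_gap[OF s, of i y] subdivision_mem[OF s, of "Suc i"] i t
        by (intro vd'[symmetric]) auto
    qed
    moreover have "(g \<longlongrightarrow> g (\<tau> i)) (at_right (\<tau> i))" using g t by (auto simp: NPC0R_iff[OF T])
    ultimately have "((\<lambda>t. vector_derivative x (at t)) \<longlongrightarrow> g (\<tau> i)) (at_right (\<tau> i))"
      by (rule Lim_transform_eventually[rotated])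
    then show ?thesis using x_right_derivative[OF t] by blast
  qed
  have left: "\<exists>d. (x has_vector_derivative d) (at_left (\<tau> i)) \<and>
           ((\<lambda>t. vector_derivative x (at t)) \<longlongrightarrow> d) (at_left (\<tau> i))" if i: "i \<in> {1..Suc k}" for i
  proof -
    have t: "\<tau> i \<in> {0<..T}" using subdivision_strict[OF s, of 0 i] subdivision_mem[OF s, of i] s i
      by (auto simp: subdivision_def)
    have i': "i - 1 \<le> k" "i - 1 \<le> Suc k" "Suc (i - 1) = i" using i by auto
    have "eventually (\<lambda>t. g t = vector_derivative x (at t)) (at_left (\<tau> i))"
      unfolding eventually_at_left_field
    proof (intro exI[of _ "\<tau> (i-1)"] conjI allI impI)
      show "\<tau> (i-1) < \<tau> i" using subdivision_strict[OF s, of "i-1" i] i by auto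
      fix y assume "\<tau> (i-1) < y" "y < \<tau> i"
      then show "g y = vector_derivative x (at y)"
        using subdivision_gap[OF s, of "i-1" y] subdivision_mem[OF s, of "i-1"] i t i'
        by (intro vd'[symmetric]) auto
    qed
    \<comment> \<open>At a jump the left derivative is the left limit of \<open>g\<close>, in
      general different from the value of \<open>g\<close> there.\<close>
    moreover obtain l where l: "(g \<longlongrightarrow> l) (at_left (\<tau> i))"
      using g t unfolding NPC0R_iff[OF T] limitin_canonical_iff by blast
    ultimately have "((\<lambda>t. vector_derivative x (at t)) \<longlongrightarrow> l) (at_left (\<tau> i))"
      by (blast intro: Lim_transform_eventually[rotated])
    then show ?thesis using x_left_derivative[OF t l] by blast
  qed
  show ?thesis unfolding PC1_def using W integral_NPC0R_continuous s c1 right left by blast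
qed

end

text \<open>Off the nodes the two-sided derivative exists and agrees with the right derivative by
  which \<open>ext_deriv\<close> is defined. This brings both alternatives of \<open>PC1\<close> to
  a single form with a finite exceptional set.\<close>

lemma PC1_derivative:
  fixes x :: "real \<Rightarrow> 'a::real_normed_vector"
  assumes T: "T > 0" and x: "x \<in> PC1 T W"
  obtains F where "finite F" "\<And>t. t \<in> {0..T} - F \<Longrightarrow> (x has_vector_derivative ext_deriv T x t) (at t)"
proof -
  have eq: "ext_deriv T x t = d" if "(x has_vector_derivative d) (at t)" "t < T" for t d
    using that by (auto simp: ext_deriv_def intro!: vector_derivative_at_right_eq has_vector_derivative_at_within)
  show ?thesis
  proof (cases "\<exists>D. continuous_on {0..T} D \<and> (\<forall>t \<in> {0..T}. (x has_vector_derivative D t) (at t within {0..T}))")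
    case True
    then obtain D where D: "\<And>t. t \<in> {0..T} \<Longrightarrow> (x has_vector_derivative D t) (at t within {0..T})" by blast
    show ?thesis
    \<comment> \<open>At the two ends only the derivative within [0,T] is known, so they are counted
      as exceptional.\<close>
    proof (rule that[of "{0, T}"])
      fix t assume t: "t \<in> {0..T} - {0, T}"
      then have "(x has_vector_derivative D t) (at t)" using D[of t] at_within_Icc_eq[of t T] by auto
      then show "(x has_vector_derivative ext_deriv T x t) (at t)" using eq t by force
    qed simp
  next
    case False
    then obtain k \<tau> where s: "subdivision T k \<tau>" and c: "x C1_differentiable_on ({0..T} - \<tau> ` {0..Suc k})"
      using x unfolding PC1_def by blast
    show ?thesis
    proof (rule that[of "\<tau> ` {0..Suc k}"])
      fix t assume t: "t \<in> {0..T} - \<tau> ` {0..Suc k}"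
      then obtain d where d: "(x has_vector_derivative d) (at t)" using c unfolding C1_differentiable_on_def by blast
      have "t \<noteq> T" using t s by (auto simp: subdivision_def)
      then show "(x has_vector_derivative ext_deriv T x t) (at t)" using eq[OF d] d t by auto
    qed simp
  qed
qed

lemma PC1_integral:
  fixes x :: "real \<Rightarrow> 'a::banach"
  assumes T: "T > 0" and x: "x \<in> PC1 T W" and t: "t \<in> {0..T}"
  shows "(ext_deriv T x has_integral x t - x 0) {0..t}"
proof -
  obtain F where F: "finite F" "\<And>t. t \<in> {0..T} - F \<Longrightarrow> (x has_vector_derivative ext_deriv T x t) (at t)"
    using PC1_derivative[OF assms(1,2)] by blast
  show ?thesis
    by (rule fundamental_theorem_of_calculus_interior_strong[OF F(1)])
       (use F t x in \<open>auto simp: PC1_def elim: continuous_on_subset\<close>)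
qed

section \<open>Integral equations\<close>

lemma exp_has_integral:
  assumes "0 \<le> t" "L > (0::real)"
  shows "((\<lambda>s. exp (2 * L * s)) has_integral (exp (2 * L * t) - 1) / (2 * L)) {0..t}"
proof -
  have "((\<lambda>s. exp (2 * L * s)) has_integral exp (2 * L * t) / (2 * L) - exp (2 * L * 0) / (2 * L)) {0..t}"
    using assms by (intro fundamental_theorem_of_calculus)
      (auto intro!: derivative_eq_intros simp: has_real_derivative_iff_has_vector_derivative[symmetric])
  then show ?thesis by (simp add: diff_divide_distrib)
qed

text \<open>Integrating L K exp(2 L s) divides by 2 L. The surviving factor 1/2 is what later serves
  both as the contraction constant and as the room for absorption in Gronwall's inequality.\<close>

lemma integral_exp_bound:
  fixes g :: "real \<Rightarrow> 'a::banach"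
  assumes "g integrable_on {0..t}" "0 \<le> t" "L > 0" "\<And>s. s \<in> {0..t} \<Longrightarrow> norm (g s) \<le> L * K * exp (2 * L * s)"
  shows "norm (integral {0..t} g) \<le> K * (exp (2 * L * t) - 1) / 2"
proof -
  have h: "((\<lambda>s. L * K * exp (2 * L * s)) has_integral L * K * ((exp (2 * L * t) - 1) / (2 * L))) {0..t}"
    by (intro has_integral_mult_right exp_has_integral assms)
  have "norm (integral {0..t} g) \<le> integral {0..t} (\<lambda>s. L * K * exp (2 * L * s))"
    using assms h by (intro integral_norm_bound_integral) (auto simp: has_integral_iff)
  also have "\<dots> = L * K * ((exp (2 * L * t) - 1) / (2 * L))" using h by (rule integral_unique)
  finally show ?thesis using assms by simp
qed

text \<open>The weight \<open>exp (-2 L t)\<close> makes the integral operator a contraction with constant \<open>1/2\<close>,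
  which costs a factor 2 in comparison with the usual Gronwall bound.\<close>

lemma gronwall_weighted:
  fixes \<phi> :: "real \<Rightarrow> real"
  assumes "continuous_on {0..T} \<phi>" "L > 0" "\<delta> \<ge> 0"
    and le: "\<And>t. t \<in> {0..T} \<Longrightarrow> \<phi> t \<le> \<delta> + L * integral {0..t} \<phi>"
    and t: "t \<in> {0..T}"
  shows "\<phi> t \<le> 2 * \<delta> * exp (2 * L * t)"
proof -
  \<comment> \<open>At a maximum point of the weighted function, the integral inequality bounds the
    maximum by \<delta> plus at most half of itself, up to the weight.\<close>
  define \<psi> where "\<psi> t = \<phi> t * exp (- (2 * L * t))" for t
  have "continuous_on {0..T} \<psi>" unfolding \<psi>_def by (intro continuous_intros assms)
  moreover have "{0..T} \<noteq> {}" using t by auto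
  ultimately obtain t0 where t0: "t0 \<in> {0..T}" "\<And>s. s \<in> {0..T} \<Longrightarrow> \<psi> s \<le> \<psi> t0"
    using continuous_attains_sup[of "{0..T}" \<psi>] by auto
  \<comment> \<open>\<phi> has no prescribed sign; the truncation keeps the comparison constant
    nonnegative.\<close>
  define m where "m = max 0 (\<psi> t0)"
  have \<phi>\<psi>: "\<phi> s = \<psi> s * exp (2 * L * s)" for s by (simp add: \<psi>_def exp_minus)
  have m: "\<phi> s \<le> m * exp (2 * L * s)" if "s \<in> {0..T}" for s
    unfolding \<phi>\<psi> using t0(2)[OF that] by (intro mult_right_mono) (auto simp: m_def)
  have "m \<le> 2 * \<delta>"
  proof (cases "\<psi> t0 > 0")
    case True
    have h: "((\<lambda>s. m * exp (2 * L * s)) has_integral m * ((exp (2 * L * t0) - 1) / (2 * L))) {0..t0}"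
      using t0 assms by (intro has_integral_mult_right exp_has_integral) auto
    have "integral {0..t0} \<phi> \<le> integral {0..t0} (\<lambda>s. m * exp (2 * L * s))"
      using t0 m by (intro integral_le integrable_continuous_real continuous_on_subset[OF assms(1)] continuous_intros) auto
    also have "\<dots> = m * ((exp (2 * L * t0) - 1) / (2 * L))" using h by (rule integral_unique)
    finally have "L * integral {0..t0} \<phi> \<le> L * (m * ((exp (2 * L * t0) - 1) / (2 * L)))"
      using assms(2) by (intro mult_left_mono) auto
    also have "\<dots> = m * (exp (2 * L * t0) - 1) / 2" using assms(2) by simp
    finally have "m * exp (2 * L * t0) \<le> \<delta> + m * (exp (2 * L * t0) - 1) / 2"
      using le[OF t0(1)] True unfolding \<phi>\<psi>[of t0] by (simp add: m_def)
    then have "m * (exp (2 * L * t0) + 1) \<le> 2 * \<delta>" by (simp add: field_simps)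
    moreover have "m * 1 \<le> m * (exp (2 * L * t0) + 1)" by (intro mult_left_mono) (auto simp: m_def)
    ultimately show ?thesis by simp
  qed (use assms in \<open>auto simp: m_def\<close>)
  then have "m * exp (2 * L * t) \<le> 2 * \<delta> * exp (2 * L * t)" by (intro mult_right_mono) auto
  from m[OF t] this show ?thesis by (rule order_trans)
qed

text \<open>The curve \<open>c\<close> is an approximate solution with defect \<delta>, and the
  Lipschitz condition holds only near it. Writing x = c + exp(2 L t) y turns the integral operator
  into a 1/2-contraction of the ball of radius 2 \<delta>; \<open>r\<close> is large enough for this
  ball to stay in the tube. The same fixed point delivers existence and the distance to
  \<open>c\<close>, which is linear in the defect.\<close>

lemma picard_tube:
  fixes F :: "real \<Rightarrow> 'a::banach \<Rightarrow> 'a" and c :: "real \<Rightarrow> 'a"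
  assumes T: "T > 0" and L: "L > 0" and \<delta>: "\<delta> \<ge> 0" and c: "continuous_on {0..T} c"
    and lip: "\<And>t x y. t \<in> {0..T} \<Longrightarrow> x \<in> cball (c t) r \<Longrightarrow> y \<in> cball (c t) r \<Longrightarrow> norm (F t x - F t y) \<le> L * norm (x - y)"
    and int: "\<And>x. continuous_on {0..T} x \<Longrightarrow> (\<And>t. t \<in> {0..T} \<Longrightarrow> x t \<in> cball (c t) r) \<Longrightarrow> (\<lambda>t. F t (x t)) integrable_on {0..T}"
    and app: "\<And>t. t \<in> {0..T} \<Longrightarrow> norm (\<xi> + integral {0..t} (\<lambda>s. F s (c s)) - c t) \<le> \<delta>"
    and r: "2 * \<delta> * exp (2 * L * T) \<le> r"
  obtains x where "continuous_on {0..T} x" "\<And>t. t \<in> {0..T} \<Longrightarrow> x t = \<xi> + integral {0..t} (\<lambda>s. F s (x s))"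
    "\<And>t. t \<in> {0..T} \<Longrightarrow> norm (x t - c t) \<le> 2 * \<delta> * exp (2 * L * t)"
proof -
  \<comment> \<open>Clamping time to [0,T] extends functions to the whole line, where the complete
    space of bounded continuous functions is available.\<close>
  define cl where "cl t = max 0 (min T t)" for t
  have cl: "cl t \<in> {0..T}" "t \<in> {0..T} \<Longrightarrow> cl t = t" for t using T by (auto simp: cl_def)
  have clc: "continuous_on UNIV cl" unfolding cl_def by (intro continuous_intros)
  define S where "S = {y :: real \<Rightarrow>\<^sub>C 'a. \<forall>t. norm (y t) \<le> 2 * \<delta>}"
  define xx where "xx y s = c s + exp (2 * L * s) *\<^sub>R apply_bcontfun y s" for y s
  define \<Psi> where "\<Psi> y t = exp (- (2 * L * t)) *\<^sub>R (\<xi> + integral {0..t} (\<lambda>s. F s (xx y s)) - c t)" for y t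
  have xc: "continuous_on {0..T} (xx y)" for y unfolding xx_def by (intro continuous_intros c continuous_on_apply_bcontfun)
  have xt: "xx y t \<in> cball (c t) r" if "y \<in> S" "t \<in> {0..T}" for y t
  proof -
    have "norm (exp (2 * L * t) *\<^sub>R apply_bcontfun y t) \<le> exp (2 * L * T) * (2 * \<delta>)"
      unfolding norm_scaleR using that L by (intro mult_mono) (auto simp: S_def)
    then show ?thesis using r by (simp add: xx_def dist_norm mult_ac)
  qed
  have "0 \<le> 2 * \<delta> * exp (2 * L * T)" using \<delta> by simp
  with r have "0 \<le> r" by linarith
  then have ct: "c t \<in> cball (c t) r" for t by simp
  have intx: "(\<lambda>s. F s (xx y s)) integrable_on {0..t}" if "y \<in> S" "t \<in> {0..T}" for y t
    using integrable_subinterval_real[OF int[OF xc xt[OF that(1)]]] that by auto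
  have intc: "(\<lambda>s. F s (c s)) integrable_on {0..t}" if "t \<in> {0..T}" for t
    using integrable_subinterval_real[OF int[OF c ct]] that by auto
  have e1: "exp (- (2 * L * t)) * (K * (exp (2 * L * t) - 1) / 2) \<le> K / 2" if "K \<ge> 0" for K t :: real
    using that by (simp add: exp_minus field_simps)
  have \<Psi>S: "norm (\<Psi> y t) \<le> 2 * \<delta>" if y: "y \<in> S" and t: "t \<in> {0..T}" for y t
  proof -
    have "\<xi> + integral {0..t} (\<lambda>s. F s (xx y s)) - c t =
       (\<xi> + integral {0..t} (\<lambda>s. F s (c s)) - c t) + integral {0..t} (\<lambda>s. F s (xx y s) - F s (c s))"
      using intx[OF y t] intc[OF t] by (simp add: integral_diff)
    also have "norm \<dots> \<le> \<delta> + (2 * \<delta>) * (exp (2 * L * t) - 1) / 2"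
    proof (intro norm_triangle_mono app[OF t] integral_exp_bound integrable_diff intx[OF y t] intc[OF t])
      fix s assume s: "s \<in> {0..t}"
      then have s': "s \<in> {0..T}" using t by auto
      have "norm (F s (xx y s) - F s (c s)) \<le> L * norm (xx y s - c s)" by (intro lip s' xt[OF y] ct)
      also have "\<dots> \<le> L * (2 * \<delta> * exp (2 * L * s))"
        using L y by (intro mult_left_mono) (auto simp: xx_def S_def)
      finally show "norm (F s (xx y s) - F s (c s)) \<le> L * (2 * \<delta>) * exp (2 * L * s)" by (simp add: mult_ac)
    qed (use t L in auto)
    \<comment> \<open>With radius 2 \<delta> the integral contributes \<delta> (exp(2 L t) - 1), so
      the constant terms cancel and the weight removes the rest.\<close>
    also have "\<dots> = \<delta> * exp (2 * L * t)" by (simp add: field_simps)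
    finally have "norm (\<Psi> y t) \<le> exp (- (2 * L * t)) * (\<delta> * exp (2 * L * t))" by (simp add: \<Psi>_def)
    also have "\<dots> = \<delta>" by (simp add: exp_minus)
    finally show ?thesis using \<delta> by simp
  qed
  have \<Psi>c: "continuous_on {0..T} (\<Psi> y)" if "y \<in> S" for y
    unfolding \<Psi>_def using intx[OF that, of T] T by (intro continuous_intros c indefinite_integral_continuous_1) auto
  have bc: "(\<lambda>t. \<Psi> y (cl t)) \<in> bcontfun" if y: "y \<in> S" for y
    unfolding bcontfun_def
  proof (intro CollectI conjI)
    show "continuous_on UNIV (\<lambda>t. \<Psi> y (cl t))"
      by (rule continuous_on_compose2[OF \<Psi>c[OF y] clc]) (use cl in auto)
    show "bounded (range (\<lambda>t. \<Psi> y (cl t)))"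
      unfolding bounded_iff using \<Psi>S[OF y cl(1)] by blast
  qed
  define \<Phi> where "\<Phi> y = Bcontfun (\<lambda>t. \<Psi> y (cl t))" for y
  have \<Phi>: "apply_bcontfun (\<Phi> y) t = \<Psi> y (cl t)" if "y \<in> S" for y t
    using Bcontfun_inverse[OF bc[OF that]] by (simp add: \<Phi>_def)
  have "closed S"
    unfolding closed_sequential_limits
  proof (intro allI impI, elim conjE)
    fix Y :: "nat \<Rightarrow> (real \<Rightarrow>\<^sub>C 'a)" and y assume Y: "\<forall>n. Y n \<in> S" "Y \<longlonglongrightarrow> y"
    have "norm (y t) \<le> 2 * \<delta>" for t
    proof (rule LIMSEQ_le_const2)
      show "(\<lambda>n. norm (Y n t)) \<longlonglongrightarrow> norm (y t)"
        using tendsto_uniform_limitI[OF tendsto_bcontfun_uniform_limit[OF Y(2)]] by (intro tendsto_norm) auto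
    qed (use Y in \<open>auto simp: S_def\<close>)
    then show "y \<in> S" by (simp add: S_def)
  qed
  then have "complete S" by (simp add: complete_eq_closed)
  moreover have "const_bcontfun 0 \<in> S" using \<delta> by (simp add: S_def const_bcontfun.rep_eq)
  moreover have "\<Phi> ` S \<subseteq> S" using \<Psi>S cl by (auto simp: S_def \<Phi>)
  moreover have "dist (\<Phi> y) (\<Phi> z) \<le> 1/2 * dist y z" if y: "y \<in> S" and z: "z \<in> S" for y z
  proof (rule dist_bound)
    fix t0
    define t where "t = cl t0"
    have t: "t \<in> {0..T}" using cl by (simp add: t_def)
    have "\<Psi> y t - \<Psi> z t = exp (- (2 * L * t)) *\<^sub>R integral {0..t} (\<lambda>s. F s (xx y s) - F s (xx z s))"
      using intx[OF y t] intx[OF z t] by (simp add: \<Psi>_def integral_diff algebra_simps)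
    then have "norm (\<Psi> y t - \<Psi> z t) = exp (- (2 * L * t)) * norm (integral {0..t} (\<lambda>s. F s (xx y s) - F s (xx z s)))"
      by simp
    also have "\<dots> \<le> exp (- (2 * L * t)) * (dist y z * (exp (2 * L * t) - 1) / 2)"
    proof (intro mult_left_mono integral_exp_bound integrable_diff intx[OF y t] intx[OF z t])
      fix s assume s: "s \<in> {0..t}"
      then have s': "s \<in> {0..T}" using t by auto
      have "norm (F s (xx y s) - F s (xx z s)) \<le> L * norm (xx y s - xx z s)" by (intro lip s' xt[OF y] xt[OF z])
      also have "xx y s - xx z s = exp (2 * L * s) *\<^sub>R (apply_bcontfun y s - apply_bcontfun z s)"
        by (simp add: xx_def algebra_simps)
      also have "L * norm (exp (2 * L * s) *\<^sub>R (apply_bcontfun y s - apply_bcontfun z s)) \<le> L * (exp (2 * L * s) * dist y z)"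
        using L dist_bounded[of y s z] by (intro mult_left_mono) (auto simp: dist_norm)
      finally show "norm (F s (xx y s) - F s (xx z s)) \<le> L * dist y z * exp (2 * L * s)" by (simp add: mult_ac)
    qed (use t L in auto)
    also have "\<dots> \<le> dist y z / 2" by (rule e1) simp
    finally show "dist (apply_bcontfun (\<Phi> y) t0) (apply_bcontfun (\<Phi> z) t0) \<le> 1/2 * dist y z"
      by (simp add: \<Phi>[OF y] \<Phi>[OF z] t_def dist_norm)
  qed
  ultimately obtain y where y: "y \<in> S" "\<Phi> y = y"
    using Banach_fix[of S "1/2" \<Phi>] by auto
  show ?thesis
  proof (rule that[of "xx y"])
    fix t assume t: "t \<in> {0..T}"
    have "apply_bcontfun y t = \<Psi> y t" using \<Phi>[OF y(1), of t] y(2) cl(2)[OF t] by simp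
    then show "xx y t = \<xi> + integral {0..t} (\<lambda>s. F s (xx y s))"
      unfolding xx_def[of y t] by (simp add: \<Psi>_def exp_minus)
    show "norm (xx y t - c t) \<le> 2 * \<delta> * exp (2 * L * t)" using y(1) by (auto simp: xx_def S_def mult_ac)
  qed (rule xc)
qed

lemma norm_integral_le_length:
  fixes g :: "real \<Rightarrow> 'a::banach"
  assumes "g integrable_on {0..T}" "\<And>t. t \<in> {0..T} \<Longrightarrow> norm (g t) \<le> B" "t \<in> {0..T}"
  shows "norm (integral {0..t} g) \<le> T * B"
proof -
  have "norm (integral {0..t} g) \<le> integral {0..t} (\<lambda>_. B)"
    using assms by (intro integral_norm_bound_integral integrable_subinterval_real[OF assms(1)]) auto
  also have "\<dots> = t * B" using assms by simp
  also have "\<dots> \<le> T * B"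
    using assms by (intro mult_right_mono) (auto intro: order_trans[OF norm_ge_zero assms(2)[OF assms(3)]])
  finally show ?thesis .
qed

text \<open>For a globally Lipschitz right-hand side the tube may be as wide as desired. It is taken
  around the constant curve \<xi>, whose defect is at most T B.\<close>

lemma linear_ode_solution:
  fixes F :: "real \<Rightarrow> 'a::banach \<Rightarrow> 'a" and \<xi> :: 'a
  assumes T: "T > 0" and L: "L > 0"
    and lip: "\<And>t x y. t \<in> {0..T} \<Longrightarrow> norm (F t x - F t y) \<le> L * norm (x - y)"
    and reg: "\<And>x. continuous_on {0..T} x \<Longrightarrow> (\<lambda>t. F t (x t)) \<in> NPC0R T euclidean"
  obtains x where "continuous_on {0..T} x" "\<And>t. t \<in> {0..T} \<Longrightarrow> x t = \<xi> + integral {0..t} (\<lambda>s. F s (x s))"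
proof -
  have r: "(\<lambda>t. F t \<xi>) \<in> NPC0R T euclidean" by (rule reg) simp
  obtain B where B: "B > 0" "\<And>t. t \<in> {0..T} \<Longrightarrow> norm (F t \<xi>) \<le> B" using NPC0R_bounded[OF T r] by blast
  show ?thesis
  proof (rule picard_tube[OF T L, where \<delta> = "T * B" and c = "\<lambda>_. \<xi>" and F = F and \<xi> = \<xi>])
    show "norm (\<xi> + integral {0..t} (\<lambda>s. F s \<xi>) - \<xi>) \<le> T * B" if "t \<in> {0..T}" for t
      using norm_integral_le_length[OF NPC0R_integrable[OF T r] B(2) that] by simp
    show "2 * (T * B) * exp (2 * L * T) \<le> 2 * (T * B) * exp (2 * L * T)" by simp
  qed (use T B lip NPC0R_integrable[OF T reg] that in auto)
qed

section \<open>Products of regular functions and the linearised equation\<close>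

lemma NPC0R_continuous_on:
  assumes "T > 0" "continuous_on {0..T} (x :: real \<Rightarrow> 'a::topological_space)"
  shows "x \<in> NPC0R T euclidean"
  using NPC0R_continuous[OF assms, of UNIV] by simp

lemma NPC0R_compose2:
  fixes u :: "real \<Rightarrow> 'a::real_normed_vector" and v :: "real \<Rightarrow> 'b::real_normed_vector" and \<phi> :: "'a \<Rightarrow> 'b \<Rightarrow> 'c::real_normed_vector"
  assumes T: "T > 0" and "u \<in> NPC0R T euclidean" "v \<in> NPC0R T euclidean"
    and "continuous_on UNIV (\<lambda>p. \<phi> (fst p) (snd p))"
  shows "(\<lambda>t. \<phi> (u t) (v t)) \<in> NPC0R T euclidean"
proof -
  have "(\<lambda>t. (u t, v t)) \<in> NPC0R T euclidean"
    using NPC0R_pair[OF assms(1-3)] by (simp add: euclidean_product_topology)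
  from NPC0R_compose[OF T this, of euclidean "\<lambda>p. \<phi> (fst p) (snd p)"] assms(4) show ?thesis by simp
qed

lemmas NPC0R_diff = NPC0R_compose2[where \<phi> = "(-)"]

lemma NPC0R_norm:
  fixes u :: "real \<Rightarrow> 'a::real_normed_vector"
  assumes "T > 0" "u \<in> NPC0R T euclidean"
  shows "(\<lambda>t. norm (u t)) \<in> NPC0R T euclidean"
  using NPC0R_compose[OF assms, of euclidean norm] by (simp add: continuous_intros)

lemma NPC0R_blinfun_apply:
  fixes u :: "real \<Rightarrow> 'a::real_normed_vector \<Rightarrow>\<^sub>L 'b::real_normed_vector" and v :: "real \<Rightarrow> 'a"
  assumes "T > 0" "u \<in> NPC0R T euclidean" "v \<in> NPC0R T euclidean"
  shows "(\<lambda>t. u t (v t)) \<in> NPC0R T euclidean"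
  by (rule NPC0R_compose2[OF assms]) (intro continuous_intros)

lemma NPC0R_blinfun_compose:
  fixes u :: "real \<Rightarrow> 'b::real_normed_vector \<Rightarrow>\<^sub>L 'c::real_normed_vector" and v :: "real \<Rightarrow> 'a::real_normed_vector \<Rightarrow>\<^sub>L 'b"
  assumes "T > 0" "u \<in> NPC0R T euclidean" "v \<in> NPC0R T euclidean"
  shows "(\<lambda>t. u t o\<^sub>L v t) \<in> NPC0R T euclidean"
  by (rule NPC0R_compose2[OF assms])
    (intro bounded_bilinear.continuous_on[OF bounded_bilinear_blinfun_compose] continuous_intros)

lemma constant_of_derivative_zero:
  fixes Z :: "real \<Rightarrow> 'a::banach"
  assumes "finite F" "continuous_on {0..T} Z" "\<And>t. t \<in> {0..T} - F \<Longrightarrow> (Z has_vector_derivative 0) (at t)"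
    and t: "t \<in> {0..T}"
  shows "Z t = Z 0"
proof -
  have "((\<lambda>_. 0) has_integral Z t - Z 0) {0..t}"
    by (rule fundamental_theorem_of_calculus_interior_strong[OF assms(1)])
      (use assms in \<open>auto elim: continuous_on_subset\<close>)
  then show ?thesis using has_integral_unique has_integral_0 by fastforce
qed

lemma blinfun_compose_assoc: "(a o\<^sub>L b) o\<^sub>L c = a o\<^sub>L (b o\<^sub>L c)"
  by (rule blinfun_eqI) simp

lemma blinfun_compose_id [simp]: "id_blinfun o\<^sub>L a = a" "a o\<^sub>L id_blinfun = a"
  by (rule blinfun_eqI; simp)+

text \<open>\<open>X\<close> solves X' = A X and \<open>Y\<close> solves Y' = -Y A. The derivative
  of Y X vanishes at once, but in infinite dimension this one-sided inverse does not yield the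
  other, and it is X Y = id that is used below. It is obtained separately: Z = X Y - id satisfies
  the linear equation Z' = A Z - Z A with Z(0) = 0.\<close>

lemma fundamental_solution:
  fixes A :: "real \<Rightarrow> 'e::banach \<Rightarrow>\<^sub>L 'e"
  assumes T: "T > 0" and A: "A \<in> NPC0R T euclidean"
  obtains X Y :: "real \<Rightarrow> 'e \<Rightarrow>\<^sub>L 'e" and F where "continuous_on {0..T} X" "continuous_on {0..T} Y" "finite F"
    "\<And>t. t \<in> {0..T} - F \<Longrightarrow> (X has_vector_derivative (A t o\<^sub>L X t)) (at t)"
    "\<And>t. t \<in> {0..T} - F \<Longrightarrow> (Y has_vector_derivative - (Y t o\<^sub>L A t)) (at t)"
    "\<And>t. t \<in> {0..T} \<Longrightarrow> X t o\<^sub>L Y t = id_blinfun"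
    "\<And>t. t \<in> {0..T} \<Longrightarrow> Y t = Y 0 + integral {0..t} (\<lambda>s. - (Y s o\<^sub>L A s))"
proof -
  note bb = bounded_bilinear_blinfun_compose
  obtain B where B: "B > 0" "\<And>t. t \<in> {0..T} \<Longrightarrow> norm (A t) \<le> B" using NPC0R_bounded[OF T A] by blast
  have regX: "(\<lambda>t. A t o\<^sub>L x t) \<in> NPC0R T euclidean" if "continuous_on {0..T} x" for x
    by (rule NPC0R_blinfun_compose[OF T A NPC0R_continuous_on[OF T that]])
  have regY: "(\<lambda>t. - (x t o\<^sub>L A t)) \<in> NPC0R T euclidean" if "continuous_on {0..T} x" for x
    using NPC0R_compose[OF T NPC0R_blinfun_compose[OF T NPC0R_continuous_on[OF T that] A], of euclidean uminus]
    by (simp add: continuous_intros)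
  have lipX: "norm ((A t o\<^sub>L x) - (A t o\<^sub>L y)) \<le> B * norm (x - y)" if "t \<in> {0..T}" for t and x y :: "'e \<Rightarrow>\<^sub>L 'e"
    using norm_blinfun_compose[of "A t" "x - y"] mult_right_mono[OF B(2)[OF that] norm_ge_zero[of "x - y"]]
    by (simp add: bounded_bilinear.diff_right[OF bb])
  have lipY: "norm (- (x o\<^sub>L A t) - - (y o\<^sub>L A t)) \<le> B * norm (x - y)" if "t \<in> {0..T}" for t and x y :: "'e \<Rightarrow>\<^sub>L 'e"
    using norm_blinfun_compose[of "x - y" "A t"] mult_left_mono[OF B(2)[OF that] norm_ge_zero[of "x - y"]]
    by (simp add: bounded_bilinear.diff_left[OF bb] norm_minus_commute mult.commute)
  obtain X where X: "continuous_on {0..T} X" "\<And>t. t \<in> {0..T} \<Longrightarrow> X t = id_blinfun + integral {0..t} (\<lambda>s. A s o\<^sub>L X s)"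
    using linear_ode_solution[OF T B(1) lipX regX, of id_blinfun] by blast
  obtain Y where Y: "continuous_on {0..T} Y" "\<And>t. t \<in> {0..T} \<Longrightarrow> Y t = id_blinfun + integral {0..t} (\<lambda>s. - (Y s o\<^sub>L A s))"
    using linear_ode_solution[OF T B(1) lipY regY, of id_blinfun] by blast
  have X0: "X 0 = id_blinfun" and Y0: "Y 0 = id_blinfun" using X(2)[of 0] Y(2)[of 0] T by auto
  obtain F1 where F1: "finite F1" "\<And>t. t \<in> {0..T} - F1 \<Longrightarrow> (X has_vector_derivative (A t o\<^sub>L X t)) (at t)"
    by (rule integral_NPC0R_derivative[OF T regX[OF X(1)], of X]) (use X(2) X0 in auto)
  obtain F2 where F2: "finite F2" "\<And>t. t \<in> {0..T} - F2 \<Longrightarrow> (Y has_vector_derivative - (Y t o\<^sub>L A t)) (at t)"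
    by (rule integral_NPC0R_derivative[OF T regY[OF Y(1)], of Y]) (use Y(2) Y0 in auto)
  define F where "F = F1 \<union> F2"
  have F: "finite F" using F1 F2 by (simp add: F_def)
  have dX: "(X has_vector_derivative (A t o\<^sub>L X t)) (at t)"
    and dY: "(Y has_vector_derivative - (Y t o\<^sub>L A t)) (at t)" if "t \<in> {0..T} - F" for t
    using that F1 F2 by (auto simp: F_def)
  have XY: "X t o\<^sub>L Y t = id_blinfun" if t: "t \<in> {0..T}" for t
  proof -
    define Z where "Z t = (X t o\<^sub>L Y t) - id_blinfun" for t
    have dZ: "(Z has_vector_derivative ((A t o\<^sub>L Z t) - (Z t o\<^sub>L A t))) (at t)" if "t \<in> {0..T} - F" for t
      unfolding Z_def
      using has_vector_derivative_diff[OF bounded_bilinear.has_vector_derivative[OF bb dX[OF that] dY[OF that]] has_vector_derivative_const[of id_blinfun]]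
      by (simp add: bounded_bilinear.minus_right[OF bb] blinfun_compose_assoc
          bounded_bilinear.diff_right[OF bb] bounded_bilinear.diff_left[OF bb])
    have cZ: "continuous_on {0..T} Z"
      unfolding Z_def by (intro continuous_intros bounded_bilinear.continuous_on[OF bb] X Y)
    have Z0: "Z 0 = 0" using X0 Y0 by (simp add: Z_def)
    \<comment> \<open>Gronwall with defect 0 and constant 2 B, one \<open>B\<close> for each of the
      two products.\<close>
    have "norm (Z t) \<le> 2 * 0 * exp (2 * (2 * B) * t)"
    proof (rule gronwall_weighted[where T = T])
      fix t assume t: "t \<in> {0..T}"
      have h: "((\<lambda>t. (A t o\<^sub>L Z t) - (Z t o\<^sub>L A t)) has_integral Z t - Z 0) {0..t}"
        by (rule fundamental_theorem_of_calculus_interior_strong[OF F])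
          (use t dZ cZ in \<open>auto elim: continuous_on_subset\<close>)
      then have "norm (Z t) = norm (integral {0..t} (\<lambda>t. (A t o\<^sub>L Z t) - (Z t o\<^sub>L A t)))"
        using Z0 by (simp add: has_integral_iff)
      also have "\<dots> \<le> integral {0..t} (\<lambda>t. (2 * B) * norm (Z t))"
      proof (rule integral_norm_bound_integral)
        show "(\<lambda>t. (A t o\<^sub>L Z t) - (Z t o\<^sub>L A t)) integrable_on {0..t}" using h by blast
        show "(\<lambda>t. 2 * B * norm (Z t)) integrable_on {0..t}"
          using t by (intro integrable_continuous_real continuous_intros continuous_on_subset[OF cZ]) auto
        fix s assume "s \<in> {0..t}"
        then have s: "s \<in> {0..T}" using t by auto
        have "norm ((A s o\<^sub>L Z s) - (Z s o\<^sub>L A s)) \<le> norm (A s) * norm (Z s) + norm (Z s) * norm (A s)"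
          by (rule order_trans[OF norm_triangle_ineq4]) (intro add_mono norm_blinfun_compose)
        also have "\<dots> = 2 * norm (A s) * norm (Z s)" by simp
        also have "\<dots> \<le> 2 * B * norm (Z s)" using B(2)[OF s] by (intro mult_right_mono) auto
        finally show "norm ((A s o\<^sub>L Z s) - (Z s o\<^sub>L A s)) \<le> 2 * B * norm (Z s)" .
      qed
      also have "\<dots> = 2 * B * integral {0..t} (\<lambda>t. norm (Z t))" by simp
      finally show "norm (Z t) \<le> 0 + 2 * B * integral {0..t} (\<lambda>t. norm (Z t))" by simp
    qed (use cZ B t in \<open>auto intro: continuous_intros\<close>)
    then show ?thesis by (simp add: Z_def)
  qed
  show ?thesis
  proof (rule that[OF X(1) Y(1) F])
    show "Y t = Y 0 + integral {0..t} (\<lambda>s. - (Y s o\<^sub>L A s))" if "t \<in> {0..T}" for t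
      unfolding Y0 by (rule Y(2)[OF that])
  qed (rule dX dY XY, assumption)+
qed

section \<open>Control systems around a reference process\<close>

lemma integrand_path_continuous:
  assumes \<phi>: "continuous_map (prod_topology (top_of_set {0..T}) (prod_topology (top_of_set \<Omega>) U)) W (\<lambda>(t, \<xi>, \<zeta>). \<phi> t \<xi> \<zeta>)"
    and x: "continuous_on {0..T} x" "\<And>t. t \<in> {0..T} \<Longrightarrow> x t \<in> \<Omega>"
  shows "continuous_map (prod_topology (top_of_set {0..T}) U) W (\<lambda>(t, \<zeta>). \<phi> t (x t) \<zeta>)"
proof -
  have c: "continuous_map (top_of_set {0..T}) (top_of_set \<Omega>) x" using x by auto
  have "continuous_map (prod_topology (top_of_set {0..T}) U) (prod_topology (top_of_set {0..T}) (prod_topology (top_of_set \<Omega>) U))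
    (\<lambda>p. (fst p, x (fst p), snd p))"
    by (intro continuous_map_pairedI continuous_map_fst continuous_map_snd
        continuous_map_compose[OF continuous_map_fst c, unfolded o_def])
  from continuous_map_compose[OF this \<phi>] show ?thesis by (simp add: o_def case_prod_unfold)
qed

lemma integrand_path_NPC0R:
  assumes "T > 0" "continuous_map (prod_topology (top_of_set {0..T}) (prod_topology (top_of_set \<Omega>) U)) W (\<lambda>(t, \<xi>, \<zeta>). \<phi> t \<xi> \<zeta>)"
    and "continuous_on {0..T} x" "\<And>t. t \<in> {0..T} \<Longrightarrow> x t \<in> \<Omega>" "u \<in> NPC0R T U"
  shows "(\<lambda>t. \<phi> t (x t) (u t)) \<in> NPC0R T W"
  by (rule NPC0R_tcompose[OF assms(1,5) integrand_path_continuous[OF assms(2,3,4)]])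

text \<open>The interface is abstract because it is instantiated twice, for the state in E and for
  the state augmented by the cost. Differentiability is required along the reference trajectory
  only; away from it, \<open>tube\<close> provides a Lipschitz bound, uniform in time and over
  compact sets of controls.\<close>

locale controlled_process =
  fixes T :: real and \<Omega> :: "'e::banach set" and U :: "'u topology"
    and f :: "real \<Rightarrow> 'e \<Rightarrow> 'u \<Rightarrow> 'e" and A :: "real \<Rightarrow> 'u \<Rightarrow> 'e \<Rightarrow>\<^sub>L 'e"
    and x0 :: "real \<Rightarrow> 'e" and u0 :: "real \<Rightarrow> 'u"
  assumes T: "T > 0"
    and fcont: "continuous_map (prod_topology (top_of_set {0..T}) (prod_topology (top_of_set \<Omega>) U)) euclidean
       (\<lambda>(t, \<xi>, \<zeta>). f t \<xi> \<zeta>)"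
    and fderiv: "\<And>t \<zeta>. t \<in> {0..T} \<Longrightarrow> \<zeta> \<in> topspace U \<Longrightarrow> ((\<lambda>y. f t y \<zeta>) has_derivative blinfun_apply (A t \<zeta>)) (at (x0 t))"
    and Acont: "continuous_map (prod_topology (top_of_set {0..T}) U) euclidean (\<lambda>(t, \<zeta>). A t \<zeta>)"
    and tube: "\<And>M. compactin U M \<Longrightarrow> \<exists>r>0. \<exists>L>0. \<forall>t\<in>{0..T}. cball (x0 t) r \<subseteq> \<Omega> \<and>
       (\<forall>\<zeta>\<in>M. \<forall>x\<in>cball (x0 t) r. \<forall>y\<in>cball (x0 t) r. norm (f t x \<zeta> - f t y \<zeta>) \<le> L * norm (x - y))"
    and x0: "x0 \<in> PC1 T \<Omega>" and u0: "u0 \<in> NPC0R T U"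
    and x0_deriv: "\<And>t. t \<in> {0..T} \<Longrightarrow> ext_deriv T x0 t = f t (x0 t) (u0 t)"
begin

lemma x0_cont: "continuous_on {0..T} x0" and x0_mem: "t \<in> {0..T} \<Longrightarrow> x0 t \<in> \<Omega>"
  using x0 by (auto simp: PC1_def)

lemma u0_mem: "t \<in> {0..T} \<Longrightarrow> u0 t \<in> topspace U"
  using u0 by (auto simp: NPC0R_iff[OF T])

lemmas f_path_continuous = integrand_path_continuous[OF fcont]
lemmas f_NPC0R = integrand_path_NPC0R[OF T fcont]

lemma f_path_bounded:
  assumes "continuous_on {0..T} x" "\<And>t. t \<in> {0..T} \<Longrightarrow> x t \<in> \<Omega>" "compactin U M"
  obtains K where "K > 0" "\<And>t \<zeta>. t \<in> {0..T} \<Longrightarrow> \<zeta> \<in> M \<Longrightarrow> norm (f t (x t) \<zeta>) \<le> K"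
proof -
  have "compactin (prod_topology (top_of_set {0..T}) U) ({0..T} \<times> M)"
    using assms(3) by (simp add: compactin_Times compactin_subtopology)
  from image_compactin[OF this f_path_continuous[OF assms(1,2)]]
  have "bounded ((\<lambda>(t, \<zeta>). f t (x t) \<zeta>) ` ({0..T} \<times> M))" by (simp add: compact_imp_bounded)
  then obtain K where "K > 0" "\<forall>y\<in>(\<lambda>(t, \<zeta>). f t (x t) \<zeta>) ` ({0..T} \<times> M). norm y \<le> K"
    using bounded_pos by blast
  then show ?thesis by (intro that[of K]) auto
qed

abbreviation "A0 \<equiv> \<lambda>t. A t (u0 t)"

lemma A0_NPC0R: "A0 \<in> NPC0R T euclidean"
  using NPC0R_tcompose[OF T u0 Acont] .

lemma x0_integral: "t \<in> {0..T} \<Longrightarrow> x0 t = x0 0 + integral {0..t} (\<lambda>s. f s (x0 s) (u0 s))"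
proof -
  assume t: "t \<in> {0..T}"
  have "((\<lambda>s. f s (x0 s) (u0 s)) has_integral x0 t - x0 0) {0..t}"
    using PC1_integral[OF T x0 t] by (rule has_integral_eq[rotated]) (use t x0_deriv in auto)
  then show ?thesis by (simp add: has_integral_iff)
qed

text \<open>The integral form is what fixed points produce and what passes to the limit;
  \<open>trajectory_PC1\<close> recovers the differential form demanded of admissible
  processes.\<close>

definition trajectory :: "(real \<Rightarrow> 'e) \<Rightarrow> (real \<Rightarrow> 'u) \<Rightarrow> bool" where
  "trajectory x u \<longleftrightarrow> continuous_on {0..T} x \<and> (\<forall>t\<in>{0..T}. x t \<in> \<Omega>) \<and> u \<in> NPC0R T U \<and>
     (\<forall>t\<in>{0..T}. x t = x0 0 + integral {0..t} (\<lambda>s. f s (x s) (u s)))"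

definition reachable :: "'e set" where
  "reachable = {x T | x u. trajectory x u}"

lemma trajectory_PC1:
  assumes "trajectory x u"
  shows "x \<in> PC1 T \<Omega>" "x 0 = x0 0" "t \<in> {0..T} \<Longrightarrow> ext_deriv T x t = f t (x t) (u t)"
proof -
  have x: "continuous_on {0..T} x" "\<And>t. t \<in> {0..T} \<Longrightarrow> x t \<in> \<Omega>" "u \<in> NPC0R T U"
    and e: "\<And>t. t \<in> {0..T} \<Longrightarrow> x t = x0 0 + integral {0..t} (\<lambda>s. f s (x s) (u s))"
    using assms by (auto simp: trajectory_def)
  have reg: "(\<lambda>t. f t (x t) (u t)) \<in> NPC0R T euclidean" by (rule f_NPC0R[OF x(1) _ x(3)]) (rule x(2))
  show x00: "x 0 = x0 0" using e[of 0] T by simp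
  have eq: "\<And>t. t \<in> {0..T} \<Longrightarrow> x t = x 0 + integral {0..t} (\<lambda>s. f s (x s) (u s))"
    unfolding x00 by (rule e)
  show "x \<in> PC1 T \<Omega>"
  proof (rule integral_NPC0R_PC1[OF T reg])
    show "x ` {0..T} \<subseteq> \<Omega>" using x(2) by blast
  qed (rule eq)
  show "ext_deriv T x t = f t (x t) (u t)" if "t \<in> {0..T}"
    by (rule integral_NPC0R_ext_deriv[OF T reg _ that]) (rule eq)
qed

end

section \<open>Needle variations\<close>

text \<open>Needle i is pushed to the right by the total length of the needles before it. Several
  needles may thus share one base point, which is unavoidable when a combination uses different
  control values at the same time.\<close>

definition needle_interval :: "(nat \<Rightarrow> real) \<Rightarrow> (nat \<Rightarrow> real) \<Rightarrow> nat \<Rightarrow> real set" where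
  "needle_interval \<tau> a i = {\<tau> i + sum a {..<i} ..< \<tau> i + sum a {..<Suc i}}"

primrec needle_control :: "(real \<Rightarrow> 'u) \<Rightarrow> (nat \<Rightarrow> real) \<Rightarrow> (nat \<Rightarrow> 'u) \<Rightarrow> nat \<Rightarrow> (nat \<Rightarrow> real) \<Rightarrow> real \<Rightarrow> 'u" where
  "needle_control u \<tau> z 0 a = u"
| "needle_control u \<tau> z (Suc n) a = (\<lambda>s. if s \<in> needle_interval \<tau> a n then z n else needle_control u \<tau> z n a s)"

section \<open>Needle controls and integrals over needles\<close>

lemma needle_control_in:
  assumes "\<And>i j. i < j \<Longrightarrow> j < N \<Longrightarrow> needle_interval \<tau> a i \<inter> needle_interval \<tau> a j = {}"
    "i < N" "s \<in> needle_interval \<tau> a i"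
  shows "needle_control u \<tau> z N a s = z i"
  using assms
proof (induction N)
  case (Suc N)
  show ?case
  proof (cases "i = N")
    case False
    then have "s \<notin> needle_interval \<tau> a N" using Suc.prems(1)[of i N] Suc.prems(2,3) by force
    then show ?thesis using Suc False by auto
  qed (use Suc in auto)
qed simp

lemma needle_control_out:
  "(\<And>i. i < N \<Longrightarrow> s \<notin> needle_interval \<tau> a i) \<Longrightarrow> needle_control u \<tau> z N a s = u s"
  by (induction N) auto

lemma needle_control_cong:
  "(\<And>i. i < N \<Longrightarrow> s \<in> needle_interval \<tau> a i \<longleftrightarrow> s \<in> needle_interval \<tau> b i) \<Longrightarrow>
   needle_control u \<tau> z N a s = needle_control u \<tau> z N b s"
  by (induction N) auto

lemma needle_control_mem:
  "(\<And>i. i < N \<Longrightarrow> z i \<in> M) \<Longrightarrow> u s \<in> M \<Longrightarrow> needle_control u \<tau> z N a s \<in> M"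
  by (induction N) auto

lemma needle_control_NPC0R:
  assumes T: "T > 0" and u: "u \<in> NPC0R T U"
    and "\<And>i. i < N \<Longrightarrow> z i \<in> topspace U" "\<And>i. i < N \<Longrightarrow> 0 \<le> \<tau> i + sum a {..<i}" "\<And>i. i < N \<Longrightarrow> \<tau> i + sum a {..<Suc i} < T"
  shows "needle_control u \<tau> z N a \<in> NPC0R T U"
  using assms(3-)
proof (induction N)
  case (Suc N)
  have "(\<lambda>s. if s \<in> {\<tau> N + sum a {..<N} ..< \<tau> N + sum a {..<Suc N}} then z N else needle_control u \<tau> z N a s) \<in> NPC0R T U"
    by (rule NPC0R_splice[OF T _ NPC0R_const[OF T]]) (use Suc in auto)
  then show ?case by (simp add: needle_interval_def)
qed (simp add: u)

lemma has_integral_indicator_interval: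
  fixes v :: "'a::banach"
  assumes "a \<le> c" "c \<le> d" "d \<le> (b::real)"
  shows "((\<lambda>s. indicat_real {c..<d} s *\<^sub>R v) has_integral (d - c) *\<^sub>R v) {a..b}"
proof -
  have "((\<lambda>s. if s \<in> cbox c d then v else 0) has_integral (d - c) *\<^sub>R v) (cbox a b)"
    using has_integral_const_real[of v c d] assms
    by (intro has_integral_restrict_closed_subinterval) auto
  then show ?thesis
    unfolding box_real by (rule has_integral_spike_finite[of "{d}", rotated 2]) (auto simp: indicator_def)
qed

lemma has_integral_norm_bound:
  fixes g :: "real \<Rightarrow> 'a::banach"
  assumes "(g has_integral I) {a..b}" "(h has_integral H) {a..b}" "\<And>s. s \<in> {a..b} \<Longrightarrow> norm (g s) \<le> h s"
  shows "norm I \<le> H"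
  using integral_norm_bound_integral[of g "{a..b}" h] assms by (auto simp: has_integral_iff)

text \<open>\<open>Y\<close> transports perturbations back to a common reference time.
  \<open>X\<close> serves to undo this at the end time, for which the one-sided identity
  \<open>XY\<close> is enough.\<close>

locale linearised_process = controlled_process +
  fixes X Y :: "real \<Rightarrow> 'a \<Rightarrow>\<^sub>L 'a" and F :: "real set"
  assumes Yc: "continuous_on {0..T} Y" and F: "finite F"
    and dY: "\<And>t. t \<in> {0..T} - F \<Longrightarrow> (Y has_vector_derivative - (Y t o\<^sub>L A t (u0 t))) (at t)"
    and XY: "\<And>t. t \<in> {0..T} \<Longrightarrow> X t o\<^sub>L Y t = id_blinfun"
begin

text \<open>The jump of the dynamics caused by \<zeta> at time s, pulled back by \<open>Y\<close>.
  Applying \<open>X T\<close> gives its effect on the endpoint, X(T) Y(s) being the resolvent of the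
  linearised equation.\<close>

definition needle_jump :: "'b \<Rightarrow> real \<Rightarrow> 'a" where
  "needle_jump \<zeta> s = Y s (f s (x0 s) \<zeta> - f s (x0 s) (u0 s))"

lemma needle_jump_NPC0R:
  assumes "\<zeta> \<in> topspace U" shows "needle_jump \<zeta> \<in> NPC0R T euclidean"
proof -
  have "(\<lambda>s. f s (x0 s) \<zeta> - f s (x0 s) (u0 s)) \<in> NPC0R T euclidean"
    by (rule NPC0R_diff[OF T f_NPC0R[OF x0_cont x0_mem NPC0R_const[OF T assms]] f_NPC0R[OF x0_cont x0_mem u0]])
      (auto intro!: continuous_intros)
  from NPC0R_blinfun_apply[OF T NPC0R_continuous_on[OF T Yc] this]
  show ?thesis unfolding needle_jump_def[abs_def] .
qed

end

text \<open>\<epsilon> bounds each needle length, hence N \<epsilon> the total length.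
  \<open>gapT\<close> keeps all needles before T, \<open>gap\<close> makes distinct base points
  further apart than the total length, and \<open>\<epsilon>r\<close> keeps the perturbed
  trajectories inside the Lipschitz tube.\<close>

locale needle_family = linearised_process +
  fixes N :: nat and \<tau> :: "nat \<Rightarrow> real" and z :: "nat \<Rightarrow> 'b" and M :: "'b set" and r L K \<epsilon> :: real
  assumes \<tau>: "\<And>i. i < N \<Longrightarrow> 0 \<le> \<tau> i" and zM: "\<And>i. i < N \<Longrightarrow> z i \<in> M"
    and M: "compactin U M" and uM: "\<And>t. t \<in> {0..T} \<Longrightarrow> u0 t \<in> M"
    and r: "r > 0" and L: "L > 0" and K: "K > 0" and \<epsilon>: "\<epsilon> > 0"
    and r\<Omega>: "\<And>t. t \<in> {0..T} \<Longrightarrow> cball (x0 t) r \<subseteq> \<Omega>"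
    and lip: "\<And>t \<zeta> x y. t \<in> {0..T} \<Longrightarrow> \<zeta> \<in> M \<Longrightarrow> x \<in> cball (x0 t) r \<Longrightarrow> y \<in> cball (x0 t) r \<Longrightarrow> norm (f t x \<zeta> - f t y \<zeta>) \<le> L * norm (x - y)"
    and fK: "\<And>t \<zeta>. t \<in> {0..T} \<Longrightarrow> \<zeta> \<in> M \<Longrightarrow> norm (f t (x0 t) \<zeta>) \<le> K"
    and gapT: "\<And>i. i < N \<Longrightarrow> \<tau> i + N * \<epsilon> < T"
    and gap: "\<And>i j. i < N \<Longrightarrow> j < N \<Longrightarrow> \<tau> j < \<tau> i \<Longrightarrow> \<tau> j + N * \<epsilon> < \<tau> i"
    and \<epsilon>r: "4 * K * (N * \<epsilon>) * exp (2 * L * T) \<le> r"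
begin

definition "small a \<longleftrightarrow> (\<forall>i<N. 0 \<le> a i \<and> a i \<le> \<epsilon>)"
abbreviation "tot a \<equiv> sum a {..<N}"
abbreviation "J \<equiv> needle_interval \<tau>"
abbreviation "ua a \<equiv> needle_control u0 \<tau> z N a"
text \<open>The defect of the reference trajectory under a needle control is at most 2 K times the
  total length; \<open>picard_tube\<close> contributes the further factor 2 and the
  exponential.\<close>

definition "C = 4 * K * exp (2 * L * T)"

lemma C: "C > 0" using K by (simp add: C_def)

lemma small_sum:
  assumes "small a"
  shows "i \<le> N \<Longrightarrow> 0 \<le> sum a {..<i}" and "i \<le> j \<Longrightarrow> j \<le> N \<Longrightarrow> sum a {..<i} \<le> sum a {..<j}"
    and "tot a \<le> N * \<epsilon>"
proof -
  show "i \<le> N \<Longrightarrow> 0 \<le> sum a {..<i}" using assms by (intro sum_nonneg) (auto simp: small_def)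
  show "i \<le> j \<Longrightarrow> j \<le> N \<Longrightarrow> sum a {..<i} \<le> sum a {..<j}" using assms by (intro sum_mono2) (auto simp: small_def)
  show "tot a \<le> N * \<epsilon>" using sum_bounded_above[of "{..<N}" a \<epsilon>] assms by (auto simp: small_def)
qed

lemma tot_nonneg: "small a \<Longrightarrow> 0 \<le> tot a" using small_sum(1) by auto

lemma J_sub: assumes "small a" "i < N" shows "J a i \<subseteq> {\<tau> i..<\<tau> i + tot a}" "\<tau> i + tot a < T" "J a i \<subseteq> {0..<T}"
proof -
  show 1: "J a i \<subseteq> {\<tau> i..<\<tau> i + tot a}"
    using small_sum(1)[OF assms(1), of i] small_sum(2)[OF assms(1), of "Suc i" N] assms(2)
    by (auto simp: needle_interval_def)
  show 2: "\<tau> i + tot a < T" using gapT[OF assms(2)] small_sum(3)[OF assms(1)] by linarith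
  show "J a i \<subseteq> {0..<T}" using 1 2 \<tau>[OF assms(2)] by fastforce
qed

text \<open>If the base points are in the order of the indices, the stacking separates the needles;
  otherwise the gap between the base points exceeds the total length.\<close>

lemma J_disjoint:
  assumes a: "small a" and ij: "i < j" "j < N"
  shows "J a i \<inter> J a j = {}"
proof (cases "\<tau> i \<le> \<tau> j")
  case True
  have "sum a {..<Suc i} \<le> sum a {..<j}" using small_sum(2)[OF a, of "Suc i" j] ij by auto
  then show ?thesis using True by (auto simp: needle_interval_def)
next
  case False
  then have "\<tau> j + N * \<epsilon> < \<tau> i" using gap ij by auto
  moreover have "J a j \<subseteq> {\<tau> j..<\<tau> j + tot a}" "J a i \<subseteq> {\<tau> i..<\<tau> i + tot a}" using J_sub(1)[OF a] ij by auto
  ultimately show ?thesis using small_sum(3)[OF a] by fastforce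
qed

lemma ua_in: "small a \<Longrightarrow> i < N \<Longrightarrow> s \<in> J a i \<Longrightarrow> ua a s = z i"
  using needle_control_in[OF J_disjoint] by blast

lemma ua_out: "(\<And>i. i < N \<Longrightarrow> s \<notin> J a i) \<Longrightarrow> ua a s = u0 s"
  by (rule needle_control_out)

lemma ua_M: "t \<in> {0..T} \<Longrightarrow> ua a t \<in> M"
  by (rule needle_control_mem) (use zM uM in auto)

lemma M_U: "M \<subseteq> topspace U" using M by (rule compactin_subset_topspace)

lemma ua_NPC0R: assumes "small a" shows "ua a \<in> NPC0R T U"
proof (rule needle_control_NPC0R[OF T u0])
  fix i assume i: "i < N"
  show "z i \<in> topspace U" using zM[OF i] M_U by auto
  show "0 \<le> \<tau> i + sum a {..<i}" using \<tau>[OF i] small_sum(1)[OF assms, of i] i by auto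
  show "\<tau> i + sum a {..<Suc i} < T" using J_sub(2)[OF assms i] small_sum(2)[OF assms, of "Suc i" N] i by auto
qed

lemma J_integral:
  fixes v :: "'c::banach"
  assumes "small a" "i < N"
  shows "((\<lambda>s. indicat_real (J a i) s *\<^sub>R v) has_integral a i *\<^sub>R v) {0..T}"
proof -
  have "((\<lambda>s. indicat_real (J a i) s *\<^sub>R v) has_integral ((\<tau> i + sum a {..<Suc i}) - (\<tau> i + sum a {..<i})) *\<^sub>R v) {0..T}"
    unfolding needle_interval_def
    by (rule has_integral_indicator_interval)
      (use \<tau>[OF assms(2)] small_sum(1)[OF assms(1), of i] small_sum(2)[OF assms(1), of "Suc i" N] assms J_sub(2)[OF assms]
       in \<open>auto simp: small_def\<close>)
  then show ?thesis by simp
qed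

lemma J_sum_integral:
  fixes v :: "nat \<Rightarrow> 'c::banach"
  assumes "small a"
  shows "((\<lambda>s. \<Sum>i<N. indicat_real (J a i) s *\<^sub>R v i) has_integral (\<Sum>i<N. a i *\<^sub>R v i)) {0..T}"
  by (intro has_integral_sum J_integral assms) auto

lemma J_sum:
  fixes v :: "nat \<Rightarrow> 'c::real_vector"
  assumes "small a" "i < N" "s \<in> J a i"
  shows "(\<Sum>k<N. indicat_real (J a k) s *\<^sub>R v k) = v i"
proof -
  have "s \<notin> J a k" if "k < N" "k \<noteq> i" for k
    using J_disjoint[OF assms(1), of i k] J_disjoint[OF assms(1), of k i] assms that by (cases "k < i") auto
  then have "(\<Sum>k<N. indicat_real (J a k) s *\<^sub>R v k) = (\<Sum>k<N. if k = i then v i else 0)"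
    using assms by (intro sum.cong) (auto simp: indicator_def)
  then show ?thesis using assms by simp
qed

lemma J_sum_out:
  fixes v :: "nat \<Rightarrow> 'c::real_vector"
  assumes "\<And>i. i < N \<Longrightarrow> s \<notin> J a i"
  shows "(\<Sum>k<N. indicat_real (J a k) s *\<^sub>R v k) = 0"
  using assms by (intro sum.neutral) auto

text \<open>The reference trajectory nearly solves the perturbed equation: the two right-hand sides
  along \<open>x0\<close> agree off the needles and differ by at most 2 K on them.
  \<open>picard_tube\<close> turns this defect into existence together with a bound linear in the
  total length.\<close>

lemma trajectory_exists:
  assumes a: "small a"
  shows "\<exists>x. continuous_on {0..T} x \<and> (\<forall>t\<in>{0..T}. x t = x0 0 + integral {0..t} (\<lambda>s. f s (x s) (ua a s))) \<and>
    (\<forall>t\<in>{0..T}. norm (x t - x0 t) \<le> C * tot a)"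
proof -
  have int: "(\<lambda>t. f t (x t) (ua a t)) integrable_on {0..T}"
    if "continuous_on {0..T} x" "\<And>t. t \<in> {0..T} \<Longrightarrow> x t \<in> cball (x0 t) r" for x
    by (rule NPC0R_integrable[OF T f_NPC0R[OF that(1) _ ua_NPC0R[OF a]]]) (use r\<Omega> that(2) in blast)
  have r0: "x0 t \<in> cball (x0 t) r" for t using r by simp
  have tot: "0 \<le> tot a" "tot a \<le> N * \<epsilon>" using tot_nonneg[OF a] small_sum(3)[OF a] by auto
  have app: "norm (x0 0 + integral {0..t} (\<lambda>s. f s (x0 s) (ua a s)) - x0 t) \<le> 2 * K * tot a" if t: "t \<in> {0..T}" for t
  proof -
    let ?g = "\<lambda>s. f s (x0 s) (ua a s) - f s (x0 s) (u0 s)"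
    let ?h = "\<lambda>s. \<Sum>i<N. indicat_real (J a i) s *\<^sub>R (2 * K)"
    have i1: "(\<lambda>s. f s (x0 s) (ua a s)) integrable_on {0..T}" by (rule int[OF x0_cont r0])
    have i2: "(\<lambda>s. f s (x0 s) (u0 s)) integrable_on {0..T}" by (rule NPC0R_integrable[OF T f_NPC0R[OF x0_cont x0_mem u0]])
    have sub: "g integrable_on {0..t}" if "g integrable_on {0..T}" for g :: "real \<Rightarrow> 'c::banach"
      using integrable_subinterval_real[OF that, of 0 t] t by auto
    have h: "(?h has_integral (\<Sum>i<N. a i *\<^sub>R (2 * K))) {0..T}" by (rule J_sum_integral[OF a])
    have hint: "?h integrable_on {0..T}" using h by blast
    have "x0 0 + integral {0..t} (\<lambda>s. f s (x0 s) (ua a s)) - x0 t = integral {0..t} ?g"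
      using sub[OF i1] sub[OF i2] x0_integral[OF t] by (simp add: integral_diff)
    also have "norm \<dots> \<le> integral {0..t} ?h"
    proof (rule integral_norm_bound_integral)
      show "?g integrable_on {0..t}" by (intro integrable_diff sub i1 i2)
      show "?h integrable_on {0..t}" by (rule integrable_subinterval_real[OF hint]) (use t in auto)
      fix s assume "s \<in> {0..t}"
      then have s: "s \<in> {0..T}" using t by auto
      show "norm (?g s) \<le> ?h s"
      proof (cases "\<exists>i<N. s \<in> J a i")
        case True
        then obtain i where i: "i < N" "s \<in> J a i" by blast
        have "norm (?g s) \<le> K + K"
          by (rule order_trans[OF norm_triangle_ineq4]) (intro add_mono fK s ua_M uM)
        then show ?thesis unfolding J_sum[OF a i] by simp
      next
        case False
        then show ?thesis using ua_out[of s a] J_sum_out[of s a] by auto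
      qed
    qed
    also have "\<dots> \<le> integral {0..T} ?h"
      using t K hint by (intro integral_subset_le integrable_subinterval_real[OF hint]) (auto intro!: sum_nonneg)
    also have "\<dots> = 2 * K * tot a"
      unfolding integral_unique[OF h] by (simp add: sum_distrib_left mult.commute mult.left_commute)
    finally show ?thesis .
  qed
  have rr: "2 * (2 * K * tot a) * exp (2 * L * T) \<le> r"
  proof -
    have "2 * (2 * K * tot a) * exp (2 * L * T) \<le> 4 * K * (N * \<epsilon>) * exp (2 * L * T)"
      using tot K by (intro mult_right_mono) auto
    then show ?thesis using \<epsilon>r by linarith
  qed
  have "0 \<le> 2 * K * tot a" using tot K by simp
  from picard_tube[OF T L this x0_cont lip[OF _ ua_M] int app rr]
  obtain x where x: "continuous_on {0..T} x" "\<And>t. t \<in> {0..T} \<Longrightarrow> x t = x0 0 + integral {0..t} (\<lambda>s. f s (x s) (ua a s))"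
    and xb: "\<And>t. t \<in> {0..T} \<Longrightarrow> norm (x t - x0 t) \<le> 2 * (2 * K * tot a) * exp (2 * L * t)" by blast
  have "norm (x t - x0 t) \<le> C * tot a" if t: "t \<in> {0..T}" for t
  proof -
    have "norm (x t - x0 t) \<le> 2 * (2 * K * tot a) * exp (2 * L * t)" by (rule xb[OF t])
    also have "\<dots> \<le> 2 * (2 * K * tot a) * exp (2 * L * T)" using t tot K L by (intro mult_left_mono) auto
    finally show ?thesis by (simp add: C_def mult_ac)
  qed
  with x show ?thesis by blast
qed

definition traj :: "(nat \<Rightarrow> real) \<Rightarrow> real \<Rightarrow> 'a" where
  "traj a = (SOME x. continuous_on {0..T} x \<and> (\<forall>t\<in>{0..T}. x t = x0 0 + integral {0..t} (\<lambda>s. f s (x s) (ua a s))) \<and>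
    (\<forall>t\<in>{0..T}. norm (x t - x0 t) \<le> C * tot a))"

lemma traj:
  assumes "small a"
  shows traj_cont: "continuous_on {0..T} (traj a)"
    and traj_eq: "t \<in> {0..T} \<Longrightarrow> traj a t = x0 0 + integral {0..t} (\<lambda>s. f s (traj a s) (ua a s))"
    and traj_bound: "t \<in> {0..T} \<Longrightarrow> norm (traj a t - x0 t) \<le> C * tot a"
  using someI_ex[OF trajectory_exists[OF assms]] unfolding traj_def[symmetric] by blast+

lemma traj_tube:
  assumes "small a" "t \<in> {0..T}" shows "traj a t \<in> cball (x0 t) r" "traj a t \<in> \<Omega>"
proof -
  have "C * tot a \<le> C * (N * \<epsilon>)" using C small_sum(3)[OF assms(1)] by (intro mult_left_mono) auto
  also have "\<dots> \<le> r" using \<epsilon>r by (simp add: C_def mult_ac)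
  finally show 1: "traj a t \<in> cball (x0 t) r" using traj_bound[OF assms] by (simp add: dist_norm norm_minus_commute)
  then show "traj a t \<in> \<Omega>" using r\<Omega> assms by blast
qed

lemma traj_NPC0R: "small a \<Longrightarrow> u \<in> NPC0R T U \<Longrightarrow> (\<lambda>s. f s (traj a s) (u s)) \<in> NPC0R T euclidean"
  by (rule f_NPC0R[OF traj_cont traj_tube(2)])

lemma traj_reachable: "small a \<Longrightarrow> traj a T \<in> reachable"
  unfolding reachable_def trajectory_def using traj_cont traj_tube(2) ua_NPC0R traj_eq by blast


section \<open>Continuous dependence on the needle lengths\<close>

lemma integral_le_total:
  fixes \<phi> :: "real \<Rightarrow> real"
  assumes "\<phi> integrable_on {0..T}" "\<And>s. s \<in> {0..T} \<Longrightarrow> 0 \<le> \<phi> s" "t \<in> {0..T}"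
  shows "integral {0..t} \<phi> \<le> integral {0..T} \<phi>"
  using assms by (intro integral_subset_le integrable_subinterval_real[OF assms(1)]) auto

text \<open>The defect compares the two controls along one fixed trajectory. When b is held fixed
  and a varies, its convergence is therefore a question about the controls alone.\<close>

lemma traj_control_difference:
  assumes a: "small a" and b: "small b" and t: "t \<in> {0..T}"
  defines "\<delta> \<equiv> integral {0..T} (\<lambda>s. norm (f s (traj b s) (ua a s) - f s (traj b s) (ua b s)))"
  shows "norm (traj a t - traj b t) \<le> 2 * \<delta> * exp (2 * L * t)"
proof (rule gronwall_weighted[OF _ L _ _ t])
  let ?d = "\<lambda>s. f s (traj b s) (ua a s) - f s (traj b s) (ua b s)"
  have dreg: "?d \<in> NPC0R T euclidean"
    by (rule NPC0R_diff[OF T traj_NPC0R[OF b ua_NPC0R[OF a]] traj_NPC0R[OF b ua_NPC0R[OF b]]]) (auto intro!: continuous_intros)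
  have nint: "(\<lambda>s. norm (?d s)) integrable_on {0..T}" by (rule NPC0R_integrable[OF T NPC0R_norm[OF T dreg]])
  have zc: "continuous_on {0..T} (\<lambda>s. norm (traj a s - traj b s))"
    by (intro continuous_intros traj_cont a b)
  then show "continuous_on {0..T} (\<lambda>s. norm (traj a s - traj b s))" .
  show "0 \<le> \<delta>" unfolding \<delta>_def by (intro integral_nonneg nint) auto
  fix t assume t: "t \<in> {0..T}"
  let ?ga = "\<lambda>s. f s (traj a s) (ua a s)" and ?gb = "\<lambda>s. f s (traj b s) (ua b s)"
  have ia: "?ga integrable_on {0..t}" and ib: "?gb integrable_on {0..t}"
    using integrable_subinterval_real[OF NPC0R_integrable[OF T traj_NPC0R[OF a ua_NPC0R[OF a]]], of 0 t]
      integrable_subinterval_real[OF NPC0R_integrable[OF T traj_NPC0R[OF b ua_NPC0R[OF b]]], of 0 t] t by auto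
  have lip_tube: "traj a s \<in> cball (x0 s) r" "traj b s \<in> cball (x0 s) r" if "s \<in> {0..T}" for s
    using traj_tube(1)[OF a that] traj_tube(1)[OF b that] .
  have zi: "(\<lambda>s. L * norm (traj a s - traj b s)) integrable_on {0..t}"
    using t by (intro integrable_continuous_real continuous_intros continuous_on_subset[OF traj_cont] a b) auto
  have ni: "(\<lambda>s. norm (?d s)) integrable_on {0..t}" by (rule integrable_subinterval_real[OF nint]) (use t in auto)
  have eq: "traj a t - traj b t = integral {0..t} (\<lambda>s. ?ga s - ?gb s)"
    using traj_eq[OF a t] traj_eq[OF b t] ia ib by (simp add: integral_diff)
  have "norm (traj a t - traj b t) \<le> integral {0..t} (\<lambda>s. L * norm (traj a s - traj b s) + norm (?d s))"
    unfolding eq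
  proof (rule integral_norm_bound_integral)
    fix s assume "s \<in> {0..t}"
    then have s: "s \<in> {0..T}" using t by auto
    \<comment> \<open>The first difference has one control and two states, so the Lipschitz bound
      applies; the second has one state and two controls, and enters \<delta>.\<close>
    have eq: "?ga s - ?gb s = (?ga s - f s (traj b s) (ua a s)) + ?d s" by simp
    show "norm (?ga s - ?gb s) \<le> L * norm (traj a s - traj b s) + norm (?d s)"
      by (subst eq) (intro norm_triangle_mono lip s ua_M lip_tube a b order_refl)
  qed (intro integrable_diff integrable_add ia ib zi ni)+
  also have "\<dots> = L * integral {0..t} (\<lambda>s. norm (traj a s - traj b s)) + integral {0..t} (\<lambda>s. norm (?d s))"
    using integral_add[OF zi ni] by simp
  also have "\<dots> \<le> L * integral {0..t} (\<lambda>s. norm (traj a s - traj b s)) + \<delta>"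
    unfolding \<delta>_def using integral_le_total[OF nint _ t] by auto
  finally show "norm (traj a t - traj b t) \<le> \<delta> + L * integral {0..t} (\<lambda>s. norm (traj a s - traj b s))" by simp
qed

text \<open>Away from the end points of the limiting needles, membership is decided by strict
  inequalities, and these persist under small changes of the lengths.\<close>

lemma needle_control_eventually_eq:
  assumes "\<And>i. i < N \<Longrightarrow> (\<lambda>j::nat. av j i) \<longlonglongrightarrow> a i"
    and "\<And>i. i < N \<Longrightarrow> s \<noteq> \<tau> i + sum a {..<i}" "\<And>i. i < N \<Longrightarrow> s \<noteq> \<tau> i + sum a {..<Suc i}"
  shows "\<forall>\<^sub>F j in sequentially. ua (av j) s = ua a s"
proof -
  have lim: "(\<lambda>j. \<tau> i + sum (av j) {..<k}) \<longlonglongrightarrow> \<tau> i + sum a {..<k}" if "k \<le> N" for i k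
    by (intro tendsto_intros assms(1)) (use that in auto)
  have side: "\<forall>\<^sub>F j in sequentially. (s < \<tau> i + sum (av j) {..<k}) = (s < \<tau> i + sum a {..<k})"
    if "s \<noteq> \<tau> i + sum a {..<k}" "k \<le> N" for i k
  proof (cases "s < \<tau> i + sum a {..<k}")
    case True
    from order_tendstoD(1)[OF lim[OF that(2)] True] show ?thesis by eventually_elim (use True in auto)
  next
    case False
    then have "\<tau> i + sum a {..<k} < s" using that by auto
    from order_tendstoD(2)[OF lim[OF that(2)] this] show ?thesis by eventually_elim (use False in auto)
  qed
  have "\<forall>\<^sub>F j in sequentially. \<forall>i\<in>{..<N}. s \<in> J (av j) i \<longleftrightarrow> s \<in> J a i"
  proof (intro eventually_ball_finite ballI)
    fix i assume "i \<in> {..<N}"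
    then have i: "i < N" by simp
    show "\<forall>\<^sub>F j in sequentially. s \<in> J (av j) i \<longleftrightarrow> s \<in> J a i"
      using side[OF assms(2)[OF i]] side[OF assms(3)[OF i]] i
      unfolding needle_interval_def atLeastLessThan_iff not_less[symmetric]
      by (auto elim: eventually_elim2)
  qed simp
  then show ?thesis by eventually_elim (auto intro: needle_control_cong)
qed

text \<open>At all but finitely many times the controls eventually coincide, and the integrands are
  uniformly bounded. Dominated convergence sends the defect in
  \<open>traj_control_difference\<close> to 0. It is applied to norms, which are real-valued, since
  E is an arbitrary Banach space.\<close>

lemma traj_continuous:
  assumes av: "\<And>j. small (av j)" and a: "small a" and lim: "\<And>i. i < N \<Longrightarrow> (\<lambda>j::nat. av j i) \<longlonglongrightarrow> a i"
  shows "(\<lambda>j. traj (av j) T) \<longlonglongrightarrow> traj a T"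
proof -
  let ?d = "\<lambda>j s. norm (f s (traj a s) (ua (av j) s) - f s (traj a s) (ua a s))"
  define E where "E = (\<lambda>i. \<tau> i + sum a {..<i}) ` {..<N} \<union> (\<lambda>i. \<tau> i + sum a {..<Suc i}) ` {..<N}"
  have E: "finite E" by (simp add: E_def)
  obtain K' where K': "K' > 0" "\<And>t \<zeta>. t \<in> {0..T} \<Longrightarrow> \<zeta> \<in> M \<Longrightarrow> norm (f t (traj a t) \<zeta>) \<le> K'"
    using f_path_bounded[OF traj_cont[OF a] traj_tube(2)[OF a] M] by blast
  have dreg: "?d j \<in> NPC0R T euclidean" for j
    by (rule NPC0R_norm[OF T NPC0R_diff[OF T traj_NPC0R[OF a ua_NPC0R[OF av]] traj_NPC0R[OF a ua_NPC0R[OF a]]]])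
      (auto intro!: continuous_intros)
  \<comment> \<open>Erasing the integrand at the end points makes the convergence hold everywhere
    without changing the integrals.\<close>
  define e where "e j s = (if s \<in> E then 0 else ?d j s)" for j s
  have eint: "e j integrable_on {0..T}" for j
    by (rule integrable_spike_finite[OF E _ NPC0R_integrable[OF T dreg[of j]]]) (simp add: e_def)
  have "(\<lambda>j. integral {0..T} (e j)) \<longlonglongrightarrow> integral {0..T} (\<lambda>_. 0 :: real)"
  proof (rule dominated_convergence(2)[where h = "\<lambda>_. 2 * K'"])
    fix j s assume s: "s \<in> {0..T}"
    have "?d j s \<le> K' + K'" by (rule order_trans[OF norm_triangle_ineq4]) (intro add_mono K' s ua_M)
    then show "norm (e j s) \<le> 2 * K'" using K' by (auto simp: e_def)
  next
    fix s assume s: "s \<in> {0..T}"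
    show "(\<lambda>j. e j s) \<longlonglongrightarrow> 0"
    proof (cases "s \<in> E")
      case False
      have "\<forall>\<^sub>F j in sequentially. ua (av j) s = ua a s"
        by (rule needle_control_eventually_eq[OF lim]) (use False in \<open>auto simp: E_def\<close>)
      then have "\<forall>\<^sub>F j in sequentially. e j s = 0" by eventually_elim (simp add: e_def)
      then show ?thesis by (rule tendsto_eventually)
    qed (simp add: e_def)
  qed (use eint in auto)
  moreover have "integral {0..T} (e j) = integral {0..T} (?d j)" for j
    by (rule integral_spike[of E]) (use E in \<open>auto simp: e_def\<close>)
  ultimately have lim0: "(\<lambda>j. 2 * integral {0..T} (?d j) * exp (2 * L * T)) \<longlonglongrightarrow> 2 * 0 * exp (2 * L * T)"
    by (intro tendsto_intros) simp
  have "(\<lambda>j. traj (av j) T - traj a T) \<longlonglongrightarrow> 0"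
    by (rule Lim_null_comparison[of _ "\<lambda>j. 2 * integral {0..T} (?d j) * exp (2 * L * T)"])
      (use lim0 traj_control_difference[OF av a, of T] T in auto)
  then show ?thesis by (simp add: Lim_null[symmetric])
qed

section \<open>First-order expansion of the endpoint\<close>

definition remainder :: "(nat \<Rightarrow> real) \<Rightarrow> real \<Rightarrow> 'a" where
  "remainder a s = f s (traj a s) (u0 s) - f s (x0 s) (u0 s) - A s (u0 s) (traj a s - x0 s)"

lemma remainder_NPC0R:
  assumes a: "small a" shows "remainder a \<in> NPC0R T euclidean"
proof -
  have 1: "(\<lambda>s. f s (traj a s) (u0 s) - f s (x0 s) (u0 s)) \<in> NPC0R T euclidean"
    by (rule NPC0R_diff[OF T traj_NPC0R[OF a u0] f_NPC0R[OF x0_cont x0_mem u0]]) (auto intro!: continuous_intros)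
  have "(\<lambda>s. traj a s - x0 s) \<in> NPC0R T euclidean"
    by (intro NPC0R_continuous_on T continuous_intros traj_cont a x0_cont)
  from NPC0R_blinfun_apply[OF T A0_NPC0R this]
  have 2: "(\<lambda>s. A s (u0 s) (traj a s - x0 s)) \<in> NPC0R T euclidean" .
  show ?thesis
    unfolding remainder_def[abs_def] by (rule NPC0R_diff[OF T 1 2]) (auto intro!: continuous_intros)
qed

text \<open>The product Y (traj a - x0) has derivative Y \<rho>, because Y' = -Y A cancels the
  linear part. Off the needles \<rho> is the Taylor remainder under the reference control. On a
  needle it contains in addition the jump, replaced by its value at the base point at cost \<theta>,
  and a mixed difference of order \<open>tot a\<close>; after integration over the needles the
  latter is of second order.\<close>

lemma expansion_bound:
  assumes a: "small a" and Y: "\<And>s. s \<in> {0..T} \<Longrightarrow> norm (Y s) \<le> KY"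
    and \<theta>: "\<And>i s. i < N \<Longrightarrow> s \<in> J a i \<Longrightarrow> norm (needle_jump (z i) s - needle_jump (z i) (\<tau> i)) \<le> \<theta>"
  shows "norm (Y T (traj a T - x0 T) - (\<Sum>i<N. a i *\<^sub>R needle_jump (z i) (\<tau> i)))
    \<le> KY * integral {0..T} (\<lambda>s. norm (remainder a s)) + tot a * (KY * (2 * L * C * tot a) + \<theta>)"
proof -
  define \<rho> where "\<rho> s = f s (traj a s) (ua a s) - f s (x0 s) (u0 s) - A s (u0 s) (traj a s - x0 s)" for s
  define W where "W s = Y s (traj a s - x0 s)" for s
  have traj0: "traj a 0 = x0 0" using traj_eq[OF a, of 0] T by simp
  have eq: "traj a t = traj a 0 + integral {0..t} (\<lambda>s. f s (traj a s) (ua a s))" if "t \<in> {0..T}" for t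
    unfolding traj0 by (rule traj_eq[OF a that])
  obtain F1 where F1: "finite F1" "\<And>t. t \<in> {0..T} - F1 \<Longrightarrow> (traj a has_vector_derivative f t (traj a t) (ua a t)) (at t)"
  proof (rule integral_NPC0R_derivative[OF T traj_NPC0R[OF a ua_NPC0R[OF a]], of "traj a"])
    fix t assume "t \<in> {0..T}" then show "traj a t = traj a 0 + integral {0..t} (\<lambda>s. f s (traj a s) (ua a s))" by (rule eq)
  next
    fix F1 assume "finite F1" "\<And>t. t \<in> {0..T} - F1 \<Longrightarrow> (traj a has_vector_derivative f t (traj a t) (ua a t)) (at t)"
    then show thesis by (rule that)
  qed
  obtain F2 where F2: "finite F2" "\<And>t. t \<in> {0..T} - F2 \<Longrightarrow> (x0 has_vector_derivative ext_deriv T x0 t) (at t)"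
    using PC1_derivative[OF T x0] by blast
  have Wc: "continuous_on {0..T} W"
    unfolding W_def by (intro continuous_intros Yc traj_cont a x0_cont)
  have h1: "((\<lambda>s. Y s (\<rho> s)) has_integral W T - W 0) {0..T}"
  proof (rule fundamental_theorem_of_calculus_interior_strong[of "F \<union> F1 \<union> F2"])
    fix s assume "s \<in> {0<..<T} - (F \<union> F1 \<union> F2)"
    then have s: "s \<in> {0..T}" "s \<in> {0..T} - F" "s \<in> {0..T} - F1" "s \<in> {0..T} - F2" by auto
    have "((\<lambda>s. traj a s - x0 s) has_vector_derivative (f s (traj a s) (ua a s) - f s (x0 s) (u0 s))) (at s)"
      using has_vector_derivative_diff[OF F1(2)[OF s(3)] F2(2)[OF s(4)]] x0_deriv[OF s(1)] by simp
    from bounded_bilinear.has_vector_derivative[OF bounded_bilinear_blinfun_apply dY[OF s(2)] this]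
    show "(W has_vector_derivative Y s (\<rho> s)) (at s)"
      unfolding W_def[abs_def] \<rho>_def by (simp add: blinfun.diff_right blinfun.add_right blinfun.minus_left blinfun.diff_left algebra_simps)
  qed (use F F1 F2 T Wc in auto)
  have W0: "W 0 = 0" by (simp add: W_def traj0)
  let ?S = "\<lambda>s. \<Sum>i<N. indicat_real (J a i) s *\<^sub>R needle_jump (z i) (\<tau> i)"
  let ?B = "KY * (2 * L * C * tot a) + \<theta>"
  have h2: "((\<lambda>s. Y s (\<rho> s) - ?S s) has_integral W T - (\<Sum>i<N. a i *\<^sub>R needle_jump (z i) (\<tau> i))) {0..T}"
    using has_integral_diff[OF h1 J_sum_integral[OF a]] W0 by simp
  have rint: "(\<lambda>s. norm (remainder a s)) integrable_on {0..T}"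
    by (rule NPC0R_integrable[OF T NPC0R_norm[OF T remainder_NPC0R[OF a]]])
  have h3: "((\<lambda>s. KY * norm (remainder a s) + (\<Sum>i<N. indicat_real (J a i) s *\<^sub>R ?B)) has_integral
     KY * integral {0..T} (\<lambda>s. norm (remainder a s)) + (\<Sum>i<N. a i *\<^sub>R ?B)) {0..T}"
    by (intro has_integral_add has_integral_mult_right J_sum_integral a integrable_integral rint)
  have "norm (W T - (\<Sum>i<N. a i *\<^sub>R needle_jump (z i) (\<tau> i))) \<le>
     KY * integral {0..T} (\<lambda>s. norm (remainder a s)) + (\<Sum>i<N. a i *\<^sub>R ?B)"
  proof (rule has_integral_norm_bound[OF h2 h3])
    fix s assume s: "s \<in> {0..T}"
    have Yn: "norm (Y s v) \<le> KY * norm v" for v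
      using norm_blinfun[of "Y s" v] mult_right_mono[OF Y[OF s] norm_ge_zero[of v]] by linarith
    show "norm (Y s (\<rho> s) - ?S s) \<le> KY * norm (remainder a s) + (\<Sum>i<N. indicat_real (J a i) s *\<^sub>R ?B)"
    proof (cases "\<exists>i<N. s \<in> J a i")
      case True
      then obtain i where i: "i < N" "s \<in> J a i" by blast
      have zi: "z i \<in> M" by (rule zM[OF i(1)])
      \<comment> \<open>Mixed difference in state and control. Each of its two brackets compares
        nearby states under one control, so no differentiability in the control is involved.\<close>
      define \<sigma> where "\<sigma> = (f s (traj a s) (z i) - f s (x0 s) (z i)) - (f s (traj a s) (u0 s) - f s (x0 s) (u0 s))"
      have x0t: "x0 s \<in> cball (x0 s) r" using r by simp
      have lb: "norm (f s (traj a s) \<zeta> - f s (x0 s) \<zeta>) \<le> L * (C * tot a)" if "\<zeta> \<in> M" for \<zeta>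
        using lip[OF s that traj_tube(1)[OF a s] x0t] mult_left_mono[OF traj_bound[OF a s], of L] L by linarith
      have "norm \<sigma> \<le> L * (C * tot a) + L * (C * tot a)"
        unfolding \<sigma>_def by (rule order_trans[OF norm_triangle_ineq4]) (intro add_mono lb zi uM s)
      then have \<sigma>: "norm \<sigma> \<le> 2 * L * C * tot a" by (simp add: mult_ac)
      have eq: "Y s (\<rho> s) - ?S s = Y s (remainder a s) + (Y s \<sigma> + (needle_jump (z i) s - needle_jump (z i) (\<tau> i)))"
        unfolding J_sum[OF a i] \<rho>_def remainder_def \<sigma>_def needle_jump_def ua_in[OF a i]
        by (simp add: blinfun.diff_right blinfun.add_right)
      have "norm (Y s (\<rho> s) - ?S s) \<le> KY * norm (remainder a s) + (KY * (2 * L * C * tot a) + \<theta>)"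
        unfolding eq
      proof (intro norm_triangle_mono Yn \<theta> i)
        have "0 \<le> KY" using Y[OF s] norm_ge_zero order_trans by blast
        then show "norm (Y s \<sigma>) \<le> KY * (2 * L * C * tot a)" using Yn[of \<sigma>] \<sigma> mult_left_mono by (meson order_trans)
      qed
      then show ?thesis unfolding J_sum[OF a i] .
    next
      case False
      then have 1: "ua a s = u0 s" and 2: "?S s = 0" and 3: "(\<Sum>i<N. indicat_real (J a i) s *\<^sub>R ?B) = 0"
        using ua_out[of s a] J_sum_out[of s a] by auto
      have "\<rho> s = remainder a s" by (simp add: \<rho>_def remainder_def 1)
      then show ?thesis unfolding 2 3 using Yn[of "remainder a s"] by simp
    qed
  qed
  then show ?thesis by (simp add: W_def sum_distrib_right)
qed


text \<open>This crude bound, linear in the total length, is the domination for the limit below; the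
  smallness comes from pointwise differentiability.\<close>

lemma remainder_bound:
  assumes a: "small a" and s: "s \<in> {0..T}" and KA: "norm (A s (u0 s)) \<le> KA"
  shows "norm (remainder a s) \<le> (L + KA) * (C * tot a)"
proof -
  have "norm (remainder a s) \<le> L * norm (traj a s - x0 s) + KA * norm (traj a s - x0 s)"
    unfolding remainder_def
  proof (rule order_trans[OF norm_triangle_ineq4], rule add_mono)
    show "norm (f s (traj a s) (u0 s) - f s (x0 s) (u0 s)) \<le> L * norm (traj a s - x0 s)"
      by (rule lip[OF s uM[OF s] traj_tube(1)[OF a s]]) (use r in simp)
    show "norm (A s (u0 s) (traj a s - x0 s)) \<le> KA * norm (traj a s - x0 s)"
      by (rule order_trans[OF norm_blinfun mult_right_mono[OF KA norm_ge_zero]])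
  qed
  also have "\<dots> = (L + KA) * norm (traj a s - x0 s)" by (simp add: algebra_simps)
  also have "\<dots> \<le> (L + KA) * (C * tot a)"
    using L norm_ge_zero[of "A s (u0 s)"] KA by (intro mult_left_mono traj_bound[OF a s]) linarith
  finally show ?thesis .
qed

text \<open>At a fixed time the displacement is O(s_j), so Frechet differentiability at
  \<open>x0 t\<close> makes the quotient tend to 0. The speed may depend on t; domination makes up
  for that.\<close>

lemma remainder_integral_limit:
  assumes s: "\<And>j::nat. s j > 0" and s0: "s \<longlonglongrightarrow> 0" and B: "\<And>i. i < N \<Longrightarrow> (\<lambda>j. B j i) \<longlonglongrightarrow> b i"
    and sm: "\<And>j. small (\<lambda>i. s j * B j i)"
  shows "(\<lambda>j. integral {0..T} (\<lambda>t. norm (remainder (\<lambda>i. s j * B j i) t)) / s j) \<longlonglongrightarrow> 0"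
proof -
  let ?a = "\<lambda>j i. s j * B j i"
  have tot: "tot (?a j) = s j * tot (B j)" for j by (simp add: sum_distrib_left)
  have Btot: "(\<lambda>j. tot (B j)) \<longlonglongrightarrow> tot b" by (intro tendsto_sum B) auto
  then obtain Bb where Bb: "Bb > 0" "\<And>j. norm (tot (B j)) \<le> Bb"
    using convergent_imp_Bseq[of "\<lambda>j. tot (B j)"] unfolding Bseq_def convergent_def by blast
  have tot_le: "tot (?a j) \<le> s j * Bb" for j
    unfolding tot using Bb(2)[of j] s[of j] by (intro mult_left_mono) auto
  obtain KA where KA: "KA > 0" "\<And>t. t \<in> {0..T} \<Longrightarrow> norm (A t (u0 t)) \<le> KA" using NPC0R_bounded[OF T A0_NPC0R] by blast
  have "(\<lambda>j. integral {0..T} (\<lambda>t. norm (remainder (?a j) t) / s j)) \<longlonglongrightarrow> integral {0..T} (\<lambda>_. 0 :: real)"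
  proof (rule dominated_convergence(2)[where h = "\<lambda>_. (L + KA) * (C * Bb)"])
    show "(\<lambda>t. norm (remainder (?a j) t) / s j) integrable_on {0..T}" for j
      using NPC0R_integrable[OF T NPC0R_norm[OF T remainder_NPC0R[OF sm]]] by (intro integrable_on_divide) auto
    show "(\<lambda>_. (L + KA) * (C * Bb)) integrable_on {0..T}" by (rule integrable_const_ivl)
    fix j t assume t: "t \<in> {0..T}"
    have "norm (remainder (?a j) t) \<le> (L + KA) * (C * tot (?a j))" by (rule remainder_bound[OF sm t KA(2)[OF t]])
    also have "\<dots> \<le> (L + KA) * (C * (s j * Bb))"
      using L KA C tot_le by (intro mult_left_mono) auto
    finally show "norm (norm (remainder (?a j) t) / s j) \<le> (L + KA) * (C * Bb)"
      using s[of j] by (simp add: field_simps)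
  next
    fix t assume t: "t \<in> {0..T}"
    show "(\<lambda>j. norm (remainder (?a j) t) / s j) \<longlonglongrightarrow> 0"
    proof (rule tendstoI)
      fix e :: real assume e: "e > 0"
      \<comment> \<open>Chosen so that e' times the displacement bound \<open>C * (s j * Bb)\<close>
        equals half of e times \<open>s j\<close>.\<close>
      define e' where "e' = e / (2 * (C * Bb))"
      have e': "e' > 0" using e C Bb by (simp add: e'_def)
      obtain d where d: "d > 0" "\<And>y. norm (y - x0 t) < d \<Longrightarrow>
          norm (f t y (u0 t) - f t (x0 t) (u0 t) - A t (u0 t) (y - x0 t)) \<le> e' * norm (y - x0 t)"
        using fderiv[OF t u0_mem[OF t]] e' unfolding has_derivative_at_alt by metis
      have "(\<lambda>j. C * (s j * Bb)) \<longlonglongrightarrow> C * (0 * Bb)" by (intro tendsto_intros s0)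
      then have "\<forall>\<^sub>F j in sequentially. C * (s j * Bb) < d" using d(1) by (intro order_tendstoD(2)) auto
      then show "\<forall>\<^sub>F j in sequentially. dist (norm (remainder (?a j) t) / s j) 0 < e"
      proof eventually_elim
        fix j assume j: "C * (s j * Bb) < d"
        have zb: "norm (traj (?a j) t - x0 t) \<le> C * (s j * Bb)"
          by (rule order_trans[OF traj_bound[OF sm t] mult_left_mono[OF tot_le]]) (use C in simp)
        then have "norm (remainder (?a j) t) \<le> e' * norm (traj (?a j) t - x0 t)"
          unfolding remainder_def using d(2) j by auto
        also have "\<dots> \<le> e' * (C * (s j * Bb))" using zb e' by (intro mult_left_mono) auto
        also have "\<dots> = s j * (e / 2)" using C Bb by (simp add: e'_def)
        finally have "norm (remainder (?a j) t) / s j \<le> e / 2" using s[of j] by (simp add: field_simps)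
        moreover have "0 \<le> norm (remainder (?a j) t) / s j" using s[of j] by (intro divide_nonneg_pos) auto
        ultimately show "dist (norm (remainder (?a j) t) / s j) 0 < e"
          using e by (simp only: dist_norm real_norm_def diff_0_right abs_of_nonneg)
      qed
    qed
  qed
  then show ?thesis by simp
qed

text \<open>Every needle lies to the right of its base point, within the total length, so
  right-continuity of the jump suffices.\<close>

lemma needle_interval_shrinks:
  assumes i: "i < N" and \<zeta>: "\<zeta> \<in> topspace U" and \<theta>: "\<theta> > 0" and a: "\<And>j. small (a j)" "(\<lambda>j. tot (a j)) \<longlonglongrightarrow> 0"
  shows "\<forall>\<^sub>F j in sequentially. \<forall>s\<in>J (a j) i. norm (needle_jump \<zeta> s - needle_jump \<zeta> (\<tau> i)) \<le> \<theta>"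
proof -
  have "0 \<le> N * \<epsilon>" using \<epsilon> by simp
  then have \<tau>i: "\<tau> i \<in> {0..<T}" using \<tau>[OF i] gapT[OF i] by auto
  then have "(needle_jump \<zeta> \<longlongrightarrow> needle_jump \<zeta> (\<tau> i)) (at_right (\<tau> i))"
    using needle_jump_NPC0R[OF \<zeta>] by (auto simp: NPC0R_iff[OF T])
  then have "\<forall>\<^sub>F s in at_right (\<tau> i). dist (needle_jump \<zeta> s) (needle_jump \<zeta> (\<tau> i)) < \<theta>"
    using \<theta> by (rule tendstoD)
  then obtain d where d: "d > \<tau> i" "\<And>s. \<tau> i < s \<Longrightarrow> s < d \<Longrightarrow> dist (needle_jump \<zeta> s) (needle_jump \<zeta> (\<tau> i)) < \<theta>"
    unfolding eventually_at_right_field by blast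
  have "\<forall>\<^sub>F j in sequentially. tot (a j) < d - \<tau> i" using a(2) d(1) by (intro order_tendstoD(2)) auto
  then show ?thesis
  proof eventually_elim
    fix j assume j: "tot (a j) < d - \<tau> i"
    show "\<forall>s\<in>J (a j) i. norm (needle_jump \<zeta> s - needle_jump \<zeta> (\<tau> i)) \<le> \<theta>"
    proof
      fix s assume "s \<in> J (a j) i"
      then have "\<tau> i \<le> s" "s < d" using J_sub(1)[OF a(1) i, of j] j by auto
      then show "norm (needle_jump \<zeta> s - needle_jump \<zeta> (\<tau> i)) \<le> \<theta>"
        using d(2)[of s] \<theta> by (cases "s = \<tau> i") (auto simp: dist_norm less_imp_le)
    qed
  qed
qed

text \<open>The directions \<open>B j\<close> may vary with j, as the Hadamard quotients of the
  terminal functions and the later compactness argument require. The expansion is established for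
  the pulled-back endpoint and then pushed forward by \<open>X T\<close>.\<close>

lemma traj_directional_derivative:
  assumes s: "\<And>j::nat. s j > 0" and s0: "s \<longlonglongrightarrow> 0" and B: "\<And>i. i < N \<Longrightarrow> (\<lambda>j. B j i) \<longlonglongrightarrow> b i"
    and sm: "\<And>j. small (\<lambda>i. s j * B j i)"
  shows "(\<lambda>j. (traj (\<lambda>i. s j * B j i) T - x0 T) /\<^sub>R s j) \<longlonglongrightarrow> (\<Sum>i<N. b i *\<^sub>R X T (needle_jump (z i) (\<tau> i)))"
proof -
  let ?a = "\<lambda>j i. s j * B j i"
  let ?v = "\<lambda>i. needle_jump (z i) (\<tau> i)"
  let ?y = "\<lambda>j. Y T ((traj (?a j) T - x0 T) /\<^sub>R s j)"
  let ?\<rho> = "\<lambda>j. integral {0..T} (\<lambda>t. norm (remainder (?a j) t)) / s j"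
  have tot: "tot (?a j) = s j * tot (B j)" for j by (simp add: sum_distrib_left)
  have Btot: "(\<lambda>j. tot (B j)) \<longlonglongrightarrow> tot b" by (intro tendsto_sum B) auto
  have atot: "(\<lambda>j. tot (?a j)) \<longlonglongrightarrow> 0" unfolding tot using tendsto_mult[OF s0 Btot] by simp
  have Bnn: "0 \<le> tot (B j)" for j using tot_nonneg[OF sm[of j]] s[of j] unfolding tot by (simp add: zero_le_mult_iff)
  have btot: "0 \<le> tot b" by (rule LIMSEQ_le_const[OF Btot]) (use Bnn in auto)
  obtain KY where KY: "\<And>t. t \<in> {0..T} \<Longrightarrow> norm (Y t) \<le> KY"
    using NPC0R_bounded[OF T NPC0R_continuous_on[OF T Yc]] by blast
  have zU: "z i \<in> topspace U" if "i < N" for i using zM[OF that] M_U by auto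
  have \<rho>0: "?\<rho> \<longlonglongrightarrow> 0" by (rule remainder_integral_limit[where b = b, OF s s0 B sm])
  have "(\<lambda>j. ?y j - (\<Sum>i<N. B j i *\<^sub>R ?v i)) \<longlonglongrightarrow> 0"
  proof (rule tendstoI)
    fix e :: real assume e: "e > 0"
    \<comment> \<open>Makes \<open>tot b\<close> times \<theta> at most e/2; the added 1 covers the
      case \<open>tot b = 0\<close>.\<close>
    define \<theta> where "\<theta> = e / (2 * (tot b + 1))"
    have \<theta>: "\<theta> > 0" using e btot by (simp add: \<theta>_def)
    have "tot b * \<theta> < e"
    proof -
      have "tot b * \<theta> \<le> (tot b + 1) * \<theta>" using \<theta> by (simp add: algebra_simps)
      also have "\<dots> = e / 2" using btot by (simp add: \<theta>_def field_simps)
      finally show ?thesis using e by simp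
    qed
    moreover have "(\<lambda>j. KY * ?\<rho> j + tot (B j) * (KY * (2 * L * C * tot (?a j)) + \<theta>)) \<longlonglongrightarrow>
       KY * 0 + tot b * (KY * (2 * L * C * 0) + \<theta>)"
      by (intro tendsto_intros \<rho>0 Btot atot)
    ultimately have ev1: "\<forall>\<^sub>F j in sequentially. KY * ?\<rho> j + tot (B j) * (KY * (2 * L * C * tot (?a j)) + \<theta>) < e"
      by (intro order_tendstoD(2)) auto
    have ev2: "\<forall>\<^sub>F j in sequentially. \<forall>i\<in>{..<N}. \<forall>t\<in>J (?a j) i. norm (needle_jump (z i) t - ?v i) \<le> \<theta>"
      by (intro eventually_ball_finite ballI needle_interval_shrinks sm atot \<theta> zU) auto
    from ev1 ev2 show "\<forall>\<^sub>F j in sequentially. dist (?y j - (\<Sum>i<N. B j i *\<^sub>R ?v i)) 0 < e"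
    proof eventually_elim
      fix j assume j1: "KY * ?\<rho> j + tot (B j) * (KY * (2 * L * C * tot (?a j)) + \<theta>) < e"
        and j2: "\<forall>i\<in>{..<N}. \<forall>t\<in>J (?a j) i. norm (needle_jump (z i) t - ?v i) \<le> \<theta>"
      have "norm (Y T (traj (?a j) T - x0 T) - (\<Sum>i<N. ?a j i *\<^sub>R ?v i))
        \<le> KY * integral {0..T} (\<lambda>s. norm (remainder (?a j) s)) + tot (?a j) * (KY * (2 * L * C * tot (?a j)) + \<theta>)"
        by (rule expansion_bound[OF sm KY]) (use j2 in auto)
      also have "\<dots> = s j * (KY * ?\<rho> j + tot (B j) * (KY * (2 * L * C * tot (?a j)) + \<theta>))"
        using s[of j] unfolding tot by (simp add: field_simps)
      also have "\<dots> < s j * e" using j1 s[of j] by (rule mult_strict_left_mono)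
      finally have lt: "norm (Y T (traj (?a j) T - x0 T) - (\<Sum>i<N. ?a j i *\<^sub>R ?v i)) < s j * e" .
      have "Y T (traj (?a j) T - x0 T) = s j *\<^sub>R ?y j"
        using s[of j] by (simp only: blinfun.scaleR_right[symmetric]) simp
      moreover have "(\<Sum>i<N. ?a j i *\<^sub>R ?v i) = s j *\<^sub>R (\<Sum>i<N. B j i *\<^sub>R ?v i)" by (simp add: scaleR_sum_right)
      ultimately have "Y T (traj (?a j) T - x0 T) - (\<Sum>i<N. ?a j i *\<^sub>R ?v i) = s j *\<^sub>R (?y j - (\<Sum>i<N. B j i *\<^sub>R ?v i))"
        by (simp only: scaleR_diff_right)
      then show "dist (?y j - (\<Sum>i<N. B j i *\<^sub>R ?v i)) 0 < e" using lt s[of j] by (simp add: dist_norm)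
    qed
  qed
  moreover have "(\<lambda>j. \<Sum>i<N. B j i *\<^sub>R ?v i) \<longlonglongrightarrow> (\<Sum>i<N. b i *\<^sub>R ?v i)"
    by (intro tendsto_intros B) auto
  ultimately have "(\<lambda>j. (?y j - (\<Sum>i<N. B j i *\<^sub>R ?v i)) + (\<Sum>i<N. B j i *\<^sub>R ?v i)) \<longlonglongrightarrow> 0 + (\<Sum>i<N. b i *\<^sub>R ?v i)"
    by (rule tendsto_add)
  then have "?y \<longlonglongrightarrow> (\<Sum>i<N. b i *\<^sub>R ?v i)" by simp
  then have "(\<lambda>j. X T (?y j)) \<longlonglongrightarrow> X T (\<Sum>i<N. b i *\<^sub>R ?v i)" by (intro tendsto_intros)
  moreover have "X T (Y T w) = w" for w
    using arg_cong[OF XY[of T], of "\<lambda>L. blinfun_apply L w"] T by simp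
  ultimately show ?thesis by (simp add: blinfun.sum_right blinfun.scaleR_right)
qed

end

section \<open>The endpoint map of a finite needle family\<close>

context linearised_process
begin

text \<open>This is the interface to the multiplier rule, free of all reference to differential
  equations: endpoints attainable for lengths in a box, depending continuously on them, with
  directional derivatives at zero length given by nonnegative combinations of the transported
  jumps.\<close>

theorem needle_variations:
  fixes d :: "nat \<Rightarrow> real \<times> 'b"
  assumes d: "\<forall>i<N. d i \<in> {0..<T} \<times> topspace U"
  shows "\<exists>\<epsilon>>0. \<exists>\<Xi>.
       (\<forall>a. (\<forall>i<N. 0 \<le> a i \<and> a i \<le> \<epsilon>) \<longrightarrow> \<Xi> a \<in> reachable) \<and>
       (\<forall>S a. (\<forall>j. \<forall>i<N. 0 \<le> S j i \<and> S j i \<le> \<epsilon>) \<and> (\<forall>i<N. 0 \<le> a i \<and> a i \<le> \<epsilon>) \<and>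
          (\<forall>i<N. (\<lambda>j::nat. S j i) \<longlonglongrightarrow> a i) \<longrightarrow> (\<lambda>j. \<Xi> (S j)) \<longlonglongrightarrow> \<Xi> a) \<and>
       (\<forall>s B b. (\<forall>j. s j > 0) \<and> s \<longlonglongrightarrow> 0 \<and> (\<forall>j. \<forall>i<N. 0 \<le> B j i) \<and> (\<forall>i<N. (\<lambda>j::nat. B j i) \<longlonglongrightarrow> b i) \<longrightarrow>
          (\<lambda>j. (\<Xi> (\<lambda>i. s j * B j i) - x0 T) /\<^sub>R s j) \<longlonglongrightarrow>
            (\<Sum>i<N. b i *\<^sub>R X T (needle_jump (snd (d i)) (fst (d i)))))"
proof -
  define \<tau> where "\<tau> i = fst (d i)" for i
  define z where "z i = snd (d i)" for i
  have \<tau>: "\<tau> i \<in> {0..<T}" and z: "z i \<in> topspace U" if "i < N" for i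
    using d that by (auto simp: \<tau>_def z_def mem_Times_iff)
  obtain M0 where M0: "compactin U M0" "u0 ` {0..T} \<subseteq> M0" using NPC0R_compact_range[OF T u0] by blast
  define M where "M = M0 \<union> z ` {..<N}"
  have M: "compactin U M"
    unfolding M_def by (intro compactin_Un M0 finite_imp_compactin) (use z in auto)
  obtain r L where r: "r > 0" and L: "L > 0" and rL: "\<forall>t\<in>{0..T}. cball (x0 t) r \<subseteq> \<Omega> \<and>
       (\<forall>\<zeta>\<in>M. \<forall>x\<in>cball (x0 t) r. \<forall>y\<in>cball (x0 t) r. norm (f t x \<zeta> - f t y \<zeta>) \<le> L * norm (x - y))"
    using tube[OF M] by blast
  obtain K where K: "K > 0" "\<And>t \<zeta>. t \<in> {0..T} \<Longrightarrow> \<zeta> \<in> M \<Longrightarrow> norm (f t (x0 t) \<zeta>) \<le> K"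
    using f_path_bounded[OF x0_cont x0_mem M] by blast
  \<comment> \<open>All positive margins in one finite set: room in the tube, distance of the base
    points to T, and gaps between distinct base points.\<close>
  define G where "G = insert (r / (4 * K * exp (2 * L * T))) ((\<lambda>i. T - \<tau> i) ` {..<N} \<union>
     (\<lambda>(i, j). \<tau> i - \<tau> j) ` {(i, j). i < N \<and> j < N \<and> \<tau> j < \<tau> i})"
  have "finite {(i, j). i < N \<and> j < N \<and> \<tau> j < \<tau> i}"
    by (rule finite_subset[of _ "{..<N} \<times> {..<N}"]) auto
  then have Gf: "finite G" by (simp add: G_def)
  have Gp: "0 < g" if "g \<in> G" for g using that \<tau> r K by (auto simp: G_def)
  \<comment> \<open>Dividing by N + 1 makes N \<epsilon> strictly smaller than every margin, also
    for N = 0.\<close>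
  define \<epsilon> where "\<epsilon> = Min G / (real N + 1)"
  have "0 < Min G" using Gf Gp by (subst Min_gr_iff) (auto simp: G_def)
  then have \<epsilon>: "\<epsilon> > 0" and N\<epsilon>: "N * \<epsilon> < Min G" by (auto simp: \<epsilon>_def field_simps)
  have N\<epsilon>G: "N * \<epsilon> < g" if "g \<in> G" for g using N\<epsilon> Min_le[OF Gf that] by linarith
  interpret nf: needle_family T \<Omega> U f A x0 u0 X Y F N \<tau> z M r L K \<epsilon>
  proof unfold_locales
    show "0 \<le> \<tau> i" "z i \<in> M" if "i < N" for i using \<tau>[OF that] that by (auto simp: M_def)
    show "u0 t \<in> M" if "t \<in> {0..T}" for t using M0 that by (auto simp: M_def)
    show "cball (x0 t) r \<subseteq> \<Omega>" if "t \<in> {0..T}" for t using rL that by blast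
    show "norm (f t x \<zeta> - f t y \<zeta>) \<le> L * norm (x - y)"
      if "t \<in> {0..T}" "\<zeta> \<in> M" "x \<in> cball (x0 t) r" "y \<in> cball (x0 t) r" for t \<zeta> x y using rL that by blast
    show "\<tau> i + real N * \<epsilon> < T" if "i < N" for i using N\<epsilon>G[of "T - \<tau> i"] that by (auto simp: G_def)
    show "\<tau> j + real N * \<epsilon> < \<tau> i" if "i < N" "j < N" "\<tau> j < \<tau> i" for i j
    proof -
      have "\<tau> i - \<tau> j \<in> G" unfolding G_def using that by (intro insertI2 UnI2 image_eqI[of _ _ "(i, j)"]) auto
      from N\<epsilon>G[OF this] show ?thesis by linarith
    qed
    have "N * \<epsilon> < r / (4 * K * exp (2 * L * T))" by (rule N\<epsilon>G) (simp add: G_def)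
    then show "4 * K * (real N * \<epsilon>) * exp (2 * L * T) \<le> r" using K by (simp add: field_simps)
  qed (use M r L K \<epsilon> in auto)
  have lim: "(\<lambda>j. (nf.traj (\<lambda>i. s j * B j i) T - x0 T) /\<^sub>R s j) \<longlonglongrightarrow> (\<Sum>i<N. b i *\<^sub>R X T (needle_jump (z i) (\<tau> i)))"
    if s: "\<forall>j. s j > 0" "s \<longlonglongrightarrow> 0" and B: "\<forall>j. \<forall>i<N. 0 \<le> B j i" "\<forall>i<N. (\<lambda>j::nat. B j i) \<longlonglongrightarrow> b i" for s B b
  proof -
    have "\<forall>\<^sub>F j in sequentially. \<forall>i\<in>{..<N}. s j * B j i < \<epsilon>"
    proof (intro eventually_ball_finite ballI)
      fix i assume "i \<in> {..<N}"
      then have "(\<lambda>j. s j * B j i) \<longlonglongrightarrow> 0 * b i" using s B by (intro tendsto_mult) auto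
      then show "\<forall>\<^sub>F j in sequentially. s j * B j i < \<epsilon>" using \<epsilon> by (intro order_tendstoD(2)) auto
    qed simp
    \<comment> \<open>The lengths \<open>s j * B j i\<close> lie in the box only from some index on,
      so the sequences are shifted there and the limit is shifted back.\<close>
    then obtain j0 where j0: "\<And>j. j \<ge> j0 \<Longrightarrow> \<forall>i\<in>{..<N}. s j * B j i < \<epsilon>" unfolding eventually_sequentially by blast
    have sm: "nf.small (\<lambda>i. s (j + j0) * B (j + j0) i)" for j
      using j0[of "j + j0"] s(1) B(1) by (auto simp: nf.small_def less_imp_le)
    have "(\<lambda>j. (nf.traj (\<lambda>i. s (j + j0) * B (j + j0) i) T - x0 T) /\<^sub>R s (j + j0)) \<longlonglongrightarrow> (\<Sum>i<N. b i *\<^sub>R X T (needle_jump (z i) (\<tau> i)))"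
      by (rule nf.traj_directional_derivative[where s = "\<lambda>j. s (j + j0)" and B = "\<lambda>j. B (j + j0)"])
        (use s B sm in \<open>auto intro: LIMSEQ_ignore_initial_segment\<close>)
    then show ?thesis by (rule LIMSEQ_offset)
  qed
  show ?thesis
  proof (intro exI[of _ \<epsilon>] exI[of _ "\<lambda>a. nf.traj a T"] conjI allI impI \<epsilon>)
    fix a assume "\<forall>i<N. 0 \<le> a i \<and> a i \<le> \<epsilon>"
    then show "nf.traj a T \<in> reachable" by (intro nf.traj_reachable) (simp add: nf.small_def)
  next
    fix S :: "nat \<Rightarrow> nat \<Rightarrow> real" and a
    assume "(\<forall>j. \<forall>i<N. 0 \<le> S j i \<and> S j i \<le> \<epsilon>) \<and> (\<forall>i<N. 0 \<le> a i \<and> a i \<le> \<epsilon>) \<and> (\<forall>i<N. (\<lambda>j. S j i) \<longlonglongrightarrow> a i)"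
    then show "(\<lambda>j. nf.traj (S j) T) \<longlonglongrightarrow> nf.traj a T"
      by (intro nf.traj_continuous) (auto simp: nf.small_def)
  next
    fix s :: "nat \<Rightarrow> real" and B :: "nat \<Rightarrow> nat \<Rightarrow> real" and b :: "nat \<Rightarrow> real"
    assume "(\<forall>j. s j > 0) \<and> s \<longlonglongrightarrow> 0 \<and> (\<forall>j. \<forall>i<N. 0 \<le> B j i) \<and> (\<forall>i<N. (\<lambda>j::nat. B j i) \<longlonglongrightarrow> b i)"
    then show "(\<lambda>j. (nf.traj (\<lambda>i. s j * B j i) T - x0 T) /\<^sub>R s j) \<longlonglongrightarrow>
            (\<Sum>i<N. b i *\<^sub>R X T (needle_jump (snd (d i)) (fst (d i))))"
      using lim unfolding \<tau>_def z_def by blast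
  qed
qed

end

section \<open>A multiplier rule for finitely many constraints\<close>

text \<open>Bolzano-Weierstrass, one coordinate at a time. Vectors of variable dimension are
  functions of which only the coordinates in \<open>K\<close> matter.\<close>

lemma bounded_componentwise_subseq:
  fixes y :: "nat \<Rightarrow> 'k \<Rightarrow> real"
  assumes "finite K" "\<And>j k. k \<in> K \<Longrightarrow> \<bar>y j k\<bar> \<le> B"
  obtains r l where "strict_mono (r :: nat \<Rightarrow> nat)" "\<And>k. k \<in> K \<Longrightarrow> (\<lambda>j. y (r j) k) \<longlonglongrightarrow> l k"
proof -
  have "\<exists>r l. strict_mono (r :: nat \<Rightarrow> nat) \<and> (\<forall>k\<in>K. (\<lambda>j. y (r j) k) \<longlonglongrightarrow> l k)"
    using assms
  proof (induction K rule: finite_induct)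
    case empty
    show ?case by (intro exI[of _ id]) (auto simp: strict_mono_def)
  next
    case (insert k K)
    then obtain r l where r: "strict_mono (r :: nat \<Rightarrow> nat)" "\<forall>k\<in>K. (\<lambda>j. y (r j) k) \<longlonglongrightarrow> l k" by auto
    have "bounded (range (\<lambda>j. y (r j) k))" using insert.prems by (auto simp: bounded_iff)
    then obtain l' r' where r': "strict_mono (r' :: nat \<Rightarrow> nat)" "((\<lambda>j. y (r j) k) \<circ> r') \<longlonglongrightarrow> l'"
      using bounded_imp_convergent_subsequence by blast
    have "(\<lambda>j. y ((r \<circ> r') j) k') \<longlonglongrightarrow> (l(k := l')) k'" if "k' \<in> insert k K" for k'
    proof (cases "k' = k")
      case True
      then show ?thesis using r' by (simp add: o_def)
    next
      case False
      then have "(\<lambda>j. y (r j) k') \<longlonglongrightarrow> l k'" using r that by auto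
      from LIMSEQ_subseq_LIMSEQ[OF this r'(1)] False show ?thesis by (simp add: o_def)
    qed
    moreover have "strict_mono (r \<circ> r')" using r r' strict_mono_o by blast
    ultimately show ?case by blast
  qed
  then show ?thesis using that by blast
qed

definition unit_cube :: "nat \<Rightarrow> (nat \<Rightarrow> real) set" where
  "unit_cube n = {y. (\<forall>j<n. \<bar>y j\<bar> \<le> 1) \<and> (\<forall>j\<ge>n. y j = 0)}"

text \<open>Label each point of a fine grid, coordinate by coordinate, by the sign of the
  corresponding component of F. Kuhn's combinatorial lemma gives a cell in which every component
  takes both signs; a limit of such cells is a common zero.\<close>

lemma poincare_miranda:
  fixes F :: "(nat \<Rightarrow> real) \<Rightarrow> nat \<Rightarrow> real"
  assumes cont: "\<And>Y y k. (\<And>j. Y j \<in> unit_cube n) \<Longrightarrow> y \<in> unit_cube n \<Longrightarrow> (\<And>i. i < n \<Longrightarrow> (\<lambda>j. Y j i) \<longlonglongrightarrow> y i) \<Longrightarrow>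
      k < n \<Longrightarrow> (\<lambda>j. F (Y j) k) \<longlonglongrightarrow> F y k"
    and lo: "\<And>y k. y \<in> unit_cube n \<Longrightarrow> k < n \<Longrightarrow> y k = -1 \<Longrightarrow> F y k \<le> 0"
    and hi: "\<And>y k. y \<in> unit_cube n \<Longrightarrow> k < n \<Longrightarrow> y k = 1 \<Longrightarrow> F y k \<ge> 0"
  obtains y where "y \<in> unit_cube n" "\<And>k. k < n \<Longrightarrow> F y k = 0"
proof -
  \<comment> \<open>Maps the integer grid {0, ..., p + 1}^n onto a grid in [-1,1]^n of mesh 2 / (p +
    1).\<close>
  define z where "z p x = (\<lambda>j. if j < n then 2 * real (x j) / real (Suc p) - 1 else 0)" for p :: nat and x :: "nat \<Rightarrow> nat"
  have z_cube: "z p x \<in> unit_cube n" if "\<forall>i<n. x i \<le> Suc p" for p x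
  proof -
    have "\<bar>2 * real (x j) / real (Suc p) - 1\<bar> \<le> 1" if "j < n" for j
    proof -
      have "real (x j) \<le> real (Suc p)" using that \<open>\<forall>i<n. x i \<le> Suc p\<close> by (metis of_nat_le_iff)
      then have "real (x j) / real (Suc p) \<le> 1" "real (x j) / real (Suc p) \<ge> 0" by (auto simp: divide_simps)
      then have "2 * (real (x j) / real (Suc p)) \<le> 2" "2 * (real (x j) / real (Suc p)) \<ge> 0" by linarith+
      then show ?thesis unfolding abs_le_iff times_divide_eq_right by linarith
    qed
    then show ?thesis by (auto simp: unit_cube_def z_def)
  qed
  \<comment> \<open>On opposite faces the label is forced, as Kuhn's lemma demands. By
    \<open>lo\<close> and \<open>hi\<close> the forced labels still tell the truth about the sign of
    F.\<close>
  define lab where "lab p x j = (if x j = Suc p then 1 else if x j = 0 \<or> F (z p x) j \<le> 0 then 0 else (1::nat))"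
    for p :: nat and x :: "nat \<Rightarrow> nat" and j :: nat
  have lab0: "F (z p x) j \<le> 0" if "\<forall>i<n. x i \<le> Suc p" "j < n" "lab p x j = 0" for p x j
    using that lo[OF z_cube[OF that(1)] that(2)] by (auto simp: lab_def z_def split: if_splits)
  have lab1: "F (z p x) j \<ge> 0" if "\<forall>i<n. x i \<le> Suc p" "j < n" "lab p x j \<noteq> 0" for p x j
  proof (cases "x j = Suc p")
    case True
    then have "z p x j = 1" using that(2) by (simp add: z_def field_simps)
    then show ?thesis using hi[OF z_cube[OF that(1)] that(2)] by blast
  qed (use that in \<open>auto simp: lab_def split: if_splits\<close>)
  have ex: "\<exists>y. y \<in> unit_cube n \<and> (\<forall>i<n. \<exists>a b. a \<in> unit_cube n \<and> b \<in> unit_cube n \<and> F a i \<le> 0 \<and> F b i \<ge> 0 \<and>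
      (\<forall>j<n. \<bar>a j - y j\<bar> \<le> 2 / real (Suc p)) \<and> (\<forall>j<n. \<bar>b j - y j\<bar> \<le> 2 / real (Suc p)))" for p
  proof -
    obtain q where q: "\<forall>i<n. q i < Suc p" and
      rs: "\<forall>i<n. \<exists>r s. (\<forall>j<n. q j \<le> r j \<and> r j \<le> q j + 1) \<and> (\<forall>j<n. q j \<le> s j \<and> s j \<le> q j + 1) \<and> lab p r i \<noteq> lab p s i"
      by (rule kuhn_lemma[of "Suc p" n "lab p"]) (auto simp: lab_def)
    have cl: "\<bar>z p r j - z p q j\<bar> \<le> 2 / real (Suc p)" if "\<forall>j<n. q j \<le> r j \<and> r j \<le> q j + 1" "j < n" for r j
    proof -
      have "real (r j) - real (q j) \<in> {0..1}" using that by fastforce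
      moreover have "z p r j - z p q j = 2 * (real (r j) - real (q j)) / real (Suc p)"
        using that by (simp add: z_def diff_divide_distrib algebra_simps)
      ultimately show ?thesis by (auto simp: divide_simps)
    qed
    have "\<exists>a b. a \<in> unit_cube n \<and> b \<in> unit_cube n \<and> F a i \<le> 0 \<and> F b i \<ge> 0 \<and>
      (\<forall>j<n. \<bar>a j - z p q j\<bar> \<le> 2 / real (Suc p)) \<and> (\<forall>j<n. \<bar>b j - z p q j\<bar> \<le> 2 / real (Suc p))" if "i < n" for i
    proof -
      from rs[THEN spec, THEN mp, OF that]
      obtain r s where r: "\<forall>j<n. q j \<le> r j \<and> r j \<le> q j + 1" and s: "\<forall>j<n. q j \<le> s j \<and> s j \<le> q j + 1"
        and ne: "lab p r i \<noteq> lab p s i" by (elim exE conjE)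
      have le: "\<forall>i<n. x i \<le> Suc p" if "\<forall>j<n. q j \<le> x j \<and> x j \<le> q j + 1" for x
      proof (intro allI impI)
        fix i assume "i < n"
        then have "x i \<le> q i + 1" "q i < Suc p" using that q by auto
        then show "x i \<le> Suc p" by linarith
      qed
      note r' = le[OF r] and s' = le[OF s]
      show ?thesis
      proof (cases "lab p r i = 0")
        case True
        then have "lab p s i \<noteq> 0" using ne by auto
        then show ?thesis
          by (intro exI[of _ "z p r"] exI[of _ "z p s"] conjI allI impI z_cube r' s' cl[OF r] cl[OF s]
              lab0[OF r' that True] lab1[OF s' that])
      next
        case False
        then have "lab p s i = 0" using ne by (auto simp: lab_def split: if_splits)
        then show ?thesis
          by (intro exI[of _ "z p s"] exI[of _ "z p r"] conjI allI impI z_cube r' s' cl[OF r] cl[OF s]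
              lab0[OF s' that] lab1[OF r' that False])
      qed
    qed
    moreover have "z p q \<in> unit_cube n" using q by (intro z_cube) auto
    ultimately show ?thesis by blast
  qed
  define Q where "Q p y i a b \<longleftrightarrow> a \<in> unit_cube n \<and> b \<in> unit_cube n \<and> F a i \<le> 0 \<and> F b i \<ge> 0 \<and>
      (\<forall>j<n. \<bar>a j - y j\<bar> \<le> 2 / real (Suc p)) \<and> (\<forall>j<n. \<bar>b j - y j\<bar> \<le> 2 / real (Suc p))" for p y i a b
  have "\<forall>p. \<exists>y. y \<in> unit_cube n \<and> (\<forall>i<n. \<exists>a b. Q p y i a b)" unfolding Q_def using ex by (intro allI)
  then obtain Y where Y: "\<And>p. Y p \<in> unit_cube n" and YQ: "\<And>p i. i < n \<Longrightarrow> \<exists>a b. Q p (Y p) i a b" by metis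
  have "\<forall>p i. \<exists>ab. i < n \<longrightarrow> Q p (Y p) i (fst ab) (snd ab)" using YQ by auto
  then obtain ab where "\<And>p i. i < n \<Longrightarrow> Q p (Y p) i (fst (ab p i)) (snd (ab p i))" by metis
  then obtain a b where "\<And>p i. i < n \<Longrightarrow> Q p (Y p) i (a p i) (b p i)"
    by (rule that[of "\<lambda>p i. fst (ab p i)" "\<lambda>p i. snd (ab p i)"])
  then have ab: "\<And>p i. i < n \<Longrightarrow> a p i \<in> unit_cube n" "\<And>p i. i < n \<Longrightarrow> b p i \<in> unit_cube n"
      "\<And>p i. i < n \<Longrightarrow> F (a p i) i \<le> 0" "\<And>p i. i < n \<Longrightarrow> F (b p i) i \<ge> 0"
      "\<And>p i j. i < n \<Longrightarrow> j < n \<Longrightarrow> \<bar>a p i j - Y p j\<bar> \<le> 2 / real (Suc p)"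
      "\<And>p i j. i < n \<Longrightarrow> j < n \<Longrightarrow> \<bar>b p i j - Y p j\<bar> \<le> 2 / real (Suc p)"
    unfolding Q_def by blast+
  obtain r l where r: "strict_mono (r :: nat \<Rightarrow> nat)" and l: "\<And>k. k \<in> {..<n} \<Longrightarrow> (\<lambda>j. Y (r j) k) \<longlonglongrightarrow> l k"
    by (rule bounded_componentwise_subseq[of "{..<n}" Y 1]) (use Y in \<open>auto simp: unit_cube_def\<close>)
  define y where "y = (\<lambda>k. if k < n then l k else 0)"
  have l': "(\<lambda>j. Y (r j) k) \<longlonglongrightarrow> y k" if "k < n" for k using l[of k] that by (simp add: y_def)
  have "\<bar>y k\<bar> \<le> 1" if "k < n" for k
    by (rule LIMSEQ_le_const2[OF tendsto_rabs[OF l'[OF that]]]) (use Y that in \<open>auto simp: unit_cube_def\<close>)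
  then have yc: "y \<in> unit_cube n" by (auto simp: unit_cube_def y_def)
  have small: "(\<lambda>j. 2 / real (Suc (r j))) \<longlonglongrightarrow> 0"
    using LIMSEQ_subseq_LIMSEQ[OF LIMSEQ_Suc[OF lim_const_over_n[of 2]] r] by (simp add: o_def)
  have close: "(\<lambda>j. c (r j) k) \<longlonglongrightarrow> y k" if "k < n" "\<And>p. \<bar>c p k - Y p k\<bar> \<le> 2 / real (Suc p)" for c :: "nat \<Rightarrow> nat \<Rightarrow> real" and k
  proof -
    have "(\<lambda>j. c (r j) k - Y (r j) k) \<longlonglongrightarrow> 0"
      by (rule Lim_null_comparison[OF _ small]) (use that(2) in auto)
    from tendsto_add[OF this l'[OF that(1)]] show ?thesis by simp
  qed
  have "F y k = 0" if k: "k < n" for k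
  proof (rule antisym)
    have "(\<lambda>j. F (a (r j) k) k) \<longlonglongrightarrow> F y k"
      by (rule cont) (use ab k yc in \<open>auto intro: close[of _ "\<lambda>p. a p k"]\<close>)
    then show "F y k \<le> 0" by (rule LIMSEQ_le_const2) (use ab k in auto)
    have "(\<lambda>j. F (b (r j) k) k) \<longlonglongrightarrow> F y k"
      by (rule cont) (use ab k yc in \<open>auto intro: close[of _ "\<lambda>p. b p k"]\<close>)
    then show "0 \<le> F y k" by (rule LIMSEQ_le_const) (use ab k in auto)
  qed
  with yc show ?thesis using that by blast
qed

text \<open>Project w onto the convex cone spanned by the vectors v d, enlarged by decreasing the
  coordinates in I. The limiting residual is nonnegative on I and pairs nonpositively with every v
  d, so \<open>sep\<close> forces it to be 0. The cone need not be closed, hence a minimising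
  sequence instead of a nearest point and the tolerance \<epsilon> in the conclusion.\<close>

lemma cone_dense:
  fixes v :: "'d \<Rightarrow> 'k \<Rightarrow> real" and w :: "'k \<Rightarrow> real"
  assumes fin: "finite K"
    and sep: "\<And>c. (\<And>k. k \<in> K \<inter> I \<Longrightarrow> 0 \<le> c k) \<Longrightarrow> \<exists>k\<in>K. c k \<noteq> 0 \<Longrightarrow> \<exists>d\<in>D. 0 < (\<Sum>k\<in>K. c k * v d k)"
    and "\<epsilon> > 0"
  obtains A a where "finite A" "A \<subseteq> D" "\<And>d. 0 \<le> a d" "\<And>d. d \<notin> A \<Longrightarrow> a d = 0"
    "\<And>k. k \<in> K \<inter> I \<Longrightarrow> w k - \<epsilon> \<le> (\<Sum>d\<in>A. a d * v d k)"
    "\<And>k. k \<in> K - I \<Longrightarrow> \<bar>(\<Sum>d\<in>A. a d * v d k) - w k\<bar> \<le> \<epsilon>"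
proof -
  define P where "P = {y. \<exists>A a. finite A \<and> A \<subseteq> D \<and> (\<forall>d. 0 \<le> a d) \<and> (\<forall>d. d \<notin> A \<longrightarrow> a d = 0) \<and>
     (\<forall>k\<in>K \<inter> I. y k \<le> (\<Sum>d\<in>A. a d * v d k)) \<and> (\<forall>k\<in>K - I. y k = (\<Sum>d\<in>A. a d * v d k))}"
  define N where "N y = (\<Sum>k\<in>K. (w k - y k)\<^sup>2)" for y
  have P0: "(\<lambda>_. 0) \<in> P" unfolding P_def by (auto intro!: exI[of _ "{}"] exI[of _ "\<lambda>_. 0"])
  define \<delta> where "\<delta> = Inf (N ` P)"
  have Nge: "N y \<ge> 0" for y by (auto simp: N_def sum_nonneg)
  have lb: "\<delta> \<le> N y" if "y \<in> P" for y
    unfolding \<delta>_def using that Nge by (intro cINF_lower bdd_belowI2[of _ 0]) auto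
  have "\<exists>y\<in>P. N y < \<delta> + inverse (real (Suc j))" for j
    using cInf_lessD[of "N ` P" "\<delta> + inverse (real (Suc j))"] P0 unfolding \<delta>_def by auto
  then obtain Y where Y: "\<And>j. Y j \<in> P" "\<And>j. N (Y j) < \<delta> + inverse (real (Suc j))" by metis
  have NY: "(\<lambda>j. N (Y j)) \<longlonglongrightarrow> \<delta>"
  proof (rule tendsto_sandwich[of "\<lambda>_. \<delta>"])
    show "\<forall>\<^sub>F j in sequentially. N (Y j) \<le> \<delta> + inverse (real (Suc j))"
      using Y(2) by (intro always_eventually allI less_imp_le)
    show "(\<lambda>j. \<delta> + inverse (real (Suc j))) \<longlonglongrightarrow> \<delta>"
      using tendsto_add[OF tendsto_const LIMSEQ_inverse_real_of_nat] by simp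
  qed (use lb Y in \<open>auto intro!: always_eventually\<close>)
  have \<delta>0: "\<delta> \<ge> 0" unfolding \<delta>_def using P0 Nge by (intro cINF_greatest) auto
  \<comment> \<open>\<delta> + 2 is merely a convenient number whose square exceeds \<delta> + 1,
    the bound for the squared distances.\<close>
  have "\<bar>w k - Y j k\<bar> \<le> \<delta> + 2" if "k \<in> K" for j k
  proof -
    have "(w k - Y j k)\<^sup>2 \<le> N (Y j)"
      unfolding N_def by (rule member_le_sum[OF that _ fin]) auto
    also have "\<dots> \<le> \<delta> + 1"
      using Y(2)[of j] inverse_le_1_iff[of "real (Suc j)"] by simp
    also have "\<dots> \<le> (\<delta> + 2)\<^sup>2" using \<delta>0 by (simp add: power2_eq_square algebra_simps)
    finally show ?thesis using \<delta>0 by (intro power2_le_imp_le[of "\<bar>_\<bar>"]) (auto simp: power2_abs)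
  qed
  note bnd = this
  obtain r \<rho> where r: "strict_mono (r :: nat \<Rightarrow> nat)" and \<rho>: "\<And>k. k \<in> K \<Longrightarrow> (\<lambda>j. w k - Y (r j) k) \<longlonglongrightarrow> \<rho> k"
    by (rule bounded_componentwise_subseq[OF fin, of "\<lambda>j k. w k - Y j k" "\<delta> + 2"]) (use bnd in auto)
  have NYr: "(\<lambda>j. N (Y (r j))) \<longlonglongrightarrow> \<delta>" using LIMSEQ_subseq_LIMSEQ[OF NY r] by (simp add: o_def)
  \<comment> \<open>A direction along which the cone may be left running forever cannot decrease the
    distance, so it pairs nonpositively with the limiting residual.\<close>
  have desc: "(\<Sum>k\<in>K. \<rho> k * e k) \<le> 0" if e: "\<And>y s. y \<in> P \<Longrightarrow> s \<ge> 0 \<Longrightarrow> (\<lambda>k. y k + s * e k) \<in> P" for e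
  proof (rule ccontr)
    define R where "R = (\<Sum>k\<in>K. \<rho> k * e k)"
    define V where "V = (\<Sum>k\<in>K. (e k)\<^sup>2)"
    \<comment> \<open>Nearly the minimiser R / V of -2 s R + s^2 V; the added 1 covers V =
      0.\<close>
    define s where "s = R / (V + 1)"
    assume "\<not> ?thesis"
    then have R: "R > 0" by (simp add: R_def)
    have V: "V \<ge> 0" by (simp add: V_def sum_nonneg)
    have s: "s > 0" using R V by (simp add: s_def)
    have exp: "N (\<lambda>k. y k + s * e k) = N y - 2 * s * (\<Sum>k\<in>K. (w k - y k) * e k) + s\<^sup>2 * V" for y
      unfolding N_def V_def sum_distrib_left sum_subtractf[symmetric] sum.distrib[symmetric]
      by (intro sum.cong) (auto simp: power2_eq_square algebra_simps)
    have "(\<lambda>j. N (\<lambda>k. Y (r j) k + s * e k)) \<longlonglongrightarrow> \<delta> - 2 * s * R + s\<^sup>2 * V"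
      unfolding exp R_def by (intro tendsto_intros NYr \<rho>)
    then have "\<delta> \<le> \<delta> - 2 * s * R + s\<^sup>2 * V"
      by (rule LIMSEQ_le_const) (use lb e Y s less_imp_le in auto)
    then have "2 * s * R \<le> s * (s * V)" by (simp add: power2_eq_square)
    then have "2 * R \<le> s * V" using s by simp
    moreover have "s * V \<le> R" using R V by (simp add: s_def divide_simps)
    ultimately show False using R by simp
  qed
  have Pd: "(\<lambda>k. y k + s * v d k) \<in> P" if y: "y \<in> P" and "s \<ge> 0" and d: "d \<in> D" for y s d
  proof -
    obtain A a where A: "finite A" "A \<subseteq> D" "\<forall>d. 0 \<le> a d" "\<forall>d. d \<notin> A \<longrightarrow> a d = 0"
     "\<forall>k\<in>K \<inter> I. y k \<le> (\<Sum>d\<in>A. a d * v d k)" "\<forall>k\<in>K - I. y k = (\<Sum>d\<in>A. a d * v d k)"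
      using y unfolding P_def by blast
    have "(\<Sum>d'\<in>insert d A. (a(d := a d + s)) d' * v d' k) = (\<Sum>d\<in>A. a d * v d k) + s * v d k" for k
    proof -
      have "(\<Sum>d'\<in>insert d A. (a(d := a d + s)) d' * v d' k) = (\<Sum>d'\<in>insert d A. a d' * v d' k + (if d' = d then s * v d k else 0))"
        by (intro sum.cong) (auto simp: algebra_simps)
      also have "\<dots> = (\<Sum>d'\<in>insert d A. a d' * v d' k) + s * v d k"
        using A(1) by (simp add: sum.distrib)
      also have "(\<Sum>d'\<in>insert d A. a d' * v d' k) = (\<Sum>d\<in>A. a d * v d k)"
        by (rule sum.mono_neutral_right) (use A in auto)
      finally show ?thesis .
    qed
    note eq = this
    have "\<forall>k\<in>K \<inter> I. y k + s * v d k \<le> (\<Sum>d'\<in>insert d A. (a(d := a d + s)) d' * v d' k)"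
      "\<forall>k\<in>K - I. y k + s * v d k = (\<Sum>d'\<in>insert d A. (a(d := a d + s)) d' * v d' k)"
      using A(5,6) unfolding eq by auto
    moreover have "finite (insert d A)" "insert d A \<subseteq> D" "\<forall>d'. 0 \<le> (a(d := a d + s)) d'"
      "\<forall>d'. d' \<notin> insert d A \<longrightarrow> (a(d := a d + s)) d' = 0"
      using A(1-4) d \<open>s \<ge> 0\<close> by auto
    ultimately show ?thesis unfolding P_def by blast
  qed
  \<comment> \<open>The directions that lower a coordinate in I; they give the sign of the residual
    there.\<close>
  have Pk: "(\<lambda>k. y k + s * (if k = k' then -1 else 0)) \<in> P" if y: "y \<in> P" and "s \<ge> 0" and k': "k' \<in> K \<inter> I" for y s k'
  proof -
    obtain A a where A: "finite A" "A \<subseteq> D" "\<forall>d. 0 \<le> a d" "\<forall>d. d \<notin> A \<longrightarrow> a d = 0"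
     "\<forall>k\<in>K \<inter> I. y k \<le> (\<Sum>d\<in>A. a d * v d k)" "\<forall>k\<in>K - I. y k = (\<Sum>d\<in>A. a d * v d k)"
      using y unfolding P_def by blast
    have "\<forall>k\<in>K \<inter> I. y k + s * (if k = k' then -1 else 0) \<le> (\<Sum>d\<in>A. a d * v d k)"
      using A(5) \<open>s \<ge> 0\<close> by force
    moreover have "\<forall>k\<in>K - I. y k + s * (if k = k' then -1 else 0) = (\<Sum>d\<in>A. a d * v d k)"
      using A(6) k' by auto
    ultimately show ?thesis unfolding P_def using A(1-4) by blast
  qed
  have "\<rho> k \<ge> 0" if "k \<in> K \<inter> I" for k
    using desc[of "\<lambda>k'. if k' = k then -1 else 0", OF Pk] that fin by (simp add: if_distrib cong: if_cong)
  moreover have "\<not> (\<exists>d\<in>D. 0 < (\<Sum>k\<in>K. \<rho> k * v d k))" using desc[OF Pd] by (meson not_less)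
  ultimately have \<rho>0: "\<rho> k = 0" if "k \<in> K" for k using sep[of \<rho>] that by blast
  have "\<forall>\<^sub>F j in sequentially. \<forall>k\<in>K. \<bar>w k - Y (r j) k\<bar> < \<epsilon>"
    using fin \<open>\<epsilon> > 0\<close> \<rho> \<rho>0 by (intro eventually_ball_finite ballI order_tendstoD(2)[of _ "\<bar>0\<bar>"] tendsto_rabs) force+
  then obtain j where j: "\<forall>k\<in>K. \<bar>w k - Y (r j) k\<bar> < \<epsilon>" by (auto simp: eventually_sequentially)
  obtain A a where A: "finite A" "A \<subseteq> D" "\<forall>d. 0 \<le> a d" "\<forall>d. d \<notin> A \<longrightarrow> a d = 0"
     "\<forall>k\<in>K \<inter> I. Y (r j) k \<le> (\<Sum>d\<in>A. a d * v d k)" "\<forall>k\<in>K - I. Y (r j) k = (\<Sum>d\<in>A. a d * v d k)"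
    using Y(1)[of "r j"] unfolding P_def by blast
  show ?thesis
  proof (rule that[OF A(1,2)])
    show "w k - \<epsilon> \<le> (\<Sum>d\<in>A. a d * v d k)" if "k \<in> K \<inter> I" for k using bspec[OF A(5) that] bspec[OF j, of k] that by auto
    show "\<bar>(\<Sum>d\<in>A. a d * v d k) - w k\<bar> \<le> \<epsilon>" if "k \<in> K - I" for k using bspec[OF A(6) that] bspec[OF j, of k] that by auto
  qed (use A in auto)
qed

lemma hadamard_sequentially:
  assumes "has_hadamard_differential \<phi> L x" "\<And>j. s j > 0" "s \<longlonglongrightarrow> 0" "w \<longlonglongrightarrow> v"
  shows "(\<lambda>j. (\<phi> (x + s j *\<^sub>R w j) - \<phi> x) /\<^sub>R s j) \<longlonglongrightarrow> L v"
proof -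
  have "filterlim s (at_right 0) sequentially"
    using assms(2,3) less_imp_neq[OF assms(2)] by (auto simp: filterlim_at intro!: always_eventually)
  then have "filterlim (\<lambda>j. (s j, w j)) (at_right 0 \<times>\<^sub>F nhds v) sequentially"
    using assms(4) by (rule filterlim_Pair)
  with assms(1) have "filterlim (\<lambda>j. (\<lambda>(\<theta>, w). (\<phi> (x + \<theta> *\<^sub>R w) - \<phi> x) /\<^sub>R \<theta>) (s j, w j)) (nhds (L v)) sequentially"
    unfolding has_hadamard_differential_def using filterlim_compose by blast
  then show ?thesis by simp
qed


text \<open>Indices below q are equalities, q is the objective, those above q are inequalities. Cone
  coefficients are nonnegative, so steering each equality in both directions takes two combinations,
  aimed at its positive and negative unit vectors. Together with one combination that raises the
  objective and the active inequalities, they are mixed by a parameter y in the cube, and a suitable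
  y restores the equalities.\<close>

theorem multiplier_rule:
  fixes xs :: "'e::real_normed_vector" and G :: "nat \<Rightarrow> 'e \<Rightarrow> real" and DG :: "nat \<Rightarrow> 'e \<Rightarrow>\<^sub>L real"
    and v :: "'d \<Rightarrow> 'e" and R :: "'e set"
  assumes had: "\<And>k. k < n \<Longrightarrow> has_hadamard_differential (G k) (DG k) xs"
    and cont: "\<And>k. k < q \<Longrightarrow> \<exists>S. open S \<and> xs \<in> S \<and> continuous_on S (G k)"
    and q: "q < n"
    and feas0: "\<And>k. k < q \<Longrightarrow> G k xs = 0" and feas: "\<And>k. q < k \<Longrightarrow> k < n \<Longrightarrow> 0 \<le> G k xs"
    and opt: "\<And>x. x \<in> R \<Longrightarrow> (\<And>k. k < q \<Longrightarrow> G k x = 0) \<Longrightarrow> (\<And>k. q < k \<Longrightarrow> k < n \<Longrightarrow> 0 \<le> G k x) \<Longrightarrow> G q x \<le> G q xs"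
    and fam: "\<And>N (d :: nat \<Rightarrow> 'd). \<forall>i<N. d i \<in> D \<Longrightarrow> \<exists>\<epsilon>>0. \<exists>X.
       (\<forall>a. (\<forall>i<N. 0 \<le> a i \<and> a i \<le> \<epsilon>) \<longrightarrow> X a \<in> R) \<and>
       (\<forall>A a. (\<forall>j. \<forall>i<N. 0 \<le> A j i \<and> A j i \<le> \<epsilon>) \<and> (\<forall>i<N. 0 \<le> a i \<and> a i \<le> \<epsilon>) \<and>
          (\<forall>i<N. (\<lambda>j::nat. A j i) \<longlonglongrightarrow> a i) \<longrightarrow> (\<lambda>j. X (A j)) \<longlonglongrightarrow> X a) \<and>
       (\<forall>s B b. (\<forall>j. s j > 0) \<and> s \<longlonglongrightarrow> 0 \<and> (\<forall>j. \<forall>i<N. 0 \<le> B j i) \<and> (\<forall>i<N. (\<lambda>j::nat. B j i) \<longlonglongrightarrow> b i) \<longrightarrow>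
          (\<lambda>j. (X (\<lambda>i. s j * B j i) - xs) /\<^sub>R s j) \<longlonglongrightarrow> (\<Sum>i<N. b i *\<^sub>R v (d i)))"
  obtains c where "\<exists>k<n. c k \<noteq> 0" "\<And>k. q \<le> k \<Longrightarrow> k < n \<Longrightarrow> 0 \<le> c k"
    "\<And>k. q < k \<Longrightarrow> k < n \<Longrightarrow> c k * G k xs = 0" "\<And>d. d \<in> D \<Longrightarrow> (\<Sum>k<n. c k * DG k (v d)) \<le> 0"
proof (rule ccontr)
  assume no: "\<not> thesis"
  note thesisI = that
  \<comment> \<open>Inactive inequalities are left out: they survive small perturbations, and
    setting their multipliers to 0 is exactly complementary slackness.\<close>
  define K where "K = {k. k < n \<and> (k \<le> q \<or> G k xs = 0)}"
  define I where "I = {q..}"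
  have finK: "finite K" and Kn: "K \<subseteq> {..<n}" by (auto simp: K_def)
  have sep: "\<exists>d\<in>D. 0 < (\<Sum>k\<in>K. c k * DG k (v d))" if c: "\<And>k. k \<in> K \<inter> I \<Longrightarrow> 0 \<le> c k" "\<exists>k\<in>K. c k \<noteq> 0" for c
  proof (rule ccontr)
    assume neg: "\<not> ?thesis"
    define c' where "c' k = (if k \<in> K then c k else 0)" for k
    have "(\<Sum>k<n. c' k * DG k (v d)) = (\<Sum>k\<in>K. c k * DG k (v d))" for d
      by (rule sum.mono_neutral_cong_right) (use Kn in \<open>auto simp: c'_def\<close>)
    then have "(\<Sum>k<n. c' k * DG k (v d)) \<le> 0" if "d \<in> D" for d using neg that by (auto simp: not_less)
    moreover have "\<exists>k<n. c' k \<noteq> 0" using c Kn unfolding c'_def by (metis lessThan_iff subsetD)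
    moreover have "0 \<le> c' k" if "q \<le> k" "k < n" for k using c that by (auto simp: c'_def I_def)
    moreover have "c' k * G k xs = 0" if "q < k" "k < n" for k using that by (auto simp: c'_def K_def)
    ultimately show False using no thesisI[of c'] by blast
  qed
  \<comment> \<open>The base combination and the q steering combinations err by at most \<epsilon>1
    each in total, and (q + 1) \<epsilon>1 = 1/4.\<close>
  define \<epsilon>\<^sub>1 where "\<epsilon>\<^sub>1 = 1 / (4 * (real q + 1))"
  have \<epsilon>\<^sub>1: "\<epsilon>\<^sub>1 > 0" by (simp add: \<epsilon>\<^sub>1_def)
  define W where "W w A a \<longleftrightarrow> finite A \<and> A \<subseteq> D \<and> (\<forall>d. 0 \<le> a d) \<and> (\<forall>d. d \<notin> A \<longrightarrow> a d = 0) \<and>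
    (\<forall>k\<in>K \<inter> I. w k - \<epsilon>\<^sub>1 \<le> (\<Sum>d\<in>A. a d * DG k (v d))) \<and>
    (\<forall>k\<in>K - I. \<bar>(\<Sum>d\<in>A. a d * DG k (v d)) - w k\<bar> \<le> \<epsilon>\<^sub>1)" for w :: "nat \<Rightarrow> real" and A and a :: "'d \<Rightarrow> real"
  have exW: "\<exists>A a. W w A a" for w
    by (rule cone_dense[OF finK sep \<epsilon>\<^sub>1, where w = w], assumption, assumption)
      (unfold W_def, intro exI conjI ballI allI impI, assumption+)
  then have "\<forall>w. \<exists>p. W w (fst p) (snd p)" by simp
  then obtain pk where pk: "\<forall>w. W w (fst (pk w)) (snd (pk w))" by (rule choice[THEN exE])
  \<comment> \<open>Target 0 on the equalities and 2 on the objective and active inequalities. The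
    steering terms can lower these values only by their tolerance, so at least 1 remains.\<close>
  define A0 a0 where "A0 = fst (pk (\<lambda>k. if k < q then 0 else 2))" and "a0 = snd (pk (\<lambda>k. if k < q then 0 else 2))"
  define Ap ap where "Ap j = fst (pk (\<lambda>k. if k = j then 1 else 0))" and "ap j = snd (pk (\<lambda>k. if k = j then 1 else 0))" for j
  define Am am where "Am j = fst (pk (\<lambda>k. if k = j then -1 else 0))" and "am j = snd (pk (\<lambda>k. if k = j then -1 else 0))" for j
  have W0: "W (\<lambda>k. if k < q then 0 else 2) A0 a0"
    and Wp: "\<And>j. W (\<lambda>k. if k = j then 1 else 0) (Ap j) (ap j)"
    and Wm: "\<And>j. W (\<lambda>k. if k = j then -1 else 0) (Am j) (am j)"
    unfolding A0_def a0_def Ap_def ap_def Am_def am_def using pk by blast+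
  define AA where "AA = A0 \<union> (\<Union>j<q. Ap j) \<union> (\<Union>j<q. Am j)"
  have WD: "finite A" "A \<subseteq> D" "0 \<le> a d" if "W w A a" for w A a d using that by (auto simp: W_def)
  have finAA: "finite AA" and AAD: "AA \<subseteq> D" using WD(1,2)[OF W0] WD(1,2)[OF Wp] WD(1,2)[OF Wm] unfolding AA_def by (auto, blast+)
  define N where "N = card AA"
  obtain e where e: "bij_betw e {..<N} AA"
    using ex_bij_betw_nat_finite[OF finAA] unfolding N_def atLeast0LessThan by blast
  have ext: "(\<Sum>d\<in>A. a d * DG k (v d)) = (\<Sum>i<N. a (e i) * DG k (v (e i)))" if "W w A a" "A \<subseteq> AA" for w A a k
  proof -
    have "(\<Sum>d\<in>A. a d * DG k (v d)) = (\<Sum>d\<in>AA. a d * DG k (v d))"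
      by (rule sum.mono_neutral_left[OF finAA that(2)]) (use that(1) in \<open>auto simp: W_def\<close>)
    also have "\<dots> = (\<Sum>i<N. a (e i) * DG k (v (e i)))" by (rule sum.reindex_bij_betw[OF e, symmetric])
    finally show ?thesis .
  qed
  \<comment> \<open>Positive and negative parts of y weight the two steering combinations; the
    coefficients are nonnegative and continuous in y.\<close>
  define \<beta> where "\<beta> y i = a0 (e i) + (\<Sum>j<q. max (y j) 0 * ap j (e i) + max (- y j) 0 * am j (e i))" for y :: "nat \<Rightarrow> real" and i
  have \<beta>0: "0 \<le> \<beta> y i" for y i
    unfolding \<beta>_def by (intro add_nonneg_nonneg sum_nonneg mult_nonneg_nonneg WD(3)[OF W0] WD(3)[OF Wp] WD(3)[OF Wm]) auto
  define w where "w y = (\<Sum>i<N. \<beta> y i *\<^sub>R v (e i))" for y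
  define S0 where "S0 k = (\<Sum>i<N. a0 (e i) * DG k (v (e i)))" for k
  define Sp where "Sp j k = (\<Sum>i<N. ap j (e i) * DG k (v (e i)))" for j k
  define Sm where "Sm j k = (\<Sum>i<N. am j (e i) * DG k (v (e i)))" for j k
  have Dw: "DG k (w y) = S0 k + (\<Sum>j<q. max (y j) 0 * Sp j k + max (- y j) 0 * Sm j k)" for k y
  proof -
    have "DG k (w y) = (\<Sum>i<N. \<beta> y i * DG k (v (e i)))"
      by (simp add: w_def blinfun.sum_right blinfun.scaleR_right)
    also have "\<dots> = S0 k + (\<Sum>i<N. \<Sum>j<q. max (y j) 0 * (ap j (e i) * DG k (v (e i))) + max (- y j) 0 * (am j (e i) * DG k (v (e i))))"
      by (simp add: \<beta>_def S0_def algebra_simps sum.distrib sum_distrib_left sum_distrib_right)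
    also have "(\<Sum>i<N. \<Sum>j<q. max (y j) 0 * (ap j (e i) * DG k (v (e i))) + max (- y j) 0 * (am j (e i) * DG k (v (e i)))) =
      (\<Sum>j<q. max (y j) 0 * Sp j k + max (- y j) 0 * Sm j k)"
      unfolding Sp_def Sm_def sum_distrib_left sum.distrib[symmetric] by (rule sum.swap)
    finally show ?thesis .
  qed
  have WK: "k < q \<Longrightarrow> \<bar>(\<Sum>d\<in>A. a d * DG k (v d)) - w k\<bar> \<le> \<epsilon>\<^sub>1"
      "k \<in> K \<inter> I \<Longrightarrow> w k - \<epsilon>\<^sub>1 \<le> (\<Sum>d\<in>A. a d * DG k (v d))" if "W w A a" for w A a k
    using that q by (auto simp: W_def K_def I_def)
  have A0s: "A0 \<subseteq> AA" by (auto simp: AA_def)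
  have AAj: "Ap j \<subseteq> AA" "Am j \<subseteq> AA" if "j < q" for j using that by (auto simp: AA_def)
  have kI: "q \<le> k" if "k \<in> K \<inter> I" for k using that by (auto simp: I_def)
  have S0: "k < q \<Longrightarrow> \<bar>S0 k\<bar> \<le> \<epsilon>\<^sub>1" "k \<in> K \<inter> I \<Longrightarrow> 2 - \<epsilon>\<^sub>1 \<le> S0 k" for k
    using WK[OF W0, of k] ext[OF W0 A0s, of k] unfolding S0_def by (auto simp: I_def)
  have Sp: "k < q \<Longrightarrow> \<bar>Sp j k - (if k = j then 1 else 0)\<bar> \<le> \<epsilon>\<^sub>1" "k \<in> K \<inter> I \<Longrightarrow> - \<epsilon>\<^sub>1 \<le> Sp j k" if "j < q" for j k
    using WK[OF Wp, of k j] ext[OF Wp, of j k] AAj[OF that] kI[of k] that unfolding Sp_def by (auto split: if_splits)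
  have Sm: "k < q \<Longrightarrow> \<bar>Sm j k - (if k = j then -1 else 0)\<bar> \<le> \<epsilon>\<^sub>1" "k \<in> K \<inter> I \<Longrightarrow> - \<epsilon>\<^sub>1 \<le> Sm j k" if "j < q" for j k
    using WK[OF Wm, of k j] ext[OF Wm, of j k] AAj[OF that] kI[of k] that unfolding Sm_def by (auto split: if_splits)
  have \<epsilon>q: "\<epsilon>\<^sub>1 + real q * \<epsilon>\<^sub>1 = 1 / 4" by (simp add: \<epsilon>\<^sub>1_def field_simps)
  have pm: "max t 0 + max (-t) 0 \<le> 1" if "\<bar>t\<bar> \<le> 1" for t :: real using that by auto
  have Deq: "\<bar>DG k (w y) - y k\<bar> \<le> 1 / 4" if y: "y \<in> unit_cube q" and k: "k < q" for y k
  proof -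
    have yk: "y k = (\<Sum>j<q. max (y j) 0 * (if k = j then 1 else 0) + max (- y j) 0 * (if k = j then -1 else 0))"
      using k by (simp add: sum.distrib if_distrib cong: if_cong)
    have "DG k (w y) - y k = S0 k + (\<Sum>j<q. max (y j) 0 * (Sp j k - (if k = j then 1 else 0)) + max (- y j) 0 * (Sm j k - (if k = j then -1 else 0)))"
      unfolding Dw by (subst yk) (simp only: right_diff_distrib sum_subtractf sum.distrib add_diff_eq diff_add_eq diff_diff_eq add.assoc add.commute add.left_commute)
    then have "\<bar>DG k (w y) - y k\<bar> \<le> \<bar>S0 k\<bar> + (\<Sum>j<q. \<bar>max (y j) 0 * (Sp j k - (if k = j then 1 else 0)) + max (- y j) 0 * (Sm j k - (if k = j then -1 else 0))\<bar>)"
      using abs_triangle_ineq[of "S0 k"] sum_abs[of "\<lambda>j. max (y j) 0 * (Sp j k - (if k = j then 1 else 0)) + max (- y j) 0 * (Sm j k - (if k = j then -1 else 0))" "{..<q}"]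
      by linarith
    also have "\<dots> \<le> \<epsilon>\<^sub>1 + (\<Sum>j<q. \<epsilon>\<^sub>1)"
    proof (intro add_mono sum_mono)
      fix j assume "j \<in> {..<q}"
      then have j: "j < q" by simp
      have "\<bar>max (y j) 0 * (Sp j k - (if k = j then 1 else 0)) + max (- y j) 0 * (Sm j k - (if k = j then -1 else 0))\<bar>
        \<le> max (y j) 0 * \<bar>Sp j k - (if k = j then 1 else 0)\<bar> + max (- y j) 0 * \<bar>Sm j k - (if k = j then -1 else 0)\<bar>"
        by (rule order_trans[OF abs_triangle_ineq]) (simp add: abs_mult)
      also have "\<dots> \<le> max (y j) 0 * \<epsilon>\<^sub>1 + max (- y j) 0 * \<epsilon>\<^sub>1"
        using Sp(1)[OF j k] Sm(1)[OF j k] by (intro add_mono mult_left_mono) auto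
      also have "\<dots> = (max (y j) 0 + max (- y j) 0) * \<epsilon>\<^sub>1" by (simp add: algebra_simps)
      also have "\<dots> \<le> 1 * \<epsilon>\<^sub>1" using pm[of "y j"] y j \<epsilon>\<^sub>1 by (intro mult_right_mono) (auto simp: unit_cube_def)
      finally show "\<bar>max (y j) 0 * (Sp j k - (if k = j then 1 else 0)) + max (- y j) 0 * (Sm j k - (if k = j then -1 else 0))\<bar> \<le> \<epsilon>\<^sub>1" by simp
    qed (use S0(1) k in auto)
    finally show ?thesis using \<epsilon>q by simp
  qed
  have Dge: "1 \<le> DG k (w y)" if y: "y \<in> unit_cube q" and k: "k \<in> K \<inter> I" for y k
  proof -
    have "(\<Sum>j<q. - \<epsilon>\<^sub>1) \<le> (\<Sum>j<q. max (y j) 0 * Sp j k + max (- y j) 0 * Sm j k)"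
    proof (rule sum_mono)
      fix j assume "j \<in> {..<q}"
      then have j: "j < q" by simp
      have "1 * (- \<epsilon>\<^sub>1) \<le> (max (y j) 0 + max (- y j) 0) * (- \<epsilon>\<^sub>1)"
        using pm[of "y j"] y j \<epsilon>\<^sub>1 by (intro mult_right_mono_neg) (auto simp: unit_cube_def)
      also have "\<dots> = max (y j) 0 * (- \<epsilon>\<^sub>1) + max (- y j) 0 * (- \<epsilon>\<^sub>1)" by (simp add: algebra_simps)
      also have "\<dots> \<le> max (y j) 0 * Sp j k + max (- y j) 0 * Sm j k"
        using Sp(2)[OF j k] Sm(2)[OF j k] by (intro add_mono mult_left_mono) auto
      finally show "- \<epsilon>\<^sub>1 \<le> max (y j) 0 * Sp j k + max (- y j) 0 * Sm j k" by simp
    qed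
    then show ?thesis using S0(2)[OF k] \<epsilon>q unfolding Dw by simp
  qed
  have eD: "\<forall>i<N. e i \<in> D" using e AAD by (auto simp: bij_betw_def)
  from fam[of N e, OF eD] obtain \<epsilon> X where \<epsilon>: "\<epsilon> > 0" and
    X1: "\<forall>a. (\<forall>i<N. 0 \<le> a i \<and> a i \<le> \<epsilon>) \<longrightarrow> X a \<in> R" and
    X2: "\<forall>A a. (\<forall>j. \<forall>i<N. 0 \<le> A j i \<and> A j i \<le> \<epsilon>) \<and> (\<forall>i<N. 0 \<le> a i \<and> a i \<le> \<epsilon>) \<and>
          (\<forall>i<N. (\<lambda>j::nat. A j i) \<longlonglongrightarrow> a i) \<longrightarrow> (\<lambda>j. X (A j)) \<longlonglongrightarrow> X a" and
    X3: "\<forall>s B b. (\<forall>j. s j > 0) \<and> s \<longlonglongrightarrow> 0 \<and> (\<forall>j. \<forall>i<N. 0 \<le> B j i) \<and> (\<forall>i<N. (\<lambda>j::nat. B j i) \<longlonglongrightarrow> b i) \<longrightarrow>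
          (\<lambda>j. (X (\<lambda>i. s j * B j i) - xs) /\<^sub>R s j) \<longlonglongrightarrow> (\<Sum>i<N. b i *\<^sub>R v (e i))"
    by (elim exE conjE)
  have XR: "X a \<in> R" if "\<And>i. i < N \<Longrightarrow> 0 \<le> a i \<and> a i \<le> \<epsilon>" for a
    using X1 that by blast
  have Xc: "(\<lambda>j. X (A j)) \<longlonglongrightarrow> X a" if "\<And>j i. i < N \<Longrightarrow> 0 \<le> A j i \<and> A j i \<le> \<epsilon>"
    "\<And>i. i < N \<Longrightarrow> 0 \<le> a i \<and> a i \<le> \<epsilon>" "\<And>i. i < N \<Longrightarrow> (\<lambda>j::nat. A j i) \<longlonglongrightarrow> a i" for A a
    by (rule X2[THEN spec, THEN spec, THEN mp]) (intro conjI allI impI that, assumption+)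
  have Xd: "(\<lambda>j. (X (\<lambda>i. s j * B j i) - xs) /\<^sub>R s j) \<longlonglongrightarrow> (\<Sum>i<N. b i *\<^sub>R v (e i))"
    if "\<And>j. s j > 0" "s \<longlonglongrightarrow> 0" "\<And>j i. i < N \<Longrightarrow> 0 \<le> B j i" "\<And>i. i < N \<Longrightarrow> (\<lambda>j::nat. B j i) \<longlonglongrightarrow> b i" for s B b
    by (rule X3[THEN spec, THEN spec, THEN spec, THEN mp]) (intro conjI allI impI that, assumption+)
  obtain U where U: "\<And>k. k < q \<Longrightarrow> open (U k) \<and> xs \<in> U k \<and> continuous_on (U k) (G k)" using cont by metis
  have \<beta>c: "(\<lambda>j. \<beta> (Y j) i) \<longlonglongrightarrow> \<beta> y i" if "\<And>k. k < q \<Longrightarrow> (\<lambda>j. Y j k) \<longlonglongrightarrow> y k" for Y :: "nat \<Rightarrow> nat \<Rightarrow> real" and y i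
    unfolding \<beta>_def by (intro tendsto_intros tendsto_max that) auto
  define P where "P s y \<longleftrightarrow> (\<forall>i<N. s * \<beta> y i \<le> \<epsilon>) \<and> (\<forall>k<q. X (\<lambda>i. s * \<beta> y i) \<in> U k) \<and>
    (\<forall>k<n. \<bar>(G k (X (\<lambda>i. s * \<beta> y i)) - G k xs) / s - DG k (w y)\<bar> < 1 / 4) \<and>
    (\<forall>k<n. 0 < G k xs \<longrightarrow> 0 < G k (X (\<lambda>i. s * \<beta> y i)))" for s y
  \<comment> \<open>One scale s must serve the whole cube. A failure at every scale would give a
    convergent sequence of parameters, and the derivative along the varying directions \<beta>(y_j)
    contradicts it.\<close>
  have "\<exists>s>0. \<forall>y\<in>unit_cube q. P s y"
  proof (rule ccontr)
    assume "\<not> ?thesis"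
    then have "\<forall>j. \<exists>y\<in>unit_cube q. \<not> P (inverse (real (Suc j))) y" by (metis inverse_positive_iff_positive of_nat_0_less_iff zero_less_Suc)
    then obtain Y where Y: "\<And>j. Y j \<in> unit_cube q" "\<And>j. \<not> P (inverse (real (Suc j))) (Y j)" by metis
    obtain r y where r: "strict_mono (r :: nat \<Rightarrow> nat)" and y: "\<And>k. k \<in> {..<q} \<Longrightarrow> (\<lambda>j. Y (r j) k) \<longlonglongrightarrow> y k"
      by (rule bounded_componentwise_subseq[of "{..<q}" Y 1]) (use Y in \<open>auto simp: unit_cube_def\<close>)
    define s where "s j = inverse (real (Suc (r j)))" for j
    have s0: "s j > 0" for j by (simp add: s_def)
    have s: "s \<longlonglongrightarrow> 0" unfolding s_def using LIMSEQ_subseq_LIMSEQ[OF LIMSEQ_inverse_real_of_nat r] by (simp add: o_def)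
    have \<beta>y: "(\<lambda>j. \<beta> (Y (r j)) i) \<longlonglongrightarrow> \<beta> y i" for i using \<beta>c[of "\<lambda>j. Y (r j)"] y by auto
    define x where "x j = X (\<lambda>i. s j * \<beta> (Y (r j)) i)" for j
    have wlim: "(\<lambda>j. w (Y (r j))) \<longlonglongrightarrow> w y" unfolding w_def by (intro tendsto_intros \<beta>y)
    have xq: "(\<lambda>j. (x j - xs) /\<^sub>R s j) \<longlonglongrightarrow> w y"
      unfolding x_def w_def by (rule Xd) (use s0 s \<beta>0 \<beta>y in auto)
    have xrep: "x j = xs + s j *\<^sub>R ((x j - xs) /\<^sub>R s j)" for j using s0[of j] by simp
    have "(\<lambda>j. xs + s j *\<^sub>R ((x j - xs) /\<^sub>R s j)) \<longlonglongrightarrow> xs + 0 *\<^sub>R w y" by (intro tendsto_intros s xq)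
    then have xlim: "x \<longlonglongrightarrow> xs" using xrep by simp
    have Gq: "(\<lambda>j. (G k (x j) - G k xs) / s j) \<longlonglongrightarrow> DG k (w y)" if "k < n" for k
      using hadamard_sequentially[OF had[OF that] s0 s xq] xrep by (simp add: divide_inverse_commute)
    \<comment> \<open>For the objective and the inequalities no continuity is assumed: the values
      converge because a convergent quotient is multiplied by s_j -> 0.\<close>
    have Glim: "(\<lambda>j. G k (x j)) \<longlonglongrightarrow> G k xs" if "k < n" for k
    proof -
      have "(\<lambda>j. G k xs + s j * ((G k (x j) - G k xs) / s j)) \<longlonglongrightarrow> G k xs + 0 * DG k (w y)"
        by (intro tendsto_intros s Gq that)
      moreover have "G k xs + s j * ((G k (x j) - G k xs) / s j) = G k (x j)" for j using s0[of j] by simp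
      ultimately show ?thesis by simp
    qed
    have "\<forall>\<^sub>F j in sequentially. \<forall>i\<in>{..<N}. s j * \<beta> (Y (r j)) i < \<epsilon>"
    proof (intro eventually_ball_finite ballI)
      fix i
      have "(\<lambda>j. s j * \<beta> (Y (r j)) i) \<longlonglongrightarrow> 0 * \<beta> y i" by (intro tendsto_intros s \<beta>y)
      then show "\<forall>\<^sub>F j in sequentially. s j * \<beta> (Y (r j)) i < \<epsilon>" using \<epsilon> by (intro order_tendstoD(2)) auto
    qed simp
    moreover have "\<forall>\<^sub>F j in sequentially. \<forall>k\<in>{..<q}. x j \<in> U k"
      using U xlim by (intro eventually_ball_finite ballI) (auto intro: topological_tendstoD)
    moreover have "\<forall>\<^sub>F j in sequentially. \<forall>k\<in>{..<n}. \<bar>(G k (x j) - G k xs) / s j - DG k (w (Y (r j)))\<bar> < 1 / 4"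
    proof (intro eventually_ball_finite ballI)
      fix k assume "k \<in> {..<n}"
      then have "(\<lambda>j. \<bar>(G k (x j) - G k xs) / s j - DG k (w (Y (r j)))\<bar>) \<longlonglongrightarrow> \<bar>DG k (w y) - DG k (w y)\<bar>"
        by (intro tendsto_intros Gq wlim) auto
      then show "\<forall>\<^sub>F j in sequentially. \<bar>(G k (x j) - G k xs) / s j - DG k (w (Y (r j)))\<bar> < 1 / 4"
        by (rule order_tendstoD) simp
    qed simp
    moreover have "\<forall>\<^sub>F j in sequentially. \<forall>k\<in>{..<n}. 0 < G k xs \<longrightarrow> 0 < G k (x j)"
    proof (intro eventually_ball_finite ballI)
      fix k assume "k \<in> {..<n}"
      then show "\<forall>\<^sub>F j in sequentially. 0 < G k xs \<longrightarrow> 0 < G k (x j)"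
        using order_tendstoD(1)[OF Glim, of k 0] by (cases "0 < G k xs") (auto elim: eventually_mono)
    qed simp
    ultimately have "\<forall>\<^sub>F j in sequentially. P (s j) (Y (r j))"
      by eventually_elim (auto simp: P_def x_def less_imp_le)
    then show False using Y(2) by (auto simp: s_def)
  qed
  then obtain s where s: "s > 0" and P: "\<And>y. y \<in> unit_cube q \<Longrightarrow> P s y" by blast
  define F where "F y k = G k (X (\<lambda>i. s * \<beta> y i))" for y k
  have Fq: "\<bar>(F y k - G k xs) / s - DG k (w y)\<bar> < 1 / 4" if "y \<in> unit_cube q" "k < n" for y k
    using P[OF that(1)] that(2) by (auto simp: P_def F_def)
  obtain y where y: "y \<in> unit_cube q" and y0: "\<And>k. k < q \<Longrightarrow> F y k = 0"
  \<comment> \<open>The equalities start at 0. Their difference quotient differs from y k by less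
    than 1/4 + 1/4, so its sign on the faces y k = 1 and y k = -1 is determined.\<close>
  proof (rule poincare_miranda[of q F])
    fix Y y k assume Y: "\<And>j. Y j \<in> unit_cube q" "y \<in> unit_cube q" "\<And>i. i < q \<Longrightarrow> (\<lambda>j. Y j i) \<longlonglongrightarrow> y i" and k: "k < q"
    have "(\<lambda>j. X (\<lambda>i. s * \<beta> (Y j) i)) \<longlonglongrightarrow> X (\<lambda>i. s * \<beta> y i)"
      by (rule Xc) (use P[OF Y(1)] P[OF Y(2)] s \<beta>0 Y(3) in \<open>auto simp: P_def intro!: tendsto_intros \<beta>c\<close>)
    moreover have "isCont (G k) (X (\<lambda>i. s * \<beta> y i))"
      using U[OF k] P[OF Y(2)] k by (auto simp: P_def continuous_on_eq_continuous_at)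
    ultimately show "(\<lambda>j. F (Y j) k) \<longlonglongrightarrow> F y k" unfolding F_def by (rule isCont_tendsto_compose[rotated])
  next
    fix y k assume y: "y \<in> unit_cube q" "k < q" "y k = - 1"
    then have "\<bar>(F y k - G k xs) / s - DG k (w y)\<bar> < 1 / 4" "\<bar>DG k (w y) - y k\<bar> \<le> 1 / 4"
      using Fq[of y k] Deq[of y k] q by auto
    then have "(F y k - G k xs) / s < 0" unfolding y(3) abs_less_iff abs_le_iff by linarith
    then show "F y k \<le> 0" using feas0[OF y(2)] s by (simp add: divide_less_0_iff)
  next
    fix y k assume y: "y \<in> unit_cube q" "k < q" "y k = 1"
    then have "\<bar>(F y k - G k xs) / s - DG k (w y)\<bar> < 1 / 4" "\<bar>DG k (w y) - y k\<bar> \<le> 1 / 4"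
      using Fq[of y k] Deq[of y k] q by auto
    then have "(F y k - G k xs) / s > 0" unfolding y(3) abs_less_iff abs_le_iff by linarith
    then show "0 \<le> F y k" using feas0[OF y(2)] s by (simp add: zero_less_divide_iff)
  qed auto
  \<comment> \<open>Here the linear part is at least 1 and the error less than 1/4. For index q this
    strict increase contradicts optimality.\<close>
  have FI: "F y k > G k xs" if "k \<in> K \<inter> I" for k
  proof -
    have "\<bar>(F y k - G k xs) / s - DG k (w y)\<bar> < 1 / 4" using Fq[OF y, of k] that Kn by auto
    then have "(F y k - G k xs) / s > 0" using Dge[OF y that] unfolding abs_less_iff by linarith
    then show ?thesis using s by (simp add: zero_less_divide_iff)
  qed
  have "F y q \<le> G q xs"
    unfolding F_def
  proof (rule opt)
    show "X (\<lambda>i. s * \<beta> y i) \<in> R" by (rule XR) (use P[OF y] \<beta>0 s in \<open>auto simp: P_def\<close>)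
    show "G k (X (\<lambda>i. s * \<beta> y i)) = 0" if "k < q" for k using y0[OF that] by (simp add: F_def)
    show "0 \<le> G k (X (\<lambda>i. s * \<beta> y i))" if "q < k" "k < n" for k
    proof (cases "G k xs = 0")
      case True
      then show ?thesis using FI[of k] that by (auto simp: K_def I_def F_def)
    next
      case False
      then show ?thesis using feas[OF that] P[OF y] that by (auto simp: P_def less_imp_le)
    qed
  qed
  moreover have "q \<in> K \<inter> I" using q by (auto simp: K_def I_def)
  ultimately show False using FI[of q] by simp
qed

section \<open>Differentials\<close>

lemma has_gateaux_differential_unique:
  assumes "has_gateaux_differential \<phi> L x" "has_gateaux_differential \<phi> L' x" shows "L = L'"
proof (rule blinfun_eqI)
  fix v
  let ?q = "\<lambda>\<theta>::real. (\<phi> (x + \<theta> *\<^sub>R v) - \<phi> x) /\<^sub>R \<theta>"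
  have "(?q \<longlongrightarrow> L v) (at_right 0)" "(?q \<longlongrightarrow> L' v) (at_right 0)"
    using assms by (auto simp: has_gateaux_differential_def)
  then show "L v = L' v" by (rule tendsto_unique[OF trivial_limit_at_right_real])
qed

lemma D_G_eq: "has_gateaux_differential \<phi> L x \<Longrightarrow> D_G \<phi> x = L"
  unfolding D_G_def using has_gateaux_differential_unique by blast

lemma has_gateaux_differential_D_G: "gateaux_differentiable \<phi> x \<Longrightarrow> has_gateaux_differential \<phi> (D_G \<phi> x) x"
  unfolding gateaux_differentiable_def using D_G_eq by blast

lemma has_hadamard_gateaux: "has_hadamard_differential \<phi> L x \<Longrightarrow> has_gateaux_differential \<phi> L x"
  by (simp add: has_hadamard_differential_def)

lemma D_H_eq: "has_hadamard_differential \<phi> L x \<Longrightarrow> D_H \<phi> x = L"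
  unfolding D_H_def using has_gateaux_differential_unique has_hadamard_gateaux by blast

lemma has_hadamard_differential_D_H: "hadamard_differentiable \<phi> x \<Longrightarrow> has_hadamard_differential \<phi> (D_H \<phi> x) x"
  unfolding hadamard_differentiable_def using D_H_eq by blast

lemma D_G_eq_D_H: "hadamard_differentiable \<phi> x \<Longrightarrow> D_G \<phi> x = D_H \<phi> x"
  by (rule D_G_eq[OF has_hadamard_gateaux[OF has_hadamard_differential_D_H]])

lemma D_F_eq: "(\<phi> has_derivative blinfun_apply L) (at x) \<Longrightarrow> D_F \<phi> x = L"
  unfolding D_F_def by (metis blinfun_apply_inverse frechet_derivative_at)

lemma has_derivative_D_F: "\<phi> differentiable (at x) \<Longrightarrow> (\<phi> has_derivative blinfun_apply (D_F \<phi> x)) (at x)"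
  unfolding D_F_def
  by (metis bounded_linear_Blinfun_apply frechet_derivative_works has_derivative_bounded_linear)

lemma has_vector_derivative_slope:
  fixes h :: "real \<Rightarrow> 'a::real_normed_vector"
  shows "(h has_vector_derivative D) (at s within S) \<longleftrightarrow> ((\<lambda>y. (h y - h s) /\<^sub>R (y - s)) \<longlongrightarrow> D) (at s within S)"
proof -
  have *: "norm ((1 / norm (y - s)) *\<^sub>R (h y - (h s + (y - s) *\<^sub>R D))) = norm ((h y - h s) /\<^sub>R (y - s) - D)" if "y \<noteq> s" for y
  proof -
    have "(h y - h s) /\<^sub>R (y - s) - D = (1 / (y - s)) *\<^sub>R (h y - (h s + (y - s) *\<^sub>R D))"
    proof -
      have "(1 / (y - s)) *\<^sub>R (h y - (h s + (y - s) *\<^sub>R D)) = (1 / (y - s)) *\<^sub>R (h y - h s) - (1 / (y - s)) *\<^sub>R ((y - s) *\<^sub>R D)"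
        by (simp only: scaleR_diff_right[symmetric] diff_diff_eq)
      also have "\<dots> = (h y - h s) /\<^sub>R (y - s) - D" using that by (simp add: divide_inverse)
      finally show ?thesis by simp
    qed
    then show ?thesis by simp
  qed
  have "(h has_vector_derivative D) (at s within S) \<longleftrightarrow>
    ((\<lambda>y. norm ((1 / norm (y - s)) *\<^sub>R (h y - (h s + (y - s) *\<^sub>R D)))) \<longlongrightarrow> 0) (at s within S)"
    by (simp only: has_vector_derivative_def has_derivative_within bounded_linear_scaleR_left tendsto_norm_zero_iff) simp
  also have "\<dots> \<longleftrightarrow> ((\<lambda>y. norm ((h y - h s) /\<^sub>R (y - s) - D)) \<longlongrightarrow> 0) (at s within S)"
    by (intro filterlim_cong refl)
      (unfold eventually_at_filter, intro always_eventually allI impI, rule *)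
  also have "\<dots> \<longleftrightarrow> ((\<lambda>y. (h y - h s) /\<^sub>R (y - s)) \<longlongrightarrow> D) (at s within S)"
    by (simp only: tendsto_norm_zero_iff LIM_zero_iff)
  finally show ?thesis .
qed

text \<open>The differential is defined through positive increments only. The left derivative along
  the line comes from the direction -v by linearity of L.\<close>

lemma gateaux_line_derivative:
  fixes \<phi> :: "'a::real_normed_vector \<Rightarrow> 'b::real_normed_vector"
  assumes "has_gateaux_differential \<phi> L (x + s *\<^sub>R v)"
  shows "((\<lambda>s. \<phi> (x + s *\<^sub>R v)) has_vector_derivative L v) (at s)"
proof -
  have lim: "((\<lambda>\<theta>. (\<phi> (x + s *\<^sub>R v + \<theta> *\<^sub>R w) - \<phi> (x + s *\<^sub>R v)) /\<^sub>R \<theta>) \<longlongrightarrow> L w) (at_right 0)" for w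
    using assms by (simp add: has_gateaux_differential_def)
  have "((\<lambda>y. (\<phi> (x + y *\<^sub>R v) - \<phi> (x + s *\<^sub>R v)) /\<^sub>R (y - s)) \<longlongrightarrow> L v) (at_right s)"
    unfolding filterlim_at_right_to_0[of _ _ s] using lim[of v] by (simp add: algebra_simps)
  moreover have "((\<lambda>y. (\<phi> (x + y *\<^sub>R v) - \<phi> (x + s *\<^sub>R v)) /\<^sub>R (y - s)) \<longlongrightarrow> L v) (at_left s)"
    unfolding filterlim_at_left_to_right[of _ _ s] filterlim_at_right_to_0[of _ _ "- s"]
    using tendsto_minus[OF lim[of "- v"]]
    by (simp add: algebra_simps blinfun.minus_right)
  ultimately show ?thesis
    unfolding has_vector_derivative_slope by (simp add: filterlim_at_split)
qed

text \<open>The mean value inequality on the segment from x to y; Gateaux differentiability suffices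
  because only the restriction to this segment is differentiated.\<close>

lemma gateaux_lipschitz:
  fixes \<phi> :: "'a::real_normed_vector \<Rightarrow> 'b::real_normed_vector"
  assumes S: "convex S" and x: "x \<in> S" "y \<in> S"
    and g: "\<And>\<xi>. \<xi> \<in> S \<Longrightarrow> has_gateaux_differential \<phi> (L \<xi>) \<xi>" "\<And>\<xi>. \<xi> \<in> S \<Longrightarrow> norm (L \<xi>) \<le> B"
  shows "norm (\<phi> y - \<phi> x) \<le> B * norm (y - x)"
proof -
  have mem: "x + s *\<^sub>R (y - x) \<in> S" if "s \<in> {0..1}" for s
  proof -
    have "(1 - s) *\<^sub>R x + s *\<^sub>R y \<in> S" using S x that by (auto simp: convex_alt)
    then show ?thesis by (simp add: algebra_simps)
  qed
  have "norm ((\<lambda>s. \<phi> (x + s *\<^sub>R (y - x))) 1 - (\<lambda>s. \<phi> (x + s *\<^sub>R (y - x))) 0) \<le> B * norm (y - x) * norm (1 - 0 :: real)"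
  proof (rule differentiable_bound[of "{0..1}" _ "\<lambda>s h. h *\<^sub>R L (x + s *\<^sub>R (y - x)) (y - x)"])
    fix s :: real assume s: "s \<in> {0..1}"
    show "((\<lambda>s. \<phi> (x + s *\<^sub>R (y - x))) has_derivative (\<lambda>h. h *\<^sub>R L (x + s *\<^sub>R (y - x)) (y - x))) (at s within {0..1})"
      using has_vector_derivative_at_within[OF gateaux_line_derivative[OF g(1)[OF mem[OF s]]]]
      by (simp add: has_vector_derivative_def)
    have "norm (L (x + s *\<^sub>R (y - x)) (y - x)) \<le> B * norm (y - x)"
      by (rule order_trans[OF norm_blinfun mult_right_mono[OF g(2)[OF mem[OF s]] norm_ge_zero]])
    then show "onorm (\<lambda>h. h *\<^sub>R L (x + s *\<^sub>R (y - x)) (y - x)) \<le> B * norm (y - x)"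
      by (intro onorm_le) (simp add: mult.commute[of "B * _"] mult_left_mono)
  qed auto
  then show ?thesis by simp
qed

section \<open>From bounds on compact sets to a Lipschitz tube\<close>

lemma integrand_regularD:
  assumes "integrand_regular T \<Omega> U x\<^sub>0 \<phi>"
  shows "continuous_map (prod_topology (top_of_set {0..T}) (prod_topology (top_of_set \<Omega>) U)) euclidean (\<lambda>(t, \<xi>, \<zeta>). \<phi> t \<xi> \<zeta>)"
    and "t \<in> {0..T} \<Longrightarrow> \<xi> \<in> \<Omega> \<Longrightarrow> \<zeta> \<in> topspace U \<Longrightarrow> gateaux_differentiable (\<lambda>y. \<phi> t y \<zeta>) \<xi>"
    and "t \<in> {0..T} \<Longrightarrow> \<zeta> \<in> topspace U \<Longrightarrow> (\<lambda>y. \<phi> t y \<zeta>) differentiable (at (x\<^sub>0 t))"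
    and "continuous_map (prod_topology (top_of_set {0..T}) U) euclidean (\<lambda>(t, \<zeta>). D_F (\<lambda>y. \<phi> t y \<zeta>) (x\<^sub>0 t))"
    and "K \<noteq> {} \<Longrightarrow> compact K \<Longrightarrow> K \<subseteq> \<Omega> \<Longrightarrow> M \<noteq> {} \<Longrightarrow> compactin U M \<Longrightarrow>
       bdd_above ((\<lambda>(t, \<xi>, \<zeta>). norm (D_G (\<lambda>y. \<phi> t y \<zeta>) \<xi>)) ` ({0..T} \<times> K \<times> M))"
  using assms unfolding integrand_regular_def
  by ((elim conjE, assumption) | (elim conjE, drule bspec, assumption, drule bspec, assumption, drule bspec, assumption, assumption)
    | (elim conjE, rotate_tac 2, drule bspec, assumption, drule bspec, assumption, assumption) | simp)+

lemma compact_range_of_convergent: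
  fixes f :: "nat \<Rightarrow> 'a::topological_space"
  assumes "f \<longlonglongrightarrow> l"
  shows "compact (insert l (range f))"
proof (rule compactI)
  fix \<C> assume o: "\<forall>S\<in>\<C>. open S" and cover: "insert l (range f) \<subseteq> \<Union>\<C>"
  then obtain S where S: "S \<in> \<C>" "l \<in> S" by blast
  then have "\<forall>\<^sub>F n in sequentially. f n \<in> S" using o assms by (auto dest: topological_tendstoD)
  then obtain N where N: "\<And>n. n \<ge> N \<Longrightarrow> f n \<in> S" unfolding eventually_sequentially by blast
  have "f ` {..<N} \<subseteq> \<Union>\<C>" using cover by blast
  then obtain \<F> where \<F>: "finite \<F>" "\<F> \<subseteq> \<C>" "f ` {..<N} \<subseteq> \<Union>\<F>"
    using finite_subset_Union[of "f ` {..<N}" \<C>] by auto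
  have "f n \<in> \<Union>(insert S \<F>)" for n
    using N[of n] \<F>(3) by (cases "n < N") auto
  then have "insert l (range f) \<subseteq> \<Union>(insert S \<F>)" using S by blast
  then show "\<exists>\<C>'\<subseteq>\<C>. finite \<C>' \<and> insert l (range f) \<subseteq> \<Union>\<C>'"
    using \<F> S by (intro exI[of _ "insert S \<F>"]) auto
qed

text \<open>If no tube carried a bound, there would be points \<xi>_n within r0 / (n + 1) of the
  trajectory at which the differential exceeds n. A subsequence of the nearby trajectory points
  converges, hence so do the \<xi>_n, and with the limit they form a compact subset of \<Omega> on
  which the hypothesis bounds the differential. The mean value inequality on convex balls
  finishes.\<close>

lemma integrand_tube_lipschitz:
  fixes \<phi> :: "real \<Rightarrow> 'e::banach \<Rightarrow> 'u \<Rightarrow> 'f::real_normed_vector"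
  assumes reg: "integrand_regular T \<Omega> U x\<^sub>0 \<phi>" and \<Omega>: "open \<Omega>" and c: "continuous_on {0..T} x\<^sub>0" "x\<^sub>0 ` {0..T} \<subseteq> \<Omega>"
    and M: "compactin U M"
  shows "\<exists>r>0. \<exists>L>0. \<forall>t\<in>{0..T}. cball (x\<^sub>0 t) r \<subseteq> \<Omega> \<and>
       (\<forall>\<zeta>\<in>M. \<forall>x\<in>cball (x\<^sub>0 t) r. \<forall>y\<in>cball (x\<^sub>0 t) r. norm (\<phi> t x \<zeta> - \<phi> t y \<zeta>) \<le> L * norm (x - y))"
proof -
  have comp: "compact (x\<^sub>0 ` {0..T})" using c by (intro compact_continuous_image) auto
  obtain r0 where r0: "r0 > 0" "(\<Union>x\<in>x\<^sub>0 ` {0..T}. cball x r0) \<subseteq> \<Omega>"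
    using compact_subset_open_imp_cball_epsilon_subset[OF comp \<Omega> c(2)] by blast
  have MU: "M \<subseteq> topspace U" using M by (rule compactin_subset_topspace)
  have gat: "has_gateaux_differential (\<lambda>y. \<phi> t y \<zeta>) (D_G (\<lambda>y. \<phi> t y \<zeta>) \<xi>) \<xi>"
    if "t \<in> {0..T}" "\<xi> \<in> \<Omega>" "\<zeta> \<in> M" for t \<xi> \<zeta>
    using integrand_regularD(2)[OF reg that(1,2)] that(3) MU by (intro has_gateaux_differential_D_G) auto
  have bdd: "bdd_above ((\<lambda>(t, \<xi>, \<zeta>). norm (D_G (\<lambda>y. \<phi> t y \<zeta>) \<xi>)) ` ({0..T} \<times> K \<times> M))"
    if "compact K" "K \<subseteq> \<Omega>" for K
  proof (cases "K = {} \<or> M = {}")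
    case False
    then show ?thesis using integrand_regularD(5)[OF reg _ that _ M] by simp
  qed auto
  \<comment> \<open>One index governs both the shrinking radius and the growing bound, so a failure
    for every n yields a single contradicting sequence.\<close>
  define good where "good n \<longleftrightarrow> (\<forall>t\<in>{0..T}. \<forall>\<zeta>\<in>M. \<forall>\<xi>\<in>cball (x\<^sub>0 t) (r0 / (real n + 1)). norm (D_G (\<lambda>y. \<phi> t y \<zeta>) \<xi>) \<le> real n)"
    for n :: nat
  have "\<exists>n. good n"
  proof (rule ccontr)
    define bad where "bad n p \<longleftrightarrow> (case p of (t, \<zeta>, \<xi>) \<Rightarrow> t \<in> {0..T} \<and> \<zeta> \<in> M \<and> \<xi> \<in> cball (x\<^sub>0 t) (r0 / (real n + 1)) \<and>
        real n < norm (D_G (\<lambda>y. \<phi> t y \<zeta>) \<xi>))" for n :: nat and p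
    assume neg: "\<not> ?thesis"
    have "\<exists>p. bad n p" for n
    proof (rule ccontr)
      assume "\<not> ?thesis"
      then have nb: "\<not> bad n p" for p by blast
      have "good n"
        unfolding good_def
      proof (intro ballI)
        fix t \<zeta> \<xi> assume "t \<in> {0..T}" "\<zeta> \<in> M" "\<xi> \<in> cball (x\<^sub>0 t) (r0 / (real n + 1))"
        then show "norm (D_G (\<lambda>y. \<phi> t y \<zeta>) \<xi>) \<le> real n"
          using nb[of "(t, \<zeta>, \<xi>)"] by (simp add: bad_def)
      qed
      with neg show False by blast
    qed
    then obtain P where P: "\<And>n. bad n (P n)" by metis
    define t \<zeta> \<xi> where "t n = fst (P n)" and "\<zeta> n = fst (snd (P n))" and "\<xi> n = snd (snd (P n))" for n
    have s: "t n \<in> {0..T}" "\<zeta> n \<in> M" "\<xi> n \<in> cball (x\<^sub>0 (t n)) (r0 / (real n + 1))"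
        "real n < norm (D_G (\<lambda>y. \<phi> (t n) y (\<zeta> n)) (\<xi> n))" for n
      using P[of n] by (simp_all add: bad_def t_def \<zeta>_def \<xi>_def case_prod_unfold)
    have "\<forall>n. x\<^sub>0 (t n) \<in> x\<^sub>0 ` {0..T}" using s(1) by blast
    then obtain l \<sigma> where l: "l \<in> x\<^sub>0 ` {0..T}" and \<sigma>: "strict_mono (\<sigma> :: nat \<Rightarrow> nat)" "((\<lambda>n. x\<^sub>0 (t n)) \<circ> \<sigma>) \<longlonglongrightarrow> l"
      by (rule seq_compactE[OF compact_imp_seq_compact[OF comp]])
    have rad0: "(\<lambda>n. r0 / (real n + 1)) \<longlonglongrightarrow> 0"
      using LIMSEQ_Suc[OF lim_const_over_n[of r0]] by (simp add: add.commute)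
    have rad: "(\<lambda>n. r0 / (real (\<sigma> n) + 1)) \<longlonglongrightarrow> 0"
      using LIMSEQ_subseq_LIMSEQ[OF rad0 \<sigma>(1)] by (simp add: o_def)
    have "(\<lambda>n. \<xi> (\<sigma> n) - x\<^sub>0 (t (\<sigma> n))) \<longlonglongrightarrow> 0"
      by (rule Lim_null_comparison[OF _ rad]) (use s(3) in \<open>auto simp: dist_norm norm_minus_commute\<close>)
    from tendsto_add[OF this \<sigma>(2)[unfolded o_def]] have lim: "(\<lambda>n. \<xi> (\<sigma> n)) \<longlonglongrightarrow> l" by simp
    define K where "K = insert l (range (\<lambda>n. \<xi> (\<sigma> n)))"
    have K: "compact K" unfolding K_def by (rule compact_range_of_convergent[OF lim])
    have inball: "\<xi> n \<in> cball (x\<^sub>0 (t n)) r0" for n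
    proof -
      have "r0 / (real n + 1) \<le> r0" using r0(1) by (simp add: field_simps)
      then show ?thesis using s(3)[of n] by auto
    qed
    have K\<Omega>: "K \<subseteq> \<Omega>" using inball s(1) r0(2) l c(2) unfolding K_def by blast
    obtain B where B: "\<And>n. norm (D_G (\<lambda>y. \<phi> (t (\<sigma> n)) y (\<zeta> (\<sigma> n))) (\<xi> (\<sigma> n))) \<le> B"
    proof -
      from bdd[OF K K\<Omega>] obtain B where B: "\<And>w. w \<in> (\<lambda>(t, \<xi>, \<zeta>). norm (D_G (\<lambda>y. \<phi> t y \<zeta>) \<xi>)) ` ({0..T} \<times> K \<times> M) \<Longrightarrow> w \<le> B"
        unfolding bdd_above_def by blast
      show ?thesis
      proof (rule that[of B], rule B)
        fix n
        show "norm (D_G (\<lambda>y. \<phi> (t (\<sigma> n)) y (\<zeta> (\<sigma> n))) (\<xi> (\<sigma> n))) \<in> (\<lambda>(t, \<xi>, \<zeta>). norm (D_G (\<lambda>y. \<phi> t y \<zeta>) \<xi>)) ` ({0..T} \<times> K \<times> M)"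
          using s(1,2) by (intro image_eqI[of _ _ "(t (\<sigma> n), \<xi> (\<sigma> n), \<zeta> (\<sigma> n))"]) (auto simp: K_def)
      qed
    qed
    obtain n :: nat where "B < real n" using reals_Archimedean2 by blast
    moreover have "real n \<le> real (\<sigma> n)" using seq_suble[OF \<sigma>(1)] by simp
    ultimately show False using s(4)[of "\<sigma> n"] B[of n] by linarith
  qed
  then obtain n where "good n" by blast
  then have n: "\<And>t \<zeta> \<xi>. t \<in> {0..T} \<Longrightarrow> \<zeta> \<in> M \<Longrightarrow> \<xi> \<in> cball (x\<^sub>0 t) (r0 / (real n + 1)) \<Longrightarrow>
      norm (D_G (\<lambda>y. \<phi> t y \<zeta>) \<xi>) \<le> real n"
    unfolding good_def by blast
  define r where "r = r0 / (real n + 1)"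
  have r: "r > 0" "r \<le> r0" using r0(1) by (auto simp: r_def field_simps)
  have sub: "cball (x\<^sub>0 t) r \<subseteq> \<Omega>" if "t \<in> {0..T}" for t
  proof -
    have "cball (x\<^sub>0 t) r \<subseteq> cball (x\<^sub>0 t) r0" using r by auto
    then show ?thesis using r0(2) that by blast
  qed
  have "norm (\<phi> t x \<zeta> - \<phi> t y \<zeta>) \<le> (real n + 1) * norm (x - y)"
    if t: "t \<in> {0..T}" and \<zeta>: "\<zeta> \<in> M" and xy: "x \<in> cball (x\<^sub>0 t) r" "y \<in> cball (x\<^sub>0 t) r" for t \<zeta> x y
  proof -
    have "norm (\<phi> t x \<zeta> - \<phi> t y \<zeta>) \<le> real n * norm (x - y)"
      by (rule gateaux_lipschitz[OF convex_cball xy(2,1) gat[OF t _ \<zeta>]])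
        (use n[OF t \<zeta>] sub[OF t] in \<open>auto simp: r_def\<close>)
    \<comment> \<open>The added 1 makes the Lipschitz constant strictly positive even for n =
      0.\<close>
    also have "\<dots> \<le> (real n + 1) * norm (x - y)" by (intro mult_right_mono) auto
    finally show ?thesis .
  qed
  moreover have "real n + 1 > 0" by simp
  ultimately show ?thesis using r(1) sub by blast
qed

text \<open>The function is linear in the cost variable, so its difference quotient splits exactly
  into that of \<phi> and a term continuous in the direction.\<close>

lemma has_hadamard_differential_augmented:
  fixes \<phi> :: "'a::real_normed_vector \<Rightarrow> real"
  assumes "has_hadamard_differential \<phi> L x"
  shows "has_hadamard_differential (\<lambda>y. c * fst y + \<phi> (snd y)) (c *\<^sub>R fst_blinfun + (L o\<^sub>L snd_blinfun)) (s, x)"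
proof -
  let ?\<Phi> = "\<lambda>y :: real \<times> 'a. c * fst y + \<phi> (snd y)"
  have q: "(?\<Phi> ((s, x) + \<theta> *\<^sub>R w) - ?\<Phi> (s, x)) /\<^sub>R \<theta> = c * fst w + (\<phi> (x + \<theta> *\<^sub>R snd w) - \<phi> x) /\<^sub>R \<theta>"
    if "\<theta> \<noteq> 0" for \<theta> w
    using that by (simp add: field_simps)
  have ev0: "\<forall>\<^sub>F \<theta> in at_right (0::real). \<theta> \<noteq> 0" by (simp add: eventually_at_filter)
  have 1: "((\<lambda>\<theta>. (?\<Phi> ((s, x) + \<theta> *\<^sub>R v) - ?\<Phi> (s, x)) /\<^sub>R \<theta>) \<longlongrightarrow> (c *\<^sub>R fst_blinfun + (L o\<^sub>L snd_blinfun)) v) (at_right 0)" for v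
  proof -
    have "((\<lambda>\<theta>. c * fst v + (\<phi> (x + \<theta> *\<^sub>R snd v) - \<phi> x) /\<^sub>R \<theta>) \<longlongrightarrow> c * fst v + L (snd v)) (at_right 0)"
      using assms by (intro tendsto_intros) (simp add: has_hadamard_differential_def has_gateaux_differential_def)
    then have "((\<lambda>\<theta>. (?\<Phi> ((s, x) + \<theta> *\<^sub>R v) - ?\<Phi> (s, x)) /\<^sub>R \<theta>) \<longlongrightarrow> c * fst v + L (snd v)) (at_right 0)"
    proof (rule Lim_transform_eventually)
      from ev0 show "\<forall>\<^sub>F \<theta> in at_right 0. c * fst v + (\<phi> (x + \<theta> *\<^sub>R snd v) - \<phi> x) /\<^sub>R \<theta> =
          (?\<Phi> ((s, x) + \<theta> *\<^sub>R v) - ?\<Phi> (s, x)) /\<^sub>R \<theta>"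
        by eventually_elim (rule q[symmetric])
    qed
    then show ?thesis by (simp add: blinfun.add_left blinfun.scaleR_left)
  qed
  have 2: "((\<lambda>(\<theta>, w). (?\<Phi> ((s, x) + \<theta> *\<^sub>R w) - ?\<Phi> (s, x)) /\<^sub>R \<theta>) \<longlongrightarrow> (c *\<^sub>R fst_blinfun + (L o\<^sub>L snd_blinfun)) v)
        (at_right 0 \<times>\<^sub>F nhds v)" for v
  proof -
    have w: "filterlim (\<lambda>p. snd (snd p)) (nhds (snd v)) (at_right (0::real) \<times>\<^sub>F nhds v)"
      by (rule filterlim_compose[OF _ filterlim_snd]) (rule tendsto_snd[OF filterlim_ident])
    have fw: "filterlim (\<lambda>p. fst (snd p)) (nhds (fst v)) (at_right (0::real) \<times>\<^sub>F nhds v)"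
      by (rule filterlim_compose[OF _ filterlim_snd]) (rule tendsto_fst[OF filterlim_ident])
    have "filterlim (\<lambda>p. (fst p, snd (snd p))) (at_right 0 \<times>\<^sub>F nhds (snd v)) (at_right (0::real) \<times>\<^sub>F nhds v)"
      by (rule filterlim_Pair[OF filterlim_fst w])
    from filterlim_compose[OF _ this, of "\<lambda>(\<theta>, w). (\<phi> (x + \<theta> *\<^sub>R w) - \<phi> x) /\<^sub>R \<theta>" "nhds (L (snd v))"] assms
    have "((\<lambda>p. (\<phi> (x + fst p *\<^sub>R snd (snd p)) - \<phi> x) /\<^sub>R fst p) \<longlongrightarrow> L (snd v)) (at_right 0 \<times>\<^sub>F nhds v)"
      by (simp add: has_hadamard_differential_def)
    then have "((\<lambda>p. c * fst (snd p) + (\<phi> (x + fst p *\<^sub>R snd (snd p)) - \<phi> x) /\<^sub>R fst p) \<longlongrightarrow> c * fst v + L (snd v)) (at_right 0 \<times>\<^sub>F nhds v)"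
      by (intro tendsto_intros fw)
    then have "((\<lambda>(\<theta>, w). (?\<Phi> ((s, x) + \<theta> *\<^sub>R w) - ?\<Phi> (s, x)) /\<^sub>R \<theta>) \<longlongrightarrow> c * fst v + L (snd v)) (at_right 0 \<times>\<^sub>F nhds v)"
    proof (rule Lim_transform_eventually)
      have "\<forall>\<^sub>F p in at_right (0::real) \<times>\<^sub>F nhds v. fst p \<noteq> 0"
        using filterlim_fst[of "at_right (0::real)" "nhds v"] ev0 unfolding filterlim_iff by blast
      then show "\<forall>\<^sub>F p in at_right 0 \<times>\<^sub>F nhds v. c * fst (snd p) + (\<phi> (x + fst p *\<^sub>R snd (snd p)) - \<phi> x) /\<^sub>R fst p =
        (\<lambda>(\<theta>, w). (?\<Phi> ((s, x) + \<theta> *\<^sub>R w) - ?\<Phi> (s, x)) /\<^sub>R \<theta>) p"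
        by eventually_elim (unfold case_prod_unfold, rule q[symmetric])
    qed
    then show ?thesis by (simp add: blinfun.add_left blinfun.scaleR_left)
  qed
  show ?thesis unfolding has_hadamard_differential_def has_gateaux_differential_def using 1 2 by blast
qed

section \<open>The Bolza problem\<close>

lemma continuous_map_compose2:
  assumes "continuous_map X euclidean a" "continuous_map X euclidean b"
    "continuous_on UNIV (\<lambda>p. \<phi> (fst p) (snd p))"
  shows "continuous_map X euclidean (\<lambda>x. \<phi> (a x) (b x))"
proof -
  have "continuous_map X euclidean (\<lambda>x. (a x, b x))"
    using continuous_map_pairedI[OF assms(1,2)] by (simp add: euclidean_product_topology)
  from continuous_map_compose[OF this, of euclidean "\<lambda>p. \<phi> (fst p) (snd p)"] assms(3)
  show ?thesis by (simp add: o_def)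
qed

definition inl_blinfun :: "'a::real_normed_vector \<Rightarrow>\<^sub>L ('a \<times> 'b::real_normed_vector)" where
  "inl_blinfun = Blinfun (\<lambda>x. (x, 0))"

definition inr_blinfun :: "'b::real_normed_vector \<Rightarrow>\<^sub>L ('a::real_normed_vector \<times> 'b)" where
  "inr_blinfun = Blinfun (\<lambda>x. (0, x))"

lemma inl_blinfun_apply [simp]: "blinfun_apply inl_blinfun x = (x, 0)"
  unfolding inl_blinfun_def
  by (subst bounded_linear_Blinfun_apply) (auto intro!: bounded_linear_intros bounded_linear_Pair)

lemma inr_blinfun_apply [simp]: "blinfun_apply inr_blinfun x = (0, x)"
  unfolding inr_blinfun_def
  by (subst bounded_linear_Blinfun_apply) (auto intro!: bounded_linear_intros bounded_linear_Pair)

locale bolza =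
  fixes T :: real and \<Omega> :: "'e::banach set" and \<xi>\<^sub>0 :: 'e and U :: "'u topology" and m q :: nat
    and f :: "real \<Rightarrow> 'e \<Rightarrow> 'u \<Rightarrow> 'e" and f\<^sub>0 :: "real \<Rightarrow> 'e \<Rightarrow> 'u \<Rightarrow> real"
    and g h :: "nat \<Rightarrow> 'e \<Rightarrow> real" and x\<^sub>0 :: "real \<Rightarrow> 'e" and u\<^sub>0 :: "real \<Rightarrow> 'u"
  assumes T: "T > 0" and \<Omega>: "open \<Omega>"
    and sol: "bolza_solution T \<Omega> \<xi>\<^sub>0 U m q f\<^sub>0 f g h x\<^sub>0 u\<^sub>0"
    and reg0: "integrand_regular T \<Omega> U x\<^sub>0 f\<^sub>0"
    and reg1: "integrand_regular T \<Omega> U x\<^sub>0 f"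
    and ter: "terminal_regular \<Omega> m q g h (x\<^sub>0 T)"
begin

lemma x0_PC1: "x\<^sub>0 \<in> PC1 T \<Omega>" and u0_NPC0R: "u\<^sub>0 \<in> NPC0R T U"
  and x0_dyn: "t \<in> {0..T} \<Longrightarrow> ext_deriv T x\<^sub>0 t = f t (x\<^sub>0 t) (u\<^sub>0 t)" and x00: "x\<^sub>0 0 = \<xi>\<^sub>0"
  and g_feasible: "\<alpha> \<in> {1..m} \<Longrightarrow> 0 \<le> g \<alpha> (x\<^sub>0 T)" and h_feasible: "\<beta> \<in> {1..q} \<Longrightarrow> h \<beta> (x\<^sub>0 T) = 0"
  using sol by (auto simp: bolza_solution_def admissible_def)

lemma optimal: "admissible T \<Omega> \<xi>\<^sub>0 U m q f g h x u \<Longrightarrow> bolza_cost T f\<^sub>0 g x u \<le> bolza_cost T f\<^sub>0 g x\<^sub>0 u\<^sub>0"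
  using sol by (simp add: bolza_solution_def)

lemma x0_continuous: "continuous_on {0..T} x\<^sub>0" and x0_in: "t \<in> {0..T} \<Longrightarrow> x\<^sub>0 t \<in> \<Omega>"
  using x0_PC1 by (auto simp: PC1_def)

lemma u0_in: "t \<in> {0..T} \<Longrightarrow> u\<^sub>0 t \<in> topspace U"
  using u0_NPC0R by (auto simp: NPC0R_iff[OF T])

definition D0 :: "real \<Rightarrow> 'u \<Rightarrow> 'e \<Rightarrow>\<^sub>L real" where "D0 t \<zeta> = D_F (\<lambda>y. f\<^sub>0 t y \<zeta>) (x\<^sub>0 t)"
definition D1 :: "real \<Rightarrow> 'u \<Rightarrow> 'e \<Rightarrow>\<^sub>L 'e" where "D1 t \<zeta> = D_F (\<lambda>y. f t y \<zeta>) (x\<^sub>0 t)"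

lemma D0_derivative: "t \<in> {0..T} \<Longrightarrow> \<zeta> \<in> topspace U \<Longrightarrow> ((\<lambda>y. f\<^sub>0 t y \<zeta>) has_derivative blinfun_apply (D0 t \<zeta>)) (at (x\<^sub>0 t))"
  unfolding D0_def by (rule has_derivative_D_F[OF integrand_regularD(3)[OF reg0]])

lemma D1_derivative: "t \<in> {0..T} \<Longrightarrow> \<zeta> \<in> topspace U \<Longrightarrow> ((\<lambda>y. f t y \<zeta>) has_derivative blinfun_apply (D1 t \<zeta>)) (at (x\<^sub>0 t))"
  unfolding D1_def by (rule has_derivative_D_F[OF integrand_regularD(3)[OF reg1]])

lemma D0_continuous: "continuous_map (prod_topology (top_of_set {0..T}) U) euclidean (\<lambda>(t, \<zeta>). D0 t \<zeta>)"
  unfolding D0_def by (rule integrand_regularD(4)[OF reg0])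

lemma D1_continuous: "continuous_map (prod_topology (top_of_set {0..T}) U) euclidean (\<lambda>(t, \<zeta>). D1 t \<zeta>)"
  unfolding D1_def by (rule integrand_regularD(4)[OF reg1])

lemma x0_image: "x\<^sub>0 ` {0..T} \<subseteq> \<Omega>" using x0_in by blast

sublocale state: controlled_process T \<Omega> U f D1 x\<^sub>0 u\<^sub>0
proof unfold_locales
  show "continuous_map (prod_topology (top_of_set {0..T}) (prod_topology (top_of_set \<Omega>) U)) euclidean (\<lambda>(t, \<xi>, \<zeta>). f t \<xi> \<zeta>)"
    by (rule integrand_regularD(1)[OF reg1])
  show "compactin U M \<Longrightarrow> \<exists>r>0. \<exists>L>0. \<forall>t\<in>{0..T}. cball (x\<^sub>0 t) r \<subseteq> \<Omega> \<and>
       (\<forall>\<zeta>\<in>M. \<forall>x\<in>cball (x\<^sub>0 t) r. \<forall>y\<in>cball (x\<^sub>0 t) r. norm (f t x \<zeta> - f t y \<zeta>) \<le> L * norm (x - y))" for M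
    by (rule integrand_tube_lipschitz[OF reg1 \<Omega> x0_continuous x0_image])
qed (use T D1_derivative D1_continuous x0_PC1 u0_NPC0R x0_dyn in auto)

section \<open>Augmentation by the accumulated cost\<close>

lemma f0_NPC0R:
  "continuous_on {0..T} x \<Longrightarrow> (\<And>t. t \<in> {0..T} \<Longrightarrow> x t \<in> \<Omega>) \<Longrightarrow> u \<in> NPC0R T U \<Longrightarrow> (\<lambda>t. f\<^sub>0 t (x t) (u t)) \<in> NPC0R T euclidean"
  by (rule integrand_path_NPC0R[OF T integrand_regularD(1)[OF reg0]])

definition aug_dyn :: "real \<Rightarrow> real \<times> 'e \<Rightarrow> 'u \<Rightarrow> real \<times> 'e" where
  "aug_dyn t y \<zeta> = (f\<^sub>0 t (snd y) \<zeta>, f t (snd y) \<zeta>)"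

definition aug_D :: "real \<Rightarrow> 'u \<Rightarrow> (real \<times> 'e) \<Rightarrow>\<^sub>L (real \<times> 'e)" where
  "aug_D t \<zeta> = (inl_blinfun o\<^sub>L (D0 t \<zeta> o\<^sub>L snd_blinfun)) + (inr_blinfun o\<^sub>L (D1 t \<zeta> o\<^sub>L snd_blinfun))"

definition aug_x0 :: "real \<Rightarrow> real \<times> 'e" where
  "aug_x0 t = (integral {0..t} (\<lambda>s. f\<^sub>0 s (x\<^sub>0 s) (u\<^sub>0 s)), x\<^sub>0 t)"

lemma snd_aug_x0 [simp]: "snd (aug_x0 t) = x\<^sub>0 t"
  by (simp add: aug_x0_def)

lemma aug_D_apply: "aug_D t \<zeta> v = (D0 t \<zeta> (snd v), D1 t \<zeta> (snd v))"
  by (simp add: aug_D_def blinfun.add_left)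

lemma aug_dyn_NPC0R:
  assumes "continuous_on {0..T} x" "\<And>t. t \<in> {0..T} \<Longrightarrow> x t \<in> \<Omega>" "u \<in> NPC0R T U"
  shows "(\<lambda>t. (f\<^sub>0 t (x t) (u t), f t (x t) (u t))) \<in> NPC0R T euclidean"
  by (rule NPC0R_compose2[OF T f0_NPC0R[OF assms] state.f_NPC0R[OF assms]]) (auto intro!: continuous_intros)

lemma aug_integral:
  assumes "continuous_on {0..T} x" "\<And>t. t \<in> {0..T} \<Longrightarrow> x t \<in> \<Omega>" "u \<in> NPC0R T U" and t: "t \<in> {0..T}"
  shows "integral {0..t} (\<lambda>s. (f\<^sub>0 s (x s) (u s), f s (x s) (u s))) =
    (integral {0..t} (\<lambda>s. f\<^sub>0 s (x s) (u s)), integral {0..t} (\<lambda>s. f s (x s) (u s)))"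
proof -
  have "(\<lambda>s. (f\<^sub>0 s (x s) (u s), f s (x s) (u s))) integrable_on {0..T}"
    by (rule NPC0R_integrable[OF T aug_dyn_NPC0R]) (rule assms, assumption?)+
  then have i: "(\<lambda>s. (f\<^sub>0 s (x s) (u s), f s (x s) (u s))) integrable_on {0..t}"
    by (rule integrable_subinterval_real) (use t in auto)
  show ?thesis
    using integral_linear[OF i bounded_linear_fst] integral_linear[OF i bounded_linear_snd]
    by (intro prod_eqI) (simp_all add: o_def)
qed

lemma aug_x0_integral:
  assumes "t \<in> {0..T}"
  shows "aug_x0 t = aug_x0 0 + integral {0..t} (\<lambda>s. (f\<^sub>0 s (x\<^sub>0 s) (u\<^sub>0 s), f s (x\<^sub>0 s) (u\<^sub>0 s)))"
proof -
  have "integral {0..t} (\<lambda>s. (f\<^sub>0 s (x\<^sub>0 s) (u\<^sub>0 s), f s (x\<^sub>0 s) (u\<^sub>0 s))) =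
    (integral {0..t} (\<lambda>s. f\<^sub>0 s (x\<^sub>0 s) (u\<^sub>0 s)), integral {0..t} (\<lambda>s. f s (x\<^sub>0 s) (u\<^sub>0 s)))"
    by (rule aug_integral[OF x0_continuous _ u0_NPC0R assms]) (rule x0_in)
  then show ?thesis using state.x0_integral[OF assms] by (simp add: aug_x0_def)
qed

sublocale aug: controlled_process T "UNIV \<times> \<Omega>" U aug_dyn aug_D aug_x0 u\<^sub>0
proof unfold_locales
  have pr: "continuous_map (prod_topology (top_of_set {0..T}) (prod_topology (top_of_set ((UNIV :: real set) \<times> \<Omega>)) U))
     (prod_topology (top_of_set {0..T}) (prod_topology (top_of_set \<Omega>) U)) (\<lambda>p. (fst p, snd (fst (snd p)), snd (snd p)))"
  proof (intro continuous_map_pairedI continuous_map_fst)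
    have s: "continuous_map (top_of_set ((UNIV :: real set) \<times> \<Omega>)) (top_of_set \<Omega>) snd"
      by (auto intro!: continuous_intros)
    show "continuous_map (prod_topology (top_of_set {0..T}) (prod_topology (top_of_set ((UNIV :: real set) \<times> \<Omega>)) U)) (top_of_set \<Omega>) (\<lambda>p. snd (fst (snd p)))"
      using continuous_map_compose[OF continuous_map_compose[OF continuous_map_snd continuous_map_fst] s] by (simp add: o_def)
    show "continuous_map (prod_topology (top_of_set {0..T}) (prod_topology (top_of_set ((UNIV :: real set) \<times> \<Omega>)) U)) U (\<lambda>p. snd (snd p))"
      using continuous_map_compose[OF continuous_map_snd continuous_map_snd] by (simp add: o_def)
  qed
  have "continuous_map (prod_topology (top_of_set {0..T}) (prod_topology (top_of_set ((UNIV :: real set) \<times> \<Omega>)) U)) euclidean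
     (\<lambda>p. (f\<^sub>0 (fst p) (snd (fst (snd p))) (snd (snd p)), f (fst p) (snd (fst (snd p))) (snd (snd p))))"
    by (rule continuous_map_compose2[where \<phi> = Pair])
      (use continuous_map_compose[OF pr integrand_regularD(1)[OF reg0]] continuous_map_compose[OF pr integrand_regularD(1)[OF reg1]]
       in \<open>auto simp: o_def intro!: continuous_intros\<close>)
  then show "continuous_map (prod_topology (top_of_set {0..T}) (prod_topology (top_of_set (UNIV \<times> \<Omega>)) U)) euclidean
     (\<lambda>(t, \<xi>, \<zeta>). aug_dyn t \<xi> \<zeta>)" by (simp add: aug_dyn_def case_prod_unfold)
  show "((\<lambda>y. aug_dyn t y \<zeta>) has_derivative blinfun_apply (aug_D t \<zeta>)) (at (aug_x0 t))"
    if "t \<in> {0..T}" "\<zeta> \<in> topspace U" for t \<zeta>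
  proof -
    have s: "(snd has_derivative snd) (at (aug_x0 t))" by (intro derivative_intros has_derivative_ident)
    have eq: "snd (aug_x0 t) = x\<^sub>0 t" by (simp add: aug_x0_def)
    have "((\<lambda>y. (f\<^sub>0 t (snd y) \<zeta>, f t (snd y) \<zeta>)) has_derivative (\<lambda>v. (D0 t \<zeta> (snd v), D1 t \<zeta> (snd v)))) (at (aug_x0 t))"
      by (intro has_derivative_Pair has_derivative_compose[OF s] D0_derivative[OF that, folded eq] D1_derivative[OF that, folded eq])
    then show ?thesis by (simp add: aug_dyn_def[abs_def] aug_D_apply[abs_def])
  qed
  have "continuous_map (prod_topology (top_of_set {0..T}) U) euclidean
    (\<lambda>p. (inl_blinfun o\<^sub>L ((\<lambda>(t, \<zeta>). D0 t \<zeta>) p o\<^sub>L snd_blinfun)) + (inr_blinfun o\<^sub>L ((\<lambda>(t, \<zeta>). D1 t \<zeta>) p o\<^sub>L snd_blinfun)) :: (real \<times> 'e) \<Rightarrow>\<^sub>L (real \<times> 'e))"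
    by (rule continuous_map_compose2[OF D0_continuous D1_continuous, where \<phi> = "\<lambda>a b. (inl_blinfun o\<^sub>L (a o\<^sub>L snd_blinfun)) + (inr_blinfun o\<^sub>L (b o\<^sub>L snd_blinfun))"])
      (intro continuous_intros bounded_bilinear.continuous_on[OF bounded_bilinear_blinfun_compose])
  then show "continuous_map (prod_topology (top_of_set {0..T}) U) euclidean (\<lambda>(t, \<zeta>). aug_D t \<zeta>)"
    by (simp add: aug_D_def case_prod_unfold)
  show "\<exists>r>0. \<exists>L>0. \<forall>t\<in>{0..T}. cball (aug_x0 t) r \<subseteq> UNIV \<times> \<Omega> \<and>
       (\<forall>\<zeta>\<in>M. \<forall>x\<in>cball (aug_x0 t) r. \<forall>y\<in>cball (aug_x0 t) r. norm (aug_dyn t x \<zeta> - aug_dyn t y \<zeta>) \<le> L * norm (x - y))"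
    if M: "compactin U M" for M
  proof -
    obtain r0 L0 where r0: "r0 > 0" "L0 > 0" "\<And>t \<zeta> x y. t \<in> {0..T} \<Longrightarrow> \<zeta> \<in> M \<Longrightarrow> x \<in> cball (x\<^sub>0 t) r0 \<Longrightarrow> y \<in> cball (x\<^sub>0 t) r0 \<Longrightarrow>
        norm (f\<^sub>0 t x \<zeta> - f\<^sub>0 t y \<zeta>) \<le> L0 * norm (x - y)"
      using integrand_tube_lipschitz[OF reg0 \<Omega> x0_continuous x0_image M] by meson
    obtain r1 L1 where r1: "r1 > 0" "L1 > 0" "\<And>t. t \<in> {0..T} \<Longrightarrow> cball (x\<^sub>0 t) r1 \<subseteq> \<Omega>"
        "\<And>t \<zeta> x y. t \<in> {0..T} \<Longrightarrow> \<zeta> \<in> M \<Longrightarrow> x \<in> cball (x\<^sub>0 t) r1 \<Longrightarrow> y \<in> cball (x\<^sub>0 t) r1 \<Longrightarrow>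
        norm (f t x \<zeta> - f t y \<zeta>) \<le> L1 * norm (x - y)"
      using integrand_tube_lipschitz[OF reg1 \<Omega> x0_continuous x0_image M] by meson
    \<comment> \<open>Projecting to the state does not increase distances, so balls of the product
      space land in balls of the same radius in E.\<close>
    have sb: "snd x \<in> cball (x\<^sub>0 t) r0" "snd x \<in> cball (x\<^sub>0 t) r1" if "x \<in> cball (aug_x0 t) (min r0 r1)" for x t
      using that order_trans[OF dist_snd_le[of "aug_x0 t" x]] by (auto simp: aug_x0_def)
    show ?thesis
    proof (rule exI[of _ "min r0 r1"], rule conjI[rotated], rule exI[of _ "L0 + L1"], intro conjI ballI)
      show "cball (aug_x0 t) (min r0 r1) \<subseteq> UNIV \<times> \<Omega>" if t: "t \<in> {0..T}" for t
      proof
        fix x assume "x \<in> cball (aug_x0 t) (min r0 r1)"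
        then have "snd x \<in> \<Omega>" using sb(2) r1(3)[OF t] by blast
        then show "x \<in> UNIV \<times> \<Omega>" by (simp add: mem_Times_iff)
      qed
      fix t \<zeta> x y assume t: "t \<in> {0..T}" and \<zeta>: "\<zeta> \<in> M" and x: "x \<in> cball (aug_x0 t) (min r0 r1)" and y: "y \<in> cball (aug_x0 t) (min r0 r1)"
      have "norm (aug_dyn t x \<zeta> - aug_dyn t y \<zeta>) \<le> norm (f\<^sub>0 t (snd x) \<zeta> - f\<^sub>0 t (snd y) \<zeta>) + norm (f t (snd x) \<zeta> - f t (snd y) \<zeta>)"
        unfolding aug_dyn_def diff_Pair by (rule norm_Pair_le)
      also have "\<dots> \<le> L0 * norm (snd x - snd y) + L1 * norm (snd x - snd y)"
        by (intro add_mono r0(3)[OF t \<zeta>] r1(4)[OF t \<zeta>] sb x y)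
      also have "\<dots> = (L0 + L1) * norm (snd (x - y))" by (simp add: algebra_simps)
      also have "\<dots> \<le> (L0 + L1) * norm (x - y)" 
      proof (rule mult_left_mono)
        show "norm (snd (x - y)) \<le> norm (x - y)"
          using norm_snd_le[of "snd (x - y)" "fst (x - y)"] by (simp only: prod.collapse)
      qed (use r0(2) r1(2) in simp)
      finally show "norm (aug_dyn t x \<zeta> - aug_dyn t y \<zeta>) \<le> (L0 + L1) * norm (x - y)" .
    qed (use r0 r1 in auto)
  qed
  have reg: "(\<lambda>t. (f\<^sub>0 t (x\<^sub>0 t) (u\<^sub>0 t), f t (x\<^sub>0 t) (u\<^sub>0 t))) \<in> NPC0R T euclidean"
    by (rule aug_dyn_NPC0R[OF x0_continuous _ u0_NPC0R]) (rule x0_in)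
  show "aug_x0 \<in> PC1 T (UNIV \<times> \<Omega>)"
  proof (rule integral_NPC0R_PC1[OF T reg aug_x0_integral])
    show "aug_x0 ` {0..T} \<subseteq> UNIV \<times> \<Omega>" using x0_in by (auto simp: aug_x0_def)
  qed
  show "ext_deriv T aug_x0 t = aug_dyn t (aug_x0 t) (u\<^sub>0 t)" if "t \<in> {0..T}" for t
    using integral_NPC0R_ext_deriv[OF T reg aug_x0_integral that] by (simp add: aug_dyn_def)
qed (use T u0_NPC0R in auto)

end

text \<open>The integral equation for \<open>Y\<close> is recorded beside its derivative: bounded
  linear maps pass under the integral, and a costate in integral form has its extended derivative at
  every time, nodes included.\<close>

locale bolza_linearised = bolza +
  fixes X Y :: "real \<Rightarrow> (real \<times> 'a) \<Rightarrow>\<^sub>L (real \<times> 'a)" and F :: "real set"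
  assumes lin: "linearised_process T (UNIV \<times> \<Omega>) U aug_dyn aug_D aug_x0 u\<^sub>0 X Y F"
    and Y_integral: "\<And>t. t \<in> {0..T} \<Longrightarrow> Y t = Y 0 + integral {0..t} (\<lambda>s. - (Y s o\<^sub>L aug_D s (u\<^sub>0 s)))"
begin

sublocale aug: linearised_process T "UNIV \<times> \<Omega>" U aug_dyn aug_D aug_x0 u\<^sub>0 X Y F
  by (rule lin)

text \<open>The constraints are numbered with the equalities \<open>h 1, \<dots>, h q\<close> at \<open>0, \<dots>, q - 1\<close>,
  the cost at \<open>q\<close> and the inequalities \<open>g 1, \<dots>, g m\<close> at \<open>q + 1, \<dots>, q + m\<close>.\<close>

definition ter :: "nat \<Rightarrow> 'a \<Rightarrow> real" where
  "ter k = (if k < q then h (Suc k) else g (k - q))"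

definition ter_D :: "nat \<Rightarrow> 'a \<Rightarrow>\<^sub>L real" where
  "ter_D k = D_H (ter k) (x\<^sub>0 T)"

text \<open>At index q this is the Bolza cost read off the augmented endpoint, accumulated running
  cost plus \<open>g 0\<close>; the other functions ignore the cost variable.\<close>

definition aug_ter :: "nat \<Rightarrow> real \<times> 'a \<Rightarrow> real" where
  "aug_ter k y = (if k = q then 1 else 0) * fst y + ter k (snd y)"

definition aug_ter_D :: "nat \<Rightarrow> (real \<times> 'a) \<Rightarrow>\<^sub>L real" where
  "aug_ter_D k = (if k = q then 1 else 0) *\<^sub>R fst_blinfun + (ter_D k o\<^sub>L snd_blinfun)"

definition multipliers :: "(nat \<Rightarrow> real) set" where
  "multipliers = {c. (\<exists>k<q + m + 1. c k \<noteq> 0) \<and> (\<forall>k. q \<le> k \<longrightarrow> k < q + m + 1 \<longrightarrow> 0 \<le> c k) \<and>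
     (\<forall>k. q < k \<longrightarrow> k < q + m + 1 \<longrightarrow> c k * aug_ter k (aug_x0 T) = 0) \<and>
     (\<forall>d\<in>{0..<T} \<times> topspace U. (\<Sum>k<q + m + 1. c k * aug_ter_D k (X T (aug.needle_jump (snd d) (fst d)))) \<le> 0)}"

lemma multipliers_scale:
  assumes c: "c \<in> multipliers" and s: "s > 0" shows "(\<lambda>k. s * c k) \<in> multipliers"
proof -
  have "(\<Sum>k<q + m + 1. s * c k * aug_ter_D k v) = s * (\<Sum>k<q + m + 1. c k * aug_ter_D k v)" for v
    by (simp add: sum_distrib_left mult.assoc distrib_left)
  then show ?thesis using c s unfolding multipliers_def by (auto simp: mult_nonneg_nonpos less_imp_le)
qed

lemma ter_hadamard: "k < q + m + 1 \<Longrightarrow> has_hadamard_differential (ter k) (ter_D k) (x\<^sub>0 T)"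
  unfolding ter_D_def by (rule has_hadamard_differential_D_H) (use ter in \<open>auto simp: terminal_regular_def ter_def\<close>)

lemma aug_trajectory:
  assumes y: "aug.trajectory y u"
  shows "state.trajectory (\<lambda>t. snd (y t)) u"
    and "fst (y T) = integral {0..T} (\<lambda>s. f\<^sub>0 s (snd (y s)) (u s))"
proof -
  have yc: "continuous_on {0..T} y" and yO: "\<And>t. t \<in> {0..T} \<Longrightarrow> snd (y t) \<in> \<Omega>" and u: "u \<in> NPC0R T U"
    and ye: "\<And>t. t \<in> {0..T} \<Longrightarrow> y t = aug_x0 0 + integral {0..t} (\<lambda>s. (f\<^sub>0 s (snd (y s)) (u s), f s (snd (y s)) (u s)))"
    using y unfolding aug.trajectory_def by (auto simp: mem_Times_iff aug_dyn_def)
  have sc: "continuous_on {0..T} (\<lambda>t. snd (y t))" by (intro continuous_intros yc)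
  have yi: "y t = (integral {0..t} (\<lambda>s. f\<^sub>0 s (snd (y s)) (u s)), x\<^sub>0 0 + integral {0..t} (\<lambda>s. f s (snd (y s)) (u s)))"
    if t: "t \<in> {0..T}" for t
  proof -
    have "integral {0..t} (\<lambda>s. (f\<^sub>0 s (snd (y s)) (u s), f s (snd (y s)) (u s))) =
      (integral {0..t} (\<lambda>s. f\<^sub>0 s (snd (y s)) (u s)), integral {0..t} (\<lambda>s. f s (snd (y s)) (u s)))"
      by (rule aug_integral[OF sc _ u t]) (rule yO)
    then show ?thesis using ye[OF t] by (simp add: aug_x0_def)
  qed
  show "state.trajectory (\<lambda>t. snd (y t)) u"
    unfolding state.trajectory_def using sc yO u arg_cong[OF yi, of _ snd] by simp
  show "fst (y T) = integral {0..T} (\<lambda>s. f\<^sub>0 s (snd (y s)) (u s))"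
    using arg_cong[OF yi, of T fst] T by simp
qed

text \<open>The state component of a feasible augmented trajectory is admissible for the Bolza
  problem, and its cost component is the running cost. Optimality of the process is thus a statement
  about reachable endpoints, the form the multiplier rule takes.\<close>

lemma aug_ter_optimal:
  assumes y: "y \<in> aug.reachable" and eq: "\<And>k. k < q \<Longrightarrow> aug_ter k y = 0"
    and ineq: "\<And>k. q < k \<Longrightarrow> k < q + m + 1 \<Longrightarrow> 0 \<le> aug_ter k y"
  shows "aug_ter q y \<le> aug_ter q (aug_x0 T)"
proof -
  obtain w u where w: "aug.trajectory w u" "y = w T" using y by (auto simp: aug.reachable_def)
  let ?x = "\<lambda>t. snd (w t)"
  note x = aug_trajectory(1)[OF w(1)]
  have "0 \<le> g \<alpha> (?x T)" if "\<alpha> \<in> {1..m}" for \<alpha>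
    using ineq[of "q + \<alpha>"] that w by (auto simp: aug_ter_def ter_def)
  moreover have "h \<beta> (?x T) = 0" if "\<beta> \<in> {1..q}" for \<beta>
    using eq[of "\<beta> - 1"] that w by (auto simp: aug_ter_def ter_def)
  ultimately have "admissible T \<Omega> \<xi>\<^sub>0 U m q f g h ?x u"
    unfolding admissible_def using state.trajectory_PC1[OF x] x x00 by (simp add: state.trajectory_def)
  from optimal[OF this] show ?thesis
    using aug_trajectory(2)[OF w(1)] w(2) by (simp add: bolza_cost_def aug_ter_def ter_def aug_x0_def)
qed

lemma multipliers_nonempty: "multipliers \<noteq> {}"
proof -
  have x0T: "aug_x0 T = (fst (aug_x0 T), x\<^sub>0 T)" by (simp add: aug_x0_def)
  have had: "has_hadamard_differential (aug_ter k) (aug_ter_D k) (aug_x0 T)" if "k < q + m + 1" for k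
    unfolding aug_ter_def[abs_def] aug_ter_D_def
    by (subst x0T) (rule has_hadamard_differential_augmented[OF ter_hadamard[OF that]])
  have cont: "\<exists>S. open S \<and> aug_x0 T \<in> S \<and> continuous_on S (aug_ter k)" if k: "k < q" for k
  proof -
    have *: "\<forall>\<beta> \<in> {1..q}. \<exists>N. open N \<and> x\<^sub>0 T \<in> N \<and> N \<subseteq> \<Omega> \<and> continuous_on N (h \<beta>)"
      using ter by (simp only: terminal_regular_def) fast
    have "Suc k \<in> {1..q}" using k by simp
    from bspec[OF * this] obtain N where N: "open N" "x\<^sub>0 T \<in> N" "continuous_on N (h (Suc k))" by (elim exE conjE)
    have "continuous_on (UNIV \<times> N) (\<lambda>y :: real \<times> 'a. h (Suc k) (snd y))"
      by (rule continuous_on_compose2[OF N(3)]) (auto intro: continuous_intros)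
    then have "continuous_on (UNIV \<times> N) (aug_ter k)" using k by (simp add: aug_ter_def[abs_def] ter_def)
    moreover have "open ((UNIV :: real set) \<times> N)" "aug_x0 T \<in> UNIV \<times> N" using N by (auto intro: open_Times simp: aug_x0_def)
    ultimately show ?thesis by (intro exI[of _ "UNIV \<times> N"] conjI)
  qed
  obtain c where c: "\<exists>k<q + m + 1. c k \<noteq> 0" "\<And>k. q \<le> k \<Longrightarrow> k < q + m + 1 \<Longrightarrow> 0 \<le> c k"
    "\<And>k. q < k \<Longrightarrow> k < q + m + 1 \<Longrightarrow> c k * aug_ter k (aug_x0 T) = 0"
    "\<And>d. d \<in> {0..<T} \<times> topspace U \<Longrightarrow> (\<Sum>k<q + m + 1. c k * aug_ter_D k (X T (aug.needle_jump (snd d) (fst d)))) \<le> 0"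
  proof (rule multiplier_rule[of "q + m + 1" aug_ter aug_ter_D "aug_x0 T" q aug.reachable "{0..<T} \<times> topspace U"
        "\<lambda>d. X T (aug.needle_jump (snd d) (fst d))"])
    show "aug_ter k (aug_x0 T) = 0" if "k < q" for k
      using h_feasible[of "Suc k"] that by (simp add: aug_ter_def ter_def aug_x0_def)
    show "0 \<le> aug_ter k (aug_x0 T)" if "q < k" "k < q + m + 1" for k
    proof -
      have "k - q \<in> {1..m}" using that by auto
      from g_feasible[OF this] show ?thesis using that by (simp add: aug_ter_def ter_def)
    qed
  next
    fix N and d :: "nat \<Rightarrow> real \<times> 'b"
    assume "\<forall>i<N. d i \<in> {0..<T} \<times> topspace U"
    then show "\<exists>\<epsilon>>0. \<exists>X'. (\<forall>a. (\<forall>i<N. 0 \<le> a i \<and> a i \<le> \<epsilon>) \<longrightarrow> X' a \<in> aug.reachable) \<and>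
       (\<forall>A a. (\<forall>j. \<forall>i<N. 0 \<le> A j i \<and> A j i \<le> \<epsilon>) \<and> (\<forall>i<N. 0 \<le> a i \<and> a i \<le> \<epsilon>) \<and>
          (\<forall>i<N. (\<lambda>j::nat. A j i) \<longlonglongrightarrow> a i) \<longrightarrow> (\<lambda>j. X' (A j)) \<longlonglongrightarrow> X' a) \<and>
       (\<forall>s B b. (\<forall>j. s j > 0) \<and> s \<longlonglongrightarrow> 0 \<and> (\<forall>j. \<forall>i<N. 0 \<le> B j i) \<and> (\<forall>i<N. (\<lambda>j::nat. B j i) \<longlonglongrightarrow> b i) \<longrightarrow>
          (\<lambda>j. (X' (\<lambda>i. s j * B j i) - aug_x0 T) /\<^sub>R s j) \<longlonglongrightarrow> (\<Sum>i<N. b i *\<^sub>R X T (aug.needle_jump (snd (d i)) (fst (d i)))))"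
      by (rule aug.needle_variations)
  qed (use had cont aug_ter_optimal in auto)
  then have "c \<in> multipliers" unfolding multipliers_def by blast
  then show ?thesis by blast
qed

section \<open>The costate of a multiplier vector\<close>

context
  fixes c assumes c: "c \<in> multipliers"
begin

text \<open>The weighted terminal differential, transported back from T to t by the resolvent X(T)
  Y(t) of the linearised augmented equation.\<close>

definition aug_costate :: "real \<Rightarrow> (real \<times> 'a) \<Rightarrow>\<^sub>L real" where
  "aug_costate t = (\<Sum>k<q + m + 1. c k *\<^sub>R aug_ter_D k) o\<^sub>L (X T o\<^sub>L Y t)"

definition costate :: "real \<Rightarrow> 'a \<Rightarrow>\<^sub>L real" where
  "costate t = aug_costate t o\<^sub>L inr_blinfun"

lemma Y_integrable: "t \<in> {0..T} \<Longrightarrow> (\<lambda>s. - (Y s o\<^sub>L aug_D s (u\<^sub>0 s))) integrable_on {0..t}"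
proof -
  assume t: "t \<in> {0..T}"
  have 1: "(\<lambda>s. Y s o\<^sub>L aug_D s (u\<^sub>0 s)) \<in> NPC0R T euclidean"
    by (rule NPC0R_blinfun_compose[OF T NPC0R_continuous_on[OF T aug.Yc] aug.A0_NPC0R])
  have "(\<lambda>s. Y s o\<^sub>L aug_D s (u\<^sub>0 s)) integrable_on {0..t}"
    by (rule integrable_subinterval_real[OF NPC0R_integrable[OF T 1]]) (use t in auto)
  then show ?thesis by (rule integrable_neg)
qed

text \<open>The component of the augmented costate along the cost variable is constant because the
  dynamics does not depend on that variable.\<close>

lemma aug_costate_split:
  assumes t: "t \<in> {0..T}" shows "aug_costate t (r, e) = c q * r + costate t e"
proof -
  let ?Q = "(\<Sum>k<q + m + 1. c k *\<^sub>R aug_ter_D k) o\<^sub>L X T"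
  let ?\<Phi> = "\<lambda>Z :: (real \<times> 'a) \<Rightarrow>\<^sub>L (real \<times> 'a). ?Q (Z (1, 0))"
  have bl: "bounded_linear ?\<Phi>" by (intro bounded_linear_intros)
  have "aug_D s \<zeta> (1, 0) = 0" for s \<zeta> by (simp add: aug_D_apply zero_prod_def)
  then have z: "?\<Phi> (- (Y s o\<^sub>L aug_D s (u\<^sub>0 s))) = 0" for s
    by (simp add: blinfun.minus_left blinfun.minus_right)
  have const: "?\<Phi> (Y t) = ?\<Phi> (Y 0)" if t: "t \<in> {0..T}" for t
  proof -
    have 0: "?\<Phi> (integral {0..t} (\<lambda>s. - (Y s o\<^sub>L aug_D s (u\<^sub>0 s)))) = 0"
      using integral_linear[OF Y_integrable[OF t] bl] z by (simp add: o_def)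
    have "?\<Phi> (Y t) = ?\<Phi> (Y 0 + integral {0..t} (\<lambda>s. - (Y s o\<^sub>L aug_D s (u\<^sub>0 s))))"
      by (simp only: Y_integral[OF t, symmetric])
    also have "\<dots> = ?\<Phi> (Y 0) + ?\<Phi> (integral {0..t} (\<lambda>s. - (Y s o\<^sub>L aug_D s (u\<^sub>0 s))))"
      by (rule linear_add[OF bounded_linear.linear[OF bl]])
    finally show ?thesis by (simp only: 0 add_0_right)
  qed
  have TT: "T \<in> {0..T}" using T by simp
  have XYv: "X T (Y T v) = v" for v
    using arg_cong[OF aug.XY[OF TT], of "\<lambda>L. blinfun_apply L v"] by simp
  have "aug_costate t (1, 0) = ?\<Phi> (Y t)" by (simp only: aug_costate_def blinfun_apply_blinfun_compose)
  also have "\<dots> = ?\<Phi> (Y T)" by (rule trans[OF const[OF t] const[OF TT, symmetric]])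
  also have "\<dots> = (\<Sum>k<q + m + 1. c k *\<^sub>R aug_ter_D k) (1, 0)" by (simp only: blinfun_apply_blinfun_compose XYv)
  \<comment> \<open>Only the terminal functional with index q depends on the cost variable, and it
    does so with coefficient 1.\<close>
  also have "\<dots> = (\<Sum>k<q + m + 1. if k = q then c q else 0)"
    unfolding blinfun.sum_left by (intro sum.cong) (auto simp: blinfun.scaleR_left aug_ter_D_def blinfun.add_left)
  also have "\<dots> = c q" by simp
  finally have 1: "aug_costate t (1, 0) = c q" .
  have "(r, e) = r *\<^sub>R (1, 0) + (0, e)" by simp
  then have "aug_costate t (r, e) = r * aug_costate t (1, 0) + aug_costate t (0, e)"
    by (metis blinfun.add_right blinfun.scaleR_right real_scaleR_def)
  then show ?thesis using 1 by (simp add: costate_def)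
qed

text \<open>Along the reference process this is minus the state differential of the Hamiltonian with
  multiplier \<open>c q\<close>, as \<open>D_F_hamiltonian\<close> confirms.\<close>

definition costate_rhs :: "real \<Rightarrow> 'a \<Rightarrow>\<^sub>L real" where
  "costate_rhs t = - (c q *\<^sub>R D0 t (u\<^sub>0 t) + (costate t o\<^sub>L D1 t (u\<^sub>0 t)))"

text \<open>The costate is the image of \<open>Y\<close> under one bounded linear map, which is
  applied to the integral equation of \<open>Y\<close>. The constant cost component supplies the
  term with \<open>D0\<close>.\<close>

lemma costate_integral:
  assumes t: "t \<in> {0..T}" shows "costate t = costate 0 + integral {0..t} costate_rhs"
proof -
  let ?Q = "(\<Sum>k<q + m + 1. c k *\<^sub>R aug_ter_D k) o\<^sub>L X T"
  let ?\<Phi> = "\<lambda>Z :: (real \<times> 'a) \<Rightarrow>\<^sub>L (real \<times> 'a). (?Q o\<^sub>L Z) o\<^sub>L inr_blinfun"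
  have bl: "bounded_linear ?\<Phi>"
    by (intro bounded_linear_compose[OF bounded_bilinear.bounded_linear_left[OF bounded_bilinear_blinfun_compose]]
        bounded_bilinear.bounded_linear_right[OF bounded_bilinear_blinfun_compose])
  have cos: "costate s = ?\<Phi> (Y s)" for s
    by (simp add: costate_def aug_costate_def blinfun_compose_assoc)
  have z: "?\<Phi> (- (Y s o\<^sub>L aug_D s (u\<^sub>0 s))) = costate_rhs s" if s: "s \<in> {0..t}" for s
  proof (rule blinfun_eqI)
    fix e
    have "s \<in> {0..T}" using s t by auto
    then have "aug_costate s (D0 s (u\<^sub>0 s) e, D1 s (u\<^sub>0 s) e) = - costate_rhs s e"
      by (simp add: aug_costate_split costate_rhs_def blinfun.minus_left blinfun.diff_left blinfun.add_left blinfun.scaleR_left)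
    then show "?\<Phi> (- (Y s o\<^sub>L aug_D s (u\<^sub>0 s))) e = costate_rhs s e"
      by (simp add: aug_costate_def aug_D_apply blinfun.minus_left blinfun.minus_right)
  qed
  have "?\<Phi> (integral {0..t} (\<lambda>s. - (Y s o\<^sub>L aug_D s (u\<^sub>0 s)))) = integral {0..t} (\<lambda>s. ?\<Phi> (- (Y s o\<^sub>L aug_D s (u\<^sub>0 s))))"
    using integral_linear[OF Y_integrable[OF t] bl] by (simp add: o_def)
  also have "\<dots> = integral {0..t} costate_rhs" by (rule integral_cong) (rule z)
  finally show ?thesis
    unfolding cos by (subst Y_integral[OF t]) (simp only: linear_add[OF bounded_linear.linear[OF bl]])
qed

lemma costate_continuous: "continuous_on {0..T} costate"
  unfolding costate_def[abs_def] aug_costate_def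
  by (intro bounded_bilinear.continuous_on[OF bounded_bilinear_blinfun_compose] continuous_intros aug.Yc)

lemma costate_rhs_NPC0R: "costate_rhs \<in> NPC0R T euclidean"
proof -
  have 0: "(\<lambda>t. D0 t (u\<^sub>0 t)) \<in> NPC0R T euclidean" by (rule NPC0R_tcompose[OF T u0_NPC0R D0_continuous])
  have 1: "(\<lambda>t. costate t o\<^sub>L D1 t (u\<^sub>0 t)) \<in> NPC0R T euclidean"
    by (rule NPC0R_blinfun_compose[OF T NPC0R_continuous_on[OF T costate_continuous] state.A0_NPC0R])
  show ?thesis
    unfolding costate_rhs_def[abs_def]
    by (rule NPC0R_compose2[OF T 0 1, where \<phi> = "\<lambda>a b. - (c q *\<^sub>R a + b)"]) (intro continuous_intros)
qed

lemma costate_PC1: "costate \<in> PC1 T UNIV"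
  by (rule integral_NPC0R_PC1[OF T costate_rhs_NPC0R costate_integral]) auto

lemma costate_deriv: "t \<in> {0..T} \<Longrightarrow> ext_deriv T costate t = costate_rhs t"
  by (rule integral_NPC0R_ext_deriv[OF T costate_rhs_NPC0R costate_integral])

lemma costate_terminal:
  "costate T = (\<Sum>\<alpha>=0..m. c (q + \<alpha>) *\<^sub>R D_H (g \<alpha>) (x\<^sub>0 T)) + (\<Sum>\<beta>=1..q. c (\<beta> - 1) *\<^sub>R D_H (h \<beta>) (x\<^sub>0 T))"
proof -
  have XYT: "X T o\<^sub>L Y T = id_blinfun" by (rule aug.XY) (use T in simp)
  have k: "aug_ter_D k o\<^sub>L inr_blinfun = ter_D k" for k
    by (rule blinfun_eqI) (simp add: aug_ter_D_def blinfun.add_left blinfun.scaleR_left)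
  have "costate T = (\<Sum>k<q + m + 1. c k *\<^sub>R aug_ter_D k) o\<^sub>L inr_blinfun"
    by (simp add: costate_def aug_costate_def XYT)
  also have "\<dots> = (\<Sum>k<q + m + 1. c k *\<^sub>R ter_D k)"
    by (rule blinfun_eqI) (simp add: blinfun.sum_left blinfun.scaleR_left k[symmetric] blinfun.add_left)
  also have "\<dots> = (\<Sum>k\<in>{0..<q}. c k *\<^sub>R ter_D k) + (\<Sum>k\<in>{q..<q + Suc m}. c k *\<^sub>R ter_D k)"
    by (subst sum.atLeastLessThan_concat) (auto simp: atLeast0LessThan)
  also have "(\<Sum>k\<in>{q..<q + Suc m}. c k *\<^sub>R ter_D k) = (\<Sum>\<alpha>=0..m. c (q + \<alpha>) *\<^sub>R D_H (g \<alpha>) (x\<^sub>0 T))"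
    using sum.shift_bounds_nat_ivl[of "\<lambda>k. c k *\<^sub>R ter_D k" 0 q "Suc m"]
    by (simp add: add.commute atLeastLessThanSuc_atLeastAtMost ter_D_def ter_def del: sum.op_ivl_Suc)
  also have "(\<Sum>k\<in>{0..<q}. c k *\<^sub>R ter_D k) = (\<Sum>\<beta>=1..q. c (\<beta> - 1) *\<^sub>R D_H (h \<beta>) (x\<^sub>0 T))"
    by (simp add: sum.atLeast1_atMost_eq atLeast0LessThan ter_D_def ter_def)
  finally show ?thesis by (simp add: add.commute)
qed

text \<open>The multiplier inequality for the needle at time t with value \<zeta> says that the
  augmented costate at t is nonpositive on the jump of the augmented dynamics. Split into
  components, this is the difference of two Hamiltonians.\<close>

lemma hamiltonian_needle:
  assumes "t \<in> {0..<T}" "\<zeta> \<in> topspace U"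
  shows "hamiltonian f\<^sub>0 f t (x\<^sub>0 t) \<zeta> (costate t) (c q) \<le> hamiltonian f\<^sub>0 f t (x\<^sub>0 t) (u\<^sub>0 t) (costate t) (c q)"
proof -
  have t: "t \<in> {0..T}" using assms by auto
  let ?v = "(f\<^sub>0 t (x\<^sub>0 t) \<zeta> - f\<^sub>0 t (x\<^sub>0 t) (u\<^sub>0 t), f t (x\<^sub>0 t) \<zeta> - f t (x\<^sub>0 t) (u\<^sub>0 t))"
  have "(t, \<zeta>) \<in> {0..<T} \<times> topspace U" using assms by simp
  with c have "(\<Sum>k<q + m + 1. c k * aug_ter_D k (X T (aug.needle_jump \<zeta> t))) \<le> 0"
    unfolding multipliers_def by fastforce
  also have "(\<Sum>k<q + m + 1. c k * aug_ter_D k (X T (aug.needle_jump \<zeta> t))) = aug_costate t ?v"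
    by (simp add: aug_costate_def blinfun.sum_left blinfun.scaleR_left aug.needle_jump_def aug_dyn_def aug_x0_def blinfun.add_left)
  finally show ?thesis
    unfolding aug_costate_split[OF t] by (simp add: hamiltonian_def blinfun.diff_right algebra_simps)
qed

end

end

section \<open>Pontryagin triples\<close>

context controlled_process
begin

text \<open>The product d X is constant, since the derivatives of its factors cancel, and d is
  recovered from it through X Y = id. A zero at one time therefore spreads forwards and
  backwards.\<close>

lemma adjoint_vanishes:
  fixes d :: "real \<Rightarrow> 'e \<Rightarrow>\<^sub>L 'f::banach"
  assumes G: "finite G" and d: "continuous_on {0..T} d"
    and dd: "\<And>t. t \<in> {0..T} - G \<Longrightarrow> (d has_vector_derivative - (d t o\<^sub>L A t (u0 t))) (at t)"
    and s: "s \<in> {0..T}" "d s = 0" and t: "t \<in> {0..T}"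
  shows "d t = 0"
proof -
  note bb = bounded_bilinear_blinfun_compose
  obtain X Y :: "real \<Rightarrow> 'e \<Rightarrow>\<^sub>L 'e" and F where X: "continuous_on {0..T} X"
    and "continuous_on {0..T} Y" and F: "finite F"
    and dX: "\<And>t. t \<in> {0..T} - F \<Longrightarrow> (X has_vector_derivative (A t (u0 t) o\<^sub>L X t)) (at t)"
    and "\<And>t. t \<in> {0..T} - F \<Longrightarrow> (Y has_vector_derivative - (Y t o\<^sub>L A t (u0 t))) (at t)"
    and XY: "\<And>t. t \<in> {0..T} \<Longrightarrow> X t o\<^sub>L Y t = id_blinfun"
    and "\<And>t. t \<in> {0..T} \<Longrightarrow> Y t = Y 0 + integral {0..t} (\<lambda>s. - (Y s o\<^sub>L A s (u0 s)))"
    by (rule fundamental_solution[OF T A0_NPC0R], rule that)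
  have "((\<lambda>t. d t o\<^sub>L X t) has_vector_derivative 0) (at t)" if "t \<in> {0..T} - (F \<union> G)" for t
    using bounded_bilinear.has_vector_derivative[OF bb dd[of t] dX[of t]] that
    by (simp add: bounded_bilinear.minus_left[OF bb] blinfun_compose_assoc)
  then have const: "d t o\<^sub>L X t = d 0 o\<^sub>L X 0" if "t \<in> {0..T}" for t
    by (intro constant_of_derivative_zero[of "F \<union> G" T "\<lambda>t. d t o\<^sub>L X t"] that)
      (use F G in \<open>auto intro!: bounded_bilinear.continuous_on[OF bb] d X\<close>)
  have "d t = (d t o\<^sub>L X t) o\<^sub>L Y t" using XY[OF t] by (simp add: blinfun_compose_assoc)
  also have "d t o\<^sub>L X t = d s o\<^sub>L X s" using const[OF t] const[OF s(1)] by simp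
  finally show ?thesis using s(2) by (simp add: bounded_bilinear.zero_left[OF bb])
qed

end

lemma on_image_apply:
  assumes "embedding_map U euclidean \<iota>" "\<zeta> \<in> topspace U"
  shows "on_image U \<iota> \<psi> (\<iota> \<zeta>) = \<psi> \<zeta>"
proof -
  have "inj_on \<iota> (topspace U)"
    using assms(1) homeomorphic_imp_injective_map unfolding embedding_map_def by blast
  then show ?thesis using assms(2) by (simp add: on_image_def inv_into_f_f)
qed

text \<open>Small steps from an interior point stay in the image of U, so the one-sided quotients
  are nonpositive in every direction; v and -v together give 0.\<close>

lemma gateaux_at_interior_max:
  fixes \<iota> :: "'u \<Rightarrow> 'y::real_normed_vector" and \<psi> :: "'u \<Rightarrow> real"
  assumes nb: "subset_nbhd U \<iota> \<zeta>" and \<zeta>: "\<zeta> \<in> topspace U"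
    and max: "\<And>z. z \<in> topspace U \<Longrightarrow> \<psi> z \<le> \<psi> \<zeta>"
    and L: "has_gateaux_differential (on_image U \<iota> \<psi>) L (\<iota> \<zeta>)"
  shows "L v = 0"
proof -
  have emb: "embedding_map U euclidean \<iota>" and int: "\<iota> \<zeta> \<in> interior (\<iota> ` topspace U)"
    using nb by (auto simp: subset_nbhd_def)
  have le: "L v \<le> 0" for v
  proof -
    have "((\<lambda>\<theta>. \<iota> \<zeta> + \<theta> *\<^sub>R v) \<longlongrightarrow> \<iota> \<zeta> + 0 *\<^sub>R v) (at_right 0)" by (intro tendsto_intros)
    then have "\<forall>\<^sub>F \<theta> in at_right 0. \<iota> \<zeta> + \<theta> *\<^sub>R v \<in> interior (\<iota> ` topspace U)"
      by (rule topological_tendstoD) (use int in auto)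
    moreover have "\<forall>\<^sub>F \<theta> in at_right (0::real). \<theta> > 0" by (simp add: eventually_at_filter)
    ultimately have ev: "\<forall>\<^sub>F \<theta> in at_right 0.
      (on_image U \<iota> \<psi> (\<iota> \<zeta> + \<theta> *\<^sub>R v) - on_image U \<iota> \<psi> (\<iota> \<zeta>)) /\<^sub>R \<theta> \<le> 0"
    proof eventually_elim
      fix \<theta> :: real assume "\<iota> \<zeta> + \<theta> *\<^sub>R v \<in> interior (\<iota> ` topspace U)" and \<theta>: "\<theta> > 0"
      then have "\<iota> \<zeta> + \<theta> *\<^sub>R v \<in> \<iota> ` topspace U" using interior_subset by blast
      then obtain z where z: "z \<in> topspace U" "\<iota> \<zeta> + \<theta> *\<^sub>R v = \<iota> z" by blast
      have "on_image U \<iota> \<psi> (\<iota> \<zeta> + \<theta> *\<^sub>R v) \<le> on_image U \<iota> \<psi> (\<iota> \<zeta>)"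
        unfolding z(2) on_image_apply[OF emb z(1)] on_image_apply[OF emb \<zeta>] by (rule max[OF z(1)])
      then show "(on_image U \<iota> \<psi> (\<iota> \<zeta> + \<theta> *\<^sub>R v) - on_image U \<iota> \<psi> (\<iota> \<zeta>)) /\<^sub>R \<theta> \<le> 0"
        using \<theta> by (simp add: mult_nonneg_nonpos)
    qed
    have "((\<lambda>\<theta>. (on_image U \<iota> \<psi> (\<iota> \<zeta> + \<theta> *\<^sub>R v) - on_image U \<iota> \<psi> (\<iota> \<zeta>)) /\<^sub>R \<theta>) \<longlongrightarrow> L v) (at_right 0)"
      using L by (simp add: has_gateaux_differential_def)
    from tendsto_upperbound[OF this ev] show ?thesis by simp
  qed
  from le[of v] le[of "- v"] show ?thesis by (simp add: blinfun.minus_right)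
qed

lemma has_gateaux_differential_add_apply:
  fixes \<phi> :: "'a::real_normed_vector \<Rightarrow> 'c::real_normed_vector"
  assumes "has_gateaux_differential \<psi> L x" "has_gateaux_differential \<phi> L' x"
  shows "has_gateaux_differential (\<lambda>y. \<psi> y + blinfun_apply p (\<phi> y)) (L + (p o\<^sub>L L')) x"
  unfolding has_gateaux_differential_def
proof
  fix v
  have "((\<lambda>\<theta>. (\<psi> (x + \<theta> *\<^sub>R v) - \<psi> x) /\<^sub>R \<theta> + p ((\<phi> (x + \<theta> *\<^sub>R v) - \<phi> x) /\<^sub>R \<theta>)) \<longlongrightarrow> L v + p (L' v)) (at_right 0)"
    using assms unfolding has_gateaux_differential_def by (intro tendsto_intros) auto
  then show "((\<lambda>\<theta>. (\<psi> (x + \<theta> *\<^sub>R v) + p (\<phi> (x + \<theta> *\<^sub>R v)) - (\<psi> x + p (\<phi> x))) /\<^sub>R \<theta>) \<longlongrightarrow> (L + (p o\<^sub>L L')) v) (at_right 0)"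
    by (simp add: blinfun.scaleR_right blinfun.diff_right blinfun.add_left scaleR_diff_right scaleR_add_right algebra_simps)
qed

section \<open>Continuity and maximality of the Hamiltonian\<close>

context bolza
begin

lemma hamiltonian_continuous_map:
  assumes "continuous_on {0..T} p"
  shows "continuous_map (prod_topology (top_of_set {0..T}) U) euclidean (\<lambda>(t, \<zeta>). hamiltonian f\<^sub>0 f t (x\<^sub>0 t) \<zeta> (p t) l)"
proof -
  have p: "continuous_map (prod_topology (top_of_set {0..T}) U) euclidean (\<lambda>z. p (fst z))"
    using continuous_map_compose[OF continuous_map_fst[of "top_of_set {0..T}" U], of euclidean p] assms by (simp add: o_def)
  have 1: "continuous_map (prod_topology (top_of_set {0..T}) U) euclidean (\<lambda>z. p (fst z) (f (fst z) (x\<^sub>0 (fst z)) (snd z)))"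
    by (rule continuous_map_compose2[OF p])
      (use state.f_path_continuous[OF x0_continuous x0_in] in \<open>auto simp: case_prod_unfold intro!: continuous_intros\<close>)
  have 0: "continuous_map (prod_topology (top_of_set {0..T}) U) euclidean (\<lambda>z. f\<^sub>0 (fst z) (x\<^sub>0 (fst z)) (snd z))"
    using integrand_path_continuous[OF integrand_regularD(1)[OF reg0] x0_continuous x0_in] by (simp add: case_prod_unfold)
  show ?thesis
    using continuous_map_compose2[OF 0 1, of "\<lambda>a b. l * a + b"]
    by (simp add: hamiltonian_def case_prod_unfold continuous_intros)
qed

context
  fixes p :: "real \<Rightarrow> 'e \<Rightarrow>\<^sub>L real" and l :: real
  assumes p: "continuous_on {0..T} p"
begin

lemma hamiltonian_NPC0R: "u \<in> NPC0R T U \<Longrightarrow> (\<lambda>t. hamiltonian f\<^sub>0 f t (x\<^sub>0 t) (u t) (p t) l) \<in> NPC0R T euclidean"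
  by (rule NPC0R_tcompose[OF T _ hamiltonian_continuous_map[OF p]])

text \<open>With the control frozen the Hamiltonian is continuous in time even where the optimal
  control jumps. This is what lets inequalities pass to one-sided limits.\<close>

lemma hamiltonian_fixed_control:
  assumes "\<zeta> \<in> topspace U" "t \<in> {0<..T}"
  shows "((\<lambda>s. hamiltonian f\<^sub>0 f s (x\<^sub>0 s) \<zeta> (p s) l) \<longlongrightarrow> hamiltonian f\<^sub>0 f t (x\<^sub>0 t) \<zeta> (p t) l) (at_left t)"
proof -
  have "continuous_map (top_of_set {0..T}) (prod_topology (top_of_set {0..T}) U) (\<lambda>s. (s, \<zeta>))"
    using assms by (intro continuous_map_pairedI) (auto simp: id_def[symmetric])
  from continuous_map_compose[OF this hamiltonian_continuous_map[OF p]]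
  have "continuous_on {0..T} (\<lambda>s. hamiltonian f\<^sub>0 f s (x\<^sub>0 s) \<zeta> (p s) l)" by (simp add: o_def)
  then have "((\<lambda>s. hamiltonian f\<^sub>0 f s (x\<^sub>0 s) \<zeta> (p s) l) \<longlongrightarrow> hamiltonian f\<^sub>0 f t (x\<^sub>0 t) \<zeta> (p t) l) (at t within {0..T})"
    using assms by (auto simp: continuous_on_def)
  from tendsto_mono[OF at_left_le_within this] show ?thesis using assms(2) by simp
qed

text \<open>Needles start strictly before T, so at T the maximum condition is a limit from the left,
  where the control is left-continuous by normalisation.\<close>

lemma hamiltonian_max_at_end:
  assumes max: "\<And>t \<zeta>. t \<in> {0..<T} \<Longrightarrow> \<zeta> \<in> topspace U \<Longrightarrow>
      hamiltonian f\<^sub>0 f t (x\<^sub>0 t) \<zeta> (p t) l \<le> hamiltonian f\<^sub>0 f t (x\<^sub>0 t) (u\<^sub>0 t) (p t) l"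
    and \<zeta>: "\<zeta> \<in> topspace U"
  shows "hamiltonian f\<^sub>0 f T (x\<^sub>0 T) \<zeta> (p T) l \<le> hamiltonian f\<^sub>0 f T (x\<^sub>0 T) (u\<^sub>0 T) (p T) l"
proof (rule tendsto_le[OF trivial_limit_at_left_real])
  show "((\<lambda>s. hamiltonian f\<^sub>0 f s (x\<^sub>0 s) \<zeta> (p s) l) \<longlongrightarrow> hamiltonian f\<^sub>0 f T (x\<^sub>0 T) \<zeta> (p T) l) (at_left T)"
    by (rule hamiltonian_fixed_control[OF \<zeta>]) (use T in simp)
  show "((\<lambda>s. hamiltonian f\<^sub>0 f s (x\<^sub>0 s) (u\<^sub>0 s) (p s) l) \<longlongrightarrow> hamiltonian f\<^sub>0 f T (x\<^sub>0 T) (u\<^sub>0 T) (p T) l) (at_left T)"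
    using hamiltonian_NPC0R[OF u0_NPC0R] by (simp add: NPC0R_iff[OF T])
  show "\<forall>\<^sub>F s in at_left T. hamiltonian f\<^sub>0 f s (x\<^sub>0 s) \<zeta> (p s) l \<le> hamiltonian f\<^sub>0 f s (x\<^sub>0 s) (u\<^sub>0 s) (p s) l"
    unfolding eventually_at_left_field using T by (intro exI[of _ 0]) (auto intro: max \<zeta>)
qed

lemma hamiltonian_continuous:
  assumes max: "\<And>t \<zeta>. t \<in> {0..T} \<Longrightarrow> \<zeta> \<in> topspace U \<Longrightarrow>
      hamiltonian f\<^sub>0 f t (x\<^sub>0 t) \<zeta> (p t) l \<le> hamiltonian f\<^sub>0 f t (x\<^sub>0 t) (u\<^sub>0 t) (p t) l"
  shows "continuous_on {0..T} (\<lambda>t. hamiltonian f\<^sub>0 f t (x\<^sub>0 t) (u\<^sub>0 t) (p t) l)" (is "continuous_on _ ?H")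
proof -
  note reg = hamiltonian_NPC0R[OF u0_NPC0R, unfolded NPC0R_iff[OF T] limitin_canonical_iff]
  have right: "(?H \<longlongrightarrow> ?H t) (at_right t)" if "t \<in> {0..<T}" for t using reg that by blast
  have left: "(?H \<longlongrightarrow> ?H t) (at_left t)" if t: "t \<in> {0<..T}" for t
  proof -
    have t': "t \<in> {0..T}" using t by auto
    obtain \<zeta> where \<zeta>: "limitin U u\<^sub>0 \<zeta> (at_left t)" using u0_NPC0R t unfolding NPC0R_iff[OF T] by blast
    have \<zeta>U: "\<zeta> \<in> topspace U" using \<zeta> by (rule limitin_topspace)
    have id: "limitin (top_of_set {0..T}) (\<lambda>s. s) t (at_left t)"
      using t by (auto simp: limitin_subtopology eventually_at_left_field intro!: exI[of _ 0] tendsto_ident_at)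
    have "limitin (prod_topology (top_of_set {0..T}) U) (\<lambda>s. (s, u\<^sub>0 s)) (t, \<zeta>) (at_left t)"
      using id \<zeta> by (simp add: limitin_pairwise o_def)
    from continuous_map_limit[OF hamiltonian_continuous_map[OF p] this]
    have lim: "(?H \<longlongrightarrow> hamiltonian f\<^sub>0 f t (x\<^sub>0 t) \<zeta> (p t) l) (at_left t)" by (simp add: o_def)
    have "?H t \<le> hamiltonian f\<^sub>0 f t (x\<^sub>0 t) \<zeta> (p t) l"
    proof (rule tendsto_le[OF trivial_limit_at_left_real lim hamiltonian_fixed_control[OF u0_in[OF t'] t]])
      show "\<forall>\<^sub>F s in at_left t. hamiltonian f\<^sub>0 f s (x\<^sub>0 s) (u\<^sub>0 t) (p s) l \<le> ?H s"
        unfolding eventually_at_left_field using t by (intro exI[of _ 0]) (auto intro!: max u0_in t')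
    qed
    then have "hamiltonian f\<^sub>0 f t (x\<^sub>0 t) \<zeta> (p t) l = ?H t" using max[OF t' \<zeta>U] by simp
    then show ?thesis using lim by simp
  qed
  show ?thesis
    unfolding continuous_on_def
  proof
    fix t assume t: "t \<in> {0..T}"
    then consider "t = 0" | "t \<in> {0<..<T}" | "t = T" by force
    then show "(?H \<longlongrightarrow> ?H t) (at t within {0..T})"
    proof cases
      case 1
      then show ?thesis using right[of t] T by (simp add: at_within_Icc_at_right)
    next
      case 2
      then show ?thesis using right[of t] left[of t] by (simp add: at_within_Icc_eq filterlim_at_split)
    next
      case 3
      then show ?thesis using left[of t] T by (simp add: at_within_Icc_at_left)
    qed
  qed
qed

end

lemma D_F_hamiltonian:
  assumes "t \<in> {0..T}"
  shows "D_F (\<lambda>\<xi>. hamiltonian f\<^sub>0 f t \<xi> (u\<^sub>0 t) p l) (x\<^sub>0 t) = l *\<^sub>R D0 t (u\<^sub>0 t) + (p o\<^sub>L D1 t (u\<^sub>0 t))"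
proof (rule D_F_eq)
  have "((\<lambda>\<xi>. l * f\<^sub>0 t \<xi> (u\<^sub>0 t) + p (f t \<xi> (u\<^sub>0 t))) has_derivative
      (\<lambda>v. l * D0 t (u\<^sub>0 t) v + p (D1 t (u\<^sub>0 t) v))) (at (x\<^sub>0 t))"
    by (intro has_derivative_add has_derivative_mult_right D0_derivative D1_derivative assms u0_in
        bounded_linear.has_derivative[OF blinfun.bounded_linear_right])
  moreover have "blinfun_apply (l *\<^sub>R D0 t (u\<^sub>0 t) + (p o\<^sub>L D1 t (u\<^sub>0 t))) = (\<lambda>v. l * D0 t (u\<^sub>0 t) v + p (D1 t (u\<^sub>0 t) v))"
    by (rule ext) (simp add: blinfun.add_left blinfun.scaleR_left)
  ultimately show "((\<lambda>\<xi>. hamiltonian f\<^sub>0 f t \<xi> (u\<^sub>0 t) p l) has_derivative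
      blinfun_apply (l *\<^sub>R D0 t (u\<^sub>0 t) + (p o\<^sub>L D1 t (u\<^sub>0 t)))) (at (x\<^sub>0 t))"
    by (simp add: hamiltonian_def)
qed

end

text \<open>Beyond renumbering, two conditions are completed here: the maximum condition is extended
  to the end time, and from it follows continuity of the Hamiltonian.\<close>

lemma (in bolza_linearised) pontryagin_triple_of_multipliers:
  assumes c: "c \<in> multipliers"
  shows "pontryagin_triple T U m q f\<^sub>0 f g h x\<^sub>0 u\<^sub>0 (\<lambda>\<alpha>. c (q + \<alpha>)) (\<lambda>\<beta>. c (\<beta> - 1)) (costate c)"
proof -
  have max: "hamiltonian f\<^sub>0 f t (x\<^sub>0 t) \<zeta> (costate c t) (c q) \<le> hamiltonian f\<^sub>0 f t (x\<^sub>0 t) (u\<^sub>0 t) (costate c t) (c q)"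
    if "t \<in> {0..T}" "\<zeta> \<in> topspace U" for t \<zeta>
  proof (cases "t = T")
    case True
    then show ?thesis
      using hamiltonian_max_at_end[OF costate_continuous[OF c] hamiltonian_needle[OF c]] that(2) by simp
  next
    case False
    then show ?thesis using hamiltonian_needle[OF c, of t \<zeta>] that by simp
  qed
  have "\<not> ((\<forall>\<alpha>\<in>{0..m}. c (q + \<alpha>) = 0) \<and> (\<forall>\<beta>\<in>{1..q}. c (\<beta> - 1) = 0))"
  proof
    assume z: "(\<forall>\<alpha>\<in>{0..m}. c (q + \<alpha>) = 0) \<and> (\<forall>\<beta>\<in>{1..q}. c (\<beta> - 1) = 0)"
    have "c k = 0" if "k < q + m + 1" for k
    proof (cases "k < q")
      case True
      then show ?thesis using bspec[OF conjunct2[OF z], of "Suc k"] by simp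
    next
      case False
      then show ?thesis using bspec[OF conjunct1[OF z], of "k - q"] that by simp
    qed
    then show False using c by (auto simp: multipliers_def)
  qed
  moreover have "\<forall>\<alpha>\<in>{0..m}. 0 \<le> c (q + \<alpha>)" using c by (simp add: multipliers_def)
  moreover have "\<forall>\<alpha>\<in>{1..m}. c (q + \<alpha>) * g \<alpha> (x\<^sub>0 T) = 0"
  proof
    fix \<alpha> assume \<alpha>: "\<alpha> \<in> {1..m}"
    then have "c (q + \<alpha>) * aug_ter (q + \<alpha>) (aug_x0 T) = 0" using c by (simp add: multipliers_def)
    then show "c (q + \<alpha>) * g \<alpha> (x\<^sub>0 T) = 0" using \<alpha> by (simp add: aug_ter_def ter_def)
  qed
  moreover have "continuous_on {0..T} (\<lambda>t. hamiltonian f\<^sub>0 f t (x\<^sub>0 t) (u\<^sub>0 t) (costate c t) (c q))"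
    by (rule hamiltonian_continuous[OF costate_continuous[OF c] max])
  ultimately show ?thesis
    unfolding pontryagin_triple_def
    using costate_PC1[OF c] costate_terminal[OF c] costate_deriv[OF c] D_F_hamiltonian max
    by (simp add: costate_rhs_def[OF c])
qed

context bolza
begin

text \<open>The multipliers satisfying the necessary conditions form a cone. Normalising them before
  the costate is constructed avoids rescaling the costate.\<close>

lemma pontryagin_multipliers:
  obtains S :: "(nat \<Rightarrow> real) set" where "S \<noteq> {}" "\<And>c s. c \<in> S \<Longrightarrow> s > 0 \<Longrightarrow> (\<lambda>k. s * c k) \<in> S"
    "\<And>c. c \<in> S \<Longrightarrow> \<exists>p. pontryagin_triple T U m q f\<^sub>0 f g h x\<^sub>0 u\<^sub>0 (\<lambda>\<alpha>. c (q + \<alpha>)) (\<lambda>\<beta>. c (\<beta> - 1)) p"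
proof -
  obtain X Y :: "real \<Rightarrow> (real \<times> 'e) \<Rightarrow>\<^sub>L (real \<times> 'e)" and F where XY:
    "continuous_on {0..T} X" "continuous_on {0..T} Y" "finite F"
    "\<And>t. t \<in> {0..T} - F \<Longrightarrow> (X has_vector_derivative (aug_D t (u\<^sub>0 t) o\<^sub>L X t)) (at t)"
    "\<And>t. t \<in> {0..T} - F \<Longrightarrow> (Y has_vector_derivative - (Y t o\<^sub>L aug_D t (u\<^sub>0 t))) (at t)"
    "\<And>t. t \<in> {0..T} \<Longrightarrow> X t o\<^sub>L Y t = id_blinfun"
    "\<And>t. t \<in> {0..T} \<Longrightarrow> Y t = Y 0 + integral {0..t} (\<lambda>s. - (Y s o\<^sub>L aug_D s (u\<^sub>0 s)))"
    by (rule fundamental_solution[OF T aug.A0_NPC0R], rule that)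
  have lin: "linearised_process T (UNIV \<times> \<Omega>) U aug_dyn aug_D aug_x0 u\<^sub>0 X Y F"
    by unfold_locales (rule XY; assumption)+
  interpret lin: bolza_linearised T \<Omega> \<xi>\<^sub>0 U m q f f\<^sub>0 g h x\<^sub>0 u\<^sub>0 X Y F
    by (intro bolza_linearised.intro bolza_linearised_axioms.intro bolza_axioms lin) (rule XY(7))
  show ?thesis
    using that[OF lin.multipliers_nonempty lin.multipliers_scale] lin.pontryagin_triple_of_multipliers by blast
qed

section \<open>Consequences of the conditions on a triple\<close>

context
  fixes l \<mu> p assumes tr: "pontryagin_triple T U m q f\<^sub>0 f g h x\<^sub>0 u\<^sub>0 l \<mu> p"
begin

lemma triple_facts:
  shows "p \<in> PC1 T UNIV" and "\<not> ((\<forall>\<alpha> \<in> {0..m}. l \<alpha> = 0) \<and> (\<forall>\<beta> \<in> {1..q}. \<mu> \<beta> = 0))"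
    and "\<And>\<alpha>. \<alpha> \<in> {0..m} \<Longrightarrow> l \<alpha> \<ge> 0" and "\<And>\<alpha>. \<alpha> \<in> {1..m} \<Longrightarrow> l \<alpha> * g \<alpha> (x\<^sub>0 T) = 0"
    and "(\<Sum>\<alpha>=0..m. l \<alpha> *\<^sub>R D_H (g \<alpha>) (x\<^sub>0 T)) + (\<Sum>\<beta>=1..q. \<mu> \<beta> *\<^sub>R D_H (h \<beta>) (x\<^sub>0 T)) = p T"
    and "\<And>t \<zeta>. t \<in> {0..T} \<Longrightarrow> \<zeta> \<in> topspace U \<Longrightarrow>
        hamiltonian f\<^sub>0 f t (x\<^sub>0 t) \<zeta> (p t) (l 0) \<le> hamiltonian f\<^sub>0 f t (x\<^sub>0 t) (u\<^sub>0 t) (p t) (l 0)"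
  using tr unfolding pontryagin_triple_def by blast+

lemma triple_continuous: "continuous_on {0..T} p"
  using triple_facts(1) by (simp add: PC1_def)

lemma triple_derivative:
  obtains F where "finite F" "\<And>t. t \<in> {0..T} - F \<Longrightarrow>
    (p has_vector_derivative - (l 0 *\<^sub>R D0 t (u\<^sub>0 t) + (p t o\<^sub>L D1 t (u\<^sub>0 t)))) (at t)"
proof -
  obtain F where F: "finite F" "\<And>t. t \<in> {0..T} - F \<Longrightarrow> (p has_vector_derivative ext_deriv T p t) (at t)"
    using PC1_derivative[OF T triple_facts(1)] by blast
  have "ext_deriv T p t = - (l 0 *\<^sub>R D0 t (u\<^sub>0 t) + (p t o\<^sub>L D1 t (u\<^sub>0 t)))" if "t \<in> {0..T}" for t
    using tr that D_F_hamiltonian[OF that, of "p t" "l 0"] unfolding pontryagin_triple_def by simp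
  with F show ?thesis using that[of F] by force
qed

lemma triple_terminal_split:
  "p T = l 0 *\<^sub>R D_H (g 0) (x\<^sub>0 T) + ((\<Sum>\<alpha>=1..m. l \<alpha> *\<^sub>R D_H (g \<alpha>) (x\<^sub>0 T)) + (\<Sum>\<beta>=1..q. \<mu> \<beta> *\<^sub>R D_H (h \<beta>) (x\<^sub>0 T)))"
  unfolding triple_facts(5)[symmetric] by (simp add: sum.atLeast_Suc_atMost add.assoc)

lemma triple_nontrivial:
  assumes "l 0 = 0"
  shows "\<not> ((\<forall>\<alpha> \<in> {1..m}. l \<alpha> = 0) \<and> (\<forall>\<beta> \<in> {1..q}. \<mu> \<beta> = 0))"
proof
  assume z: "(\<forall>\<alpha> \<in> {1..m}. l \<alpha> = 0) \<and> (\<forall>\<beta> \<in> {1..q}. \<mu> \<beta> = 0)"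
  have "l \<alpha> = 0" if "\<alpha> \<in> {0..m}" for \<alpha> using z assms that by (cases "\<alpha> = 0") auto
  then show False using triple_facts(2) z by blast
qed

text \<open>With l 0 = 0 the adjoint equation is homogeneous, so a zero of p at one time makes p(T)
  vanish. The terminal condition then becomes the relation excluded by \<open>QC\<close>, and all
  multipliers would be 0.\<close>

lemma triple_not_zero:
  assumes qc: "QC m q g h (x\<^sub>0 T)" and t: "t \<in> {0..T}"
  shows "(l 0, p t) \<noteq> 0"
proof
  assume "(l 0, p t) = 0"
  then have l0: "l 0 = 0" and pt: "p t = 0" by (auto simp: zero_prod_def)
  obtain F where F: "finite F" "\<And>t. t \<in> {0..T} - F \<Longrightarrow>
    (p has_vector_derivative - (l 0 *\<^sub>R D0 t (u\<^sub>0 t) + (p t o\<^sub>L D1 t (u\<^sub>0 t)))) (at t)"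
    using triple_derivative by blast
  have "p T = 0"
    by (rule state.adjoint_vanishes[OF F(1) triple_continuous _ t pt]) (use F(2) l0 T in auto)
  then have z: "(\<Sum>\<alpha>=1..m. l \<alpha> *\<^sub>R D_H (g \<alpha>) (x\<^sub>0 T)) + (\<Sum>\<beta>=1..q. \<mu> \<beta> *\<^sub>R D_H (h \<beta>) (x\<^sub>0 T)) = 0"
    using triple_terminal_split l0 by simp
  have "(\<Sum>\<alpha>=1..m. l \<alpha> *\<^sub>R D_G (g \<alpha>) (x\<^sub>0 T)) = (\<Sum>\<alpha>=1..m. l \<alpha> *\<^sub>R D_H (g \<alpha>) (x\<^sub>0 T))"
    "(\<Sum>\<beta>=1..q. \<mu> \<beta> *\<^sub>R D_G (h \<beta>) (x\<^sub>0 T)) = (\<Sum>\<beta>=1..q. \<mu> \<beta> *\<^sub>R D_H (h \<beta>) (x\<^sub>0 T))"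
    using ter by (auto intro!: sum.cong simp: D_G_eq_D_H terminal_regular_def)
  with z have z': "(\<Sum>\<alpha>=1..m. l \<alpha> *\<^sub>R D_G (g \<alpha>) (x\<^sub>0 T)) + (\<Sum>\<beta>=1..q. \<mu> \<beta> *\<^sub>R D_G (h \<beta>) (x\<^sub>0 T)) = 0"
    by (simp only:)
  have "(\<forall>\<alpha> \<in> {1..m}. l \<alpha> = 0) \<and> (\<forall>\<beta> \<in> {1..q}. \<mu> \<beta> = 0)"
  proof (rule qc[unfolded QC_def, THEN spec, THEN spec, THEN mp], intro conjI ballI z')
    show "0 \<le> l \<alpha>" if "\<alpha> \<in> {1..m}" for \<alpha> using triple_facts(3)[of \<alpha>] that by simp
  qed (rule triple_facts(4))
  then show False using triple_nontrivial[OF l0] by blast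
qed

text \<open>The differential is that of the product \<open>l 0\<close> times the running cost. In
  this form the abnormal case takes L = 0 and asks for no differentiability of the running cost in
  the control.\<close>

lemma triple_stationary:
  fixes \<iota> :: "'u \<Rightarrow> 'y::real_normed_vector"
  assumes t: "t \<in> {0..T}" and nb: "subset_nbhd U \<iota> (u\<^sub>0 t)"
    and f: "gateaux_differentiable (on_image U \<iota> (f t (x\<^sub>0 t))) (\<iota> (u\<^sub>0 t))"
    and L: "has_gateaux_differential (on_image U \<iota> (\<lambda>\<zeta>. l 0 * f\<^sub>0 t (x\<^sub>0 t) \<zeta>)) L (\<iota> (u\<^sub>0 t))"
  shows "L v + p t (D_G (on_image U \<iota> (f t (x\<^sub>0 t))) (\<iota> (u\<^sub>0 t)) v) = 0"
proof -
  let ?\<psi> = "\<lambda>\<zeta>. hamiltonian f\<^sub>0 f t (x\<^sub>0 t) \<zeta> (p t) (l 0)"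
  have "on_image U \<iota> ?\<psi> = (\<lambda>y. on_image U \<iota> (\<lambda>\<zeta>. l 0 * f\<^sub>0 t (x\<^sub>0 t) \<zeta>) y + p t (on_image U \<iota> (f t (x\<^sub>0 t)) y))"
    by (rule ext) (simp add: on_image_def hamiltonian_def)
  then have "has_gateaux_differential (on_image U \<iota> ?\<psi>)
     (L + (p t o\<^sub>L D_G (on_image U \<iota> (f t (x\<^sub>0 t))) (\<iota> (u\<^sub>0 t)))) (\<iota> (u\<^sub>0 t))"
    using has_gateaux_differential_add_apply[OF L has_gateaux_differential_D_G[OF f]] by simp
  from gateaux_at_interior_max[OF nb u0_in[OF t] triple_facts(6)[OF t] this]
  show ?thesis by (simp add: blinfun.add_left)
qed

lemma triple_stationary_abnormal:
  fixes \<iota> :: "'u \<Rightarrow> 'y::real_normed_vector"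
  assumes "l 0 = 0" "t \<in> {0..T}" "subset_nbhd U \<iota> (u\<^sub>0 t)"
    "gateaux_differentiable (on_image U \<iota> (f t (x\<^sub>0 t))) (\<iota> (u\<^sub>0 t))"
  shows "p t (D_G (on_image U \<iota> (f t (x\<^sub>0 t))) (\<iota> (u\<^sub>0 t)) v) = 0"
proof -
  have "has_gateaux_differential (on_image U \<iota> (\<lambda>\<zeta>. l 0 * f\<^sub>0 t (x\<^sub>0 t) \<zeta>)) 0 (\<iota> (u\<^sub>0 t))"
    using assms(1) by (simp add: has_gateaux_differential_def on_image_def)
  from triple_stationary[OF assms(2-4) this] show ?thesis by simp
qed

text \<open>In the abnormal case stationarity makes p(t) vanish on the range of the control
  differential, which is all of E. Then p(t) = 0, contradicting
  \<open>triple_not_zero\<close>.\<close>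

lemma triple_normal_Surj:
  assumes qc: "QC m q g h (x\<^sub>0 T)" and sj: "Surj T U \<iota> f x\<^sub>0 u\<^sub>0"
  shows "l 0 \<noteq> 0"
proof
  assume l0: "l 0 = 0"
  obtain t where t: "t \<in> {0..T}" "subset_nbhd U \<iota> (u\<^sub>0 t)"
    "gateaux_differentiable (on_image U \<iota> (f t (x\<^sub>0 t))) (\<iota> (u\<^sub>0 t))"
    and s: "surj (blinfun_apply (D_G (on_image U \<iota> (f t (x\<^sub>0 t))) (\<iota> (u\<^sub>0 t))))"
    using sj by (auto simp: Surj_def)
  have "p t = 0"
  proof (rule blinfun_eqI)
    fix w
    obtain v where "w = D_G (on_image U \<iota> (f t (x\<^sub>0 t))) (\<iota> (u\<^sub>0 t)) v" using s by (auto simp: surj_def)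
    then show "p t w = blinfun_apply 0 w" using triple_stationary_abnormal[OF l0 t] by simp
  qed
  then show False using triple_not_zero[OF qc t(1)] l0 by (simp add: zero_prod_def)
qed

text \<open>In the abnormal case stationarity at T, with p(T) expanded by the terminal condition, is
  a vanishing linear combination of the independent family. All multipliers would be 0.\<close>

lemma triple_normal_LI:
  assumes li: "LI T U \<iota> m q f g h x\<^sub>0 u\<^sub>0"
  shows "l 0 \<noteq> 0"
proof
  assume l0: "l 0 = 0"
  let ?A = "D_G (on_image U \<iota> (f T (x\<^sub>0 T))) (\<iota> (u\<^sub>0 T))"
  have TT: "T \<in> {0..T}" using T by simp
  have nb: "subset_nbhd U \<iota> (u\<^sub>0 T)" and f: "gateaux_differentiable (on_image U \<iota> (f T (x\<^sub>0 T))) (\<iota> (u\<^sub>0 T))"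
    and ind: "\<And>c d :: nat \<Rightarrow> real. (\<Sum>\<alpha>=1..m. c \<alpha> *\<^sub>R (D_H (g \<alpha>) (x\<^sub>0 T) o\<^sub>L ?A)) + (\<Sum>\<beta>=1..q. d \<beta> *\<^sub>R (D_H (h \<beta>) (x\<^sub>0 T) o\<^sub>L ?A)) = 0 \<Longrightarrow>
        (\<forall>\<alpha> \<in> {1..m}. c \<alpha> = 0) \<and> (\<forall>\<beta> \<in> {1..q}. d \<beta> = 0)"
    using li by (auto simp: LI_def Let_def)
  have "(\<Sum>\<alpha>=1..m. l \<alpha> *\<^sub>R (D_H (g \<alpha>) (x\<^sub>0 T) o\<^sub>L ?A)) + (\<Sum>\<beta>=1..q. \<mu> \<beta> *\<^sub>R (D_H (h \<beta>) (x\<^sub>0 T) o\<^sub>L ?A)) = 0"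
  proof (rule blinfun_eqI)
    fix v
    have "p T (?A v) = 0" by (rule triple_stationary_abnormal[OF l0 TT nb f])
    then show "((\<Sum>\<alpha>=1..m. l \<alpha> *\<^sub>R (D_H (g \<alpha>) (x\<^sub>0 T) o\<^sub>L ?A)) + (\<Sum>\<beta>=1..q. \<mu> \<beta> *\<^sub>R (D_H (h \<beta>) (x\<^sub>0 T) o\<^sub>L ?A))) v = blinfun_apply 0 v"
      unfolding triple_terminal_split using l0 by (simp add: blinfun.add_left blinfun.sum_left blinfun.scaleR_left)
  qed
  from ind[OF this] show False using triple_nontrivial[OF l0] by blast
qed

end

text \<open>The cost multiplier is nonnegative and, by assumption, nonzero. The multiplier vector is
  divided by it before a costate is attached.\<close>

lemma normalised_triple:
  assumes "\<And>l \<mu> p. pontryagin_triple T U m q f\<^sub>0 f g h x\<^sub>0 u\<^sub>0 l \<mu> p \<Longrightarrow> l 0 \<noteq> 0"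
  shows "\<exists>l \<mu> p. pontryagin_triple T U m q f\<^sub>0 f g h x\<^sub>0 u\<^sub>0 l \<mu> p \<and> l 0 = 1"
proof -
  obtain S where S: "S \<noteq> {}" "\<And>c s. c \<in> S \<Longrightarrow> s > 0 \<Longrightarrow> (\<lambda>k. s * c k) \<in> S"
    "\<And>c. c \<in> S \<Longrightarrow> \<exists>p. pontryagin_triple T U m q f\<^sub>0 f g h x\<^sub>0 u\<^sub>0 (\<lambda>\<alpha>. c (q + \<alpha>)) (\<lambda>\<beta>. c (\<beta> - 1)) p"
    using pontryagin_multipliers by blast
  obtain c where c: "c \<in> S" using S(1) by blast
  obtain p where p: "pontryagin_triple T U m q f\<^sub>0 f g h x\<^sub>0 u\<^sub>0 (\<lambda>\<alpha>. c (q + \<alpha>)) (\<lambda>\<beta>. c (\<beta> - 1)) p"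
    using S(3)[OF c] by blast
  have "c q \<noteq> 0" using assms[OF p] by simp
  moreover have "c q \<ge> 0" using triple_facts(3)[OF p, of 0] by simp
  ultimately have cq: "c q > 0" by simp
  then have "(\<lambda>k. inverse (c q) * c k) \<in> S" using S(2)[OF c] by simp
  from S(3)[OF this] show ?thesis using cq by (auto intro!: exI)
qed

text \<open>Both triples are stationary at T with the same running cost term, which cancels on
  subtraction, as does \<open>g 0\<close>. Independence identifies the remaining multipliers, hence
  p(T).\<close>

lemma normal_triple_unique:
  assumes li: "LI T U \<iota> m q f g h x\<^sub>0 u\<^sub>0"
    and f0: "gateaux_differentiable (on_image U \<iota> (f\<^sub>0 T (x\<^sub>0 T))) (\<iota> (u\<^sub>0 T))"
    and tr: "pontryagin_triple T U m q f\<^sub>0 f g h x\<^sub>0 u\<^sub>0 l \<mu> p" "l 0 = 1"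
    and tr': "pontryagin_triple T U m q f\<^sub>0 f g h x\<^sub>0 u\<^sub>0 l' \<mu>' p'" "l' 0 = 1"
  shows "(\<forall>\<alpha> \<in> {0..m}. l' \<alpha> = l \<alpha>) \<and> (\<forall>\<beta> \<in> {1..q}. \<mu>' \<beta> = \<mu> \<beta>) \<and> (\<forall>t \<in> {0..T}. p' t = p t)"
proof -
  let ?A = "D_G (on_image U \<iota> (f T (x\<^sub>0 T))) (\<iota> (u\<^sub>0 T))"
  let ?B = "D_G (on_image U \<iota> (f\<^sub>0 T (x\<^sub>0 T))) (\<iota> (u\<^sub>0 T))"
  have TT: "T \<in> {0..T}" using T by simp
  have nb: "subset_nbhd U \<iota> (u\<^sub>0 T)" and f: "gateaux_differentiable (on_image U \<iota> (f T (x\<^sub>0 T))) (\<iota> (u\<^sub>0 T))"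
    and ind: "\<And>c d :: nat \<Rightarrow> real. (\<Sum>\<alpha>=1..m. c \<alpha> *\<^sub>R (D_H (g \<alpha>) (x\<^sub>0 T) o\<^sub>L ?A)) + (\<Sum>\<beta>=1..q. d \<beta> *\<^sub>R (D_H (h \<beta>) (x\<^sub>0 T) o\<^sub>L ?A)) = 0 \<Longrightarrow>
        (\<forall>\<alpha> \<in> {1..m}. c \<alpha> = 0) \<and> (\<forall>\<beta> \<in> {1..q}. d \<beta> = 0)"
    using li by (auto simp: LI_def Let_def)
  have f0': "has_gateaux_differential (on_image U \<iota> (\<lambda>\<zeta>. k 0 * f\<^sub>0 T (x\<^sub>0 T) \<zeta>)) ?B (\<iota> (u\<^sub>0 T))" if "k 0 = 1" for k :: "nat \<Rightarrow> real"
    using has_gateaux_differential_D_G[OF f0] that by (simp add: has_gateaux_differential_def on_image_def)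
  have st: "?B v + p T (?A v) = 0" "?B v + p' T (?A v) = 0" for v
    using triple_stationary[OF tr(1) TT nb f f0'[of l, OF tr(2)]] triple_stationary[OF tr'(1) TT nb f f0'[of l', OF tr'(2)]] by auto
  have "(\<Sum>\<alpha>=1..m. (l' \<alpha> - l \<alpha>) *\<^sub>R (D_H (g \<alpha>) (x\<^sub>0 T) o\<^sub>L ?A)) + (\<Sum>\<beta>=1..q. (\<mu>' \<beta> - \<mu> \<beta>) *\<^sub>R (D_H (h \<beta>) (x\<^sub>0 T) o\<^sub>L ?A)) = 0"
  proof (rule blinfun_eqI)
    fix v
    have "p' T (?A v) - p T (?A v) = 0" using st[of v] by simp
    then show "((\<Sum>\<alpha>=1..m. (l' \<alpha> - l \<alpha>) *\<^sub>R (D_H (g \<alpha>) (x\<^sub>0 T) o\<^sub>L ?A)) + (\<Sum>\<beta>=1..q. (\<mu>' \<beta> - \<mu> \<beta>) *\<^sub>R (D_H (h \<beta>) (x\<^sub>0 T) o\<^sub>L ?A))) v = blinfun_apply 0 v"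
      unfolding triple_terminal_split[OF tr(1)] triple_terminal_split[OF tr'(1)] using tr(2) tr'(2)
      by (simp add: blinfun.add_left blinfun.sum_left blinfun.scaleR_left left_diff_distrib sum_subtractf)
  qed
  from ind[OF this] have l1: "\<forall>\<alpha> \<in> {1..m}. l' \<alpha> = l \<alpha>" and \<mu>: "\<forall>\<beta> \<in> {1..q}. \<mu>' \<beta> = \<mu> \<beta>" by auto
  have "l' \<alpha> = l \<alpha>" if "\<alpha> \<in> {0..m}" for \<alpha> using l1 tr(2) tr'(2) that by (cases "\<alpha> = 0") auto
  moreover have "p' T = p T"
    unfolding triple_terminal_split[OF tr(1)] triple_terminal_split[OF tr'(1)] using l1 \<mu> tr(2) tr'(2) by simp
  moreover have "p' t = p t" if "t \<in> {0..T}" for t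
  proof -
    obtain F where F: "finite F" "\<And>t. t \<in> {0..T} - F \<Longrightarrow>
      (p has_vector_derivative - (l 0 *\<^sub>R D0 t (u\<^sub>0 t) + (p t o\<^sub>L D1 t (u\<^sub>0 t)))) (at t)"
      using triple_derivative[OF tr(1)] by blast
    obtain F' where F': "finite F'" "\<And>t. t \<in> {0..T} - F' \<Longrightarrow>
      (p' has_vector_derivative - (l' 0 *\<^sub>R D0 t (u\<^sub>0 t) + (p' t o\<^sub>L D1 t (u\<^sub>0 t)))) (at t)"
      using triple_derivative[OF tr'(1)] by blast
    have "p' t - p t = 0"
    \<comment> \<open>The inhomogeneous terms agree because both cost multipliers are 1, so the
      difference of the costates solves the homogeneous adjoint equation and vanishes at T.\<close>
    proof (rule state.adjoint_vanishes[of "F \<union> F'" "\<lambda>t. p' t - p t" T t])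
      show "continuous_on {0..T} (\<lambda>t. p' t - p t)"
        by (intro continuous_intros triple_continuous[OF tr(1)] triple_continuous[OF tr'(1)])
      fix s assume s: "s \<in> {0..T} - (F \<union> F')"
      then show "((\<lambda>t. p' t - p t) has_vector_derivative - ((p' s - p s) o\<^sub>L D1 s (u\<^sub>0 s))) (at s)"
        using has_vector_derivative_diff[OF F'(2)[of s] F(2)[of s]] tr(2) tr'(2)
        by (simp add: bounded_bilinear.diff_left[OF bounded_bilinear_blinfun_compose])
    qed (use F F' T that \<open>p' T = p T\<close> in auto)
    then show ?thesis by simp
  qed
  ultimately show ?thesis using \<mu> by blast
qed

end

theorem corollary2p3:
  fixes T :: real
    and \<Omega> :: "'e::banach set" and \<xi>\<^sub>0 :: 'e
    and U :: "'u topology"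
    and m q :: nat
    and f :: "real \<Rightarrow> 'e \<Rightarrow> 'u \<Rightarrow> 'e" and f\<^sub>0 :: "real \<Rightarrow> 'e \<Rightarrow> 'u \<Rightarrow> real"
    and g h :: "nat \<Rightarrow> 'e \<Rightarrow> real"
    and x\<^sub>0 :: "real \<Rightarrow> 'e" and u\<^sub>0 :: "real \<Rightarrow> 'u"
    and \<iota> :: "'u \<Rightarrow> 'y::real_normed_vector"
  assumes "T > 0"
    and "open \<Omega>" and "\<Omega> \<noteq> {}" and "\<xi>\<^sub>0 \<in> \<Omega>"
    and "Hausdorff_space U"
    and "m \<ge> 1" and "q \<ge> 1"
    and "bolza_solution T \<Omega> \<xi>\<^sub>0 U m q f\<^sub>0 f g h x\<^sub>0 u\<^sub>0"
    and "integrand_regular T \<Omega> U x\<^sub>0 f\<^sub>0"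
    and "integrand_regular T \<Omega> U x\<^sub>0 f"
    and "terminal_regular \<Omega> m q g h (x\<^sub>0 T)"
  shows "(QC m q g h (x\<^sub>0 T) \<longrightarrow>
           (\<forall>l \<mu> p. pontryagin_triple T U m q f\<^sub>0 f g h x\<^sub>0 u\<^sub>0 l \<mu> p \<longrightarrow>
              (\<forall>t \<in> {0..T}. (l 0, p t) \<noteq> 0))) \<and>
         (QC m q g h (x\<^sub>0 T) \<and> Surj T U \<iota> f x\<^sub>0 u\<^sub>0 \<longrightarrow>
           (\<exists>l \<mu> p. pontryagin_triple T U m q f\<^sub>0 f g h x\<^sub>0 u\<^sub>0 l \<mu> p \<and> l 0 = 1)) \<and>
         (LI T U \<iota> m q f g h x\<^sub>0 u\<^sub>0 \<longrightarrow>
           (\<exists>l \<mu> p. pontryagin_triple T U m q f\<^sub>0 f g h x\<^sub>0 u\<^sub>0 l \<mu> p \<and> l 0 = 1)) \<and>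
         (LI T U \<iota> m q f g h x\<^sub>0 u\<^sub>0 \<and>
          gateaux_differentiable (on_image U \<iota> (f\<^sub>0 T (x\<^sub>0 T))) (\<iota> (u\<^sub>0 T)) \<longrightarrow>
           (\<exists>l \<mu> p. pontryagin_triple T U m q f\<^sub>0 f g h x\<^sub>0 u\<^sub>0 l \<mu> p \<and> l 0 = 1 \<and>
              (\<forall>l' \<mu>' p'. pontryagin_triple T U m q f\<^sub>0 f g h x\<^sub>0 u\<^sub>0 l' \<mu>' p' \<and> l' 0 = 1 \<longrightarrow>
                 (\<forall>\<alpha> \<in> {0..m}. l' \<alpha> = l \<alpha>) \<and> (\<forall>\<beta> \<in> {1..q}. \<mu>' \<beta> = \<mu> \<beta>) \<and>
                 (\<forall>t \<in> {0..T}. p' t = p t))))"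
proof -
  interpret bolza T \<Omega> \<xi>\<^sub>0 U m q f f\<^sub>0 g h x\<^sub>0 u\<^sub>0
    by unfold_locales (rule assms)+
  have iii: "\<exists>l \<mu> p. pontryagin_triple T U m q f\<^sub>0 f g h x\<^sub>0 u\<^sub>0 l \<mu> p \<and> l 0 = 1" if "LI T U \<iota> m q f g h x\<^sub>0 u\<^sub>0"
    by (rule normalised_triple) (rule triple_normal_LI[OF _ that])
  have ii: "\<exists>l \<mu> p. pontryagin_triple T U m q f\<^sub>0 f g h x\<^sub>0 u\<^sub>0 l \<mu> p \<and> l 0 = 1"
    if "QC m q g h (x\<^sub>0 T)" "Surj T U \<iota> f x\<^sub>0 u\<^sub>0"
    by (rule normalised_triple) (rule triple_normal_Surj[OF _ that])
  show ?thesis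
  proof (intro conjI impI allI ballI; (elim conjE)?)
    show "(l 0, p t) \<noteq> 0" if "QC m q g h (x\<^sub>0 T)" "pontryagin_triple T U m q f\<^sub>0 f g h x\<^sub>0 u\<^sub>0 l \<mu> p" "t \<in> {0..T}" for l \<mu> p t
      by (rule triple_not_zero[OF that(2,1,3)])
    assume li: "LI T U \<iota> m q f g h x\<^sub>0 u\<^sub>0"
      and f0: "gateaux_differentiable (on_image U \<iota> (f\<^sub>0 T (x\<^sub>0 T))) (\<iota> (u\<^sub>0 T))"
    obtain l \<mu> p where "pontryagin_triple T U m q f\<^sub>0 f g h x\<^sub>0 u\<^sub>0 l \<mu> p" "l 0 = 1" using iii[OF li] by blast
    then show "\<exists>l \<mu> p. pontryagin_triple T U m q f\<^sub>0 f g h x\<^sub>0 u\<^sub>0 l \<mu> p \<and> l 0 = 1 \<and>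
              (\<forall>l' \<mu>' p'. pontryagin_triple T U m q f\<^sub>0 f g h x\<^sub>0 u\<^sub>0 l' \<mu>' p' \<and> l' 0 = 1 \<longrightarrow>
                 (\<forall>\<alpha> \<in> {0..m}. l' \<alpha> = l \<alpha>) \<and> (\<forall>\<beta> \<in> {1..q}. \<mu>' \<beta> = \<mu> \<beta>) \<and>
                 (\<forall>t \<in> {0..T}. p' t = p t))"
      using normal_triple_unique[OF li f0] by (intro exI[of _ l] exI[of _ \<mu>] exI[of _ p]) blast
  qed (use ii iii in blast)+
qed

end
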